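(* For each multi-index $\alpha\in\mathbb{N}_0^n$ there exists $C=C(\alpha)>0$ such that $$\|D_x^\alpha P_{s,t}\|_{\mathcal{L}(L^2(\mathbb{R}^n,\nu_t),L^2(\mathbb{R}^n,\nu_s))}\le C(t-s)^{-|\alpha|/2},\quad 0<t-s<1,$$ and for each multi-index $\alpha$ and each $\omega\in(\omega_0(U),0)$ there exists $C=C(\alpha,\omega)>0$ such that $$\|D_x^\alpha P_{s,t}\|_{\mathcal{L}(L^2(\mathbb{R}^n,\nu_t),L^2(\mathbb{R}^n,\nu_s))}\le Ce^{\omega|\alpha|(t-s)},\quad t-s>1.$$
   Context: Standing assumptions. $A,B:\mathbb{R}\to\mathcal{L}(\mathbb{R}^n)$ and $f:\mathbb{R}\to\mathbb{R}^n$ are continuous and bounded. There is $\mu_0>0$ with $\|B(t)x\|\ge\mu_0\|x\|$ for all $t\in\mathbb{R}$, $x\in\mathbb{R}^n$. $U(t,s)$ ($t,s\in\mathbb{R}$) is the evolution family generated by $A(\cdot)$, i.e. $\partial_tU(t,s)=A(t)U(t,s)$, $U(s,s)=I$, and its growth bound $\omega_0(U):=\inf\{\omega\in\mathbb{R}:\exists M=M(\omega)\text{ such that }\|U(t,s)\|\le Me^{\omega(t-s)},\ -\infty<s\le t<\infty\}$ satisfies $\omega_0(U)<0$. Measures. For $-\infty\le s<t$ put $g(t,s)=\int_s^tU(t,r)f(r)\,dr$ and $Q(t,s)=\int_s^tU(t,r)B(r)B^*(r)U^*(t,r)\,dr$. $\mathcal{N}_{m,Q}$ is the Gaussian measure on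 $\mathbb{R}^n$ with mean $m$ and covariance $Q$. Set $\nu_t=\mathcal{N}_{g(t,-\infty),Q(t,-\infty)}$. Evolution operator. For $s\le t$, $P_{s,t}\varphi(x)=\int_{\mathbb{R}^n}\varphi(y+g(t,s))\,\mathcal{N}_{U(t,s)x,Q(t,s)}(dy)$ for $\varphi\in C_b(\mathbb{R}^n)$, extended by density to a bounded operator from $L^2(\mathbb{R}^n,\nu_t)$ to $L^2(\mathbb{R}^n,\nu_s)$. The constants $C$ do not depend on $s,t$. *)

theory Defs
  imports "HOL-Probability.Probability"
begin

text \<open>Operators on \<open>\<real>\<^sup>n\<close> are matrices \<open>real^'n^'n\<close>, their norm is the operator norm
  \<^term>\<open>onorm ((*v) M)\<close>, and the adjoint is the transpose.\<close>

definition evolution_family ::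
  "(real \<Rightarrow> real^'n^'n) \<Rightarrow> (real \<Rightarrow> real \<Rightarrow> real^'n^'n::finite) \<Rightarrow> bool" where
  "evolution_family A U \<longleftrightarrow>
     (\<forall>s. U s s = mat 1) \<and>
     (\<forall>t s. ((\<lambda>\<tau>. U \<tau> s) has_vector_derivative (A t ** U t s)) (at t))"

definition growth_bound :: "(real \<Rightarrow> real \<Rightarrow> real^'n^'n::finite) \<Rightarrow> real" where
  "growth_bound U =
     Inf {\<omega>. \<exists>M. \<forall>s t. s \<le> t \<longrightarrow> onorm ((*v) (U t s)) \<le> M * exp (\<omega> * (t - s))}"


text \<open>The set \<open>I\<close> is the range of integration: \<open>{s..t}\<close> gives \<open>g(t,s)\<close> and \<open>Q(t,s)\<close>,
  and \<open>{..t}\<close> gives \<open>g(t,-\<infinity>)\<close> and \<open>Q(t,-\<infinity>)\<close>.\<close>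

definition g_int ::
  "(real \<Rightarrow> real \<Rightarrow> real^'n^'n) \<Rightarrow> (real \<Rightarrow> real^'n) \<Rightarrow> real \<Rightarrow> real set \<Rightarrow> real^'n::finite" where
  "g_int U f t I = integral I (\<lambda>r. U t r *v f r)"

definition Q_int ::
  "(real \<Rightarrow> real \<Rightarrow> real^'n^'n) \<Rightarrow> (real \<Rightarrow> real^'n^'n) \<Rightarrow> real \<Rightarrow> real set \<Rightarrow> real^'n^'n::finite" where
  "Q_int U B t I =
     integral I (\<lambda>r. U t r ** B r ** transpose (B r) ** transpose (U t r))"

text \<open>The Gaussian measure with mean \<open>m\<close> and covariance \<open>Q\<close>, for \<open>Q\<close> symmetric and either
  positive definite or zero (Dirac measure). No other degenerate covariances arise:
  \<open>Q(t,s)\<close> is positive definite for \<open>s < t\<close> because \<open>B\<close> is bounded below, and \<open>Q(t,t) = 0\<close>.\<close>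

definition gaussian :: "real^'n \<Rightarrow> real^'n^'n \<Rightarrow> (real^'n::finite) measure" where
  "gaussian m Q =
     (if Q = 0 then return borel m
      else density lborel (\<lambda>x. ennreal
        (exp (- ((x - m) \<bullet> (matrix_inv Q *v (x - m))) / 2) /
         sqrt ((2 * pi) ^ CARD('n) * det Q))))"

definition evol_measure ::
  "(real \<Rightarrow> real \<Rightarrow> real^'n^'n) \<Rightarrow> (real \<Rightarrow> real^'n^'n) \<Rightarrow> (real \<Rightarrow> real^'n) \<Rightarrow> real
    \<Rightarrow> (real^'n::finite) measure" where
  "evol_measure U B f t = gaussian (g_int U f t {..t}) (Q_int U B t {..t})"


definition L2_space :: "'a measure \<Rightarrow> ('a \<Rightarrow> real) set" where
  "L2_space M = {\<phi> \<in> borel_measurable M. integrable M (\<lambda>x. (\<phi> x)\<^sup>2)}"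

definition L2_norm :: "'a measure \<Rightarrow> ('a \<Rightarrow> real) \<Rightarrow> real" where
  "L2_norm M \<phi> = sqrt (\<integral>x. (\<phi> x)\<^sup>2 \<partial>M)"

text \<open>Elements of \<open>L\<^sup>2\<close> are represented by functions, and linear operators between \<open>L\<^sup>2\<close> spaces
  by their graphs: \<open>T \<phi> v\<close> says that \<open>v\<close> represents the value of the operator at \<open>\<phi>\<close>.
  The norm is \<open>\<infinity>\<close> unless the operator is defined on all of \<open>L\<^sup>2(M)\<close>, takes values in
  \<open>L\<^sup>2(N)\<close> and is bounded.\<close>

definition L2_op_norm ::
  "'a measure \<Rightarrow> 'b measure \<Rightarrow> (('a \<Rightarrow> real) \<Rightarrow> ('b \<Rightarrow> real) \<Rightarrow> bool) \<Rightarrow> ennreal" where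
  "L2_op_norm M N T =
     Inf {ennreal K | K. 0 \<le> K \<and>
       (\<forall>\<phi> \<in> L2_space M. (\<exists>v. T \<phi> v) \<and>
          (\<forall>v. T \<phi> v \<longrightarrow> v \<in> L2_space N \<and> L2_norm N v \<le> K * L2_norm M \<phi>))}"


definition evol_Cb ::
  "(real \<Rightarrow> real \<Rightarrow> real^'n^'n) \<Rightarrow> (real \<Rightarrow> real^'n^'n) \<Rightarrow> (real \<Rightarrow> real^'n) \<Rightarrow> real \<Rightarrow> real
    \<Rightarrow> (real^'n \<Rightarrow> real) \<Rightarrow> real^'n::finite \<Rightarrow> real" where
  "evol_Cb U B f s t \<phi> x =
     (\<integral>y. \<phi> (y + g_int U f t {s..t}) \<partial>gaussian (U t s *v x) (Q_int U B t {s..t}))"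

text \<open>The extension by density of \<open>P\<^bsub>s,t\<^esub>\<close> from \<open>C\<^sub>b\<close> to \<open>L\<^sup>2\<close>: its graph is the closure in
  \<open>L\<^sup>2(\<nu>\<^sub>t) \<times> L\<^sup>2(\<nu>\<^sub>s)\<close> of the graph of \<open>P\<^bsub>s,t\<^esub>\<close> on \<open>C\<^sub>b\<close>.\<close>

definition evol_L2 ::
  "(real \<Rightarrow> real \<Rightarrow> real^'n^'n) \<Rightarrow> (real \<Rightarrow> real^'n^'n) \<Rightarrow> (real \<Rightarrow> real^'n) \<Rightarrow> real \<Rightarrow> real
    \<Rightarrow> (real^'n \<Rightarrow> real) \<Rightarrow> (real^'n::finite \<Rightarrow> real) \<Rightarrow> bool" where
  "evol_L2 U B f s t \<phi> u \<longleftrightarrow>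
     \<phi> \<in> L2_space (evol_measure U B f t) \<and> u \<in> L2_space (evol_measure U B f s) \<and>
     (\<exists>\<Phi>. (\<forall>k::nat. \<Phi> k \<in> bcontfun \<and>
              evol_Cb U B f s t (\<Phi> k) \<in> L2_space (evol_measure U B f s)) \<and>
        (\<lambda>k. L2_norm (evol_measure U B f t) (\<lambda>x. \<Phi> k x - \<phi> x)) \<longlonglongrightarrow> 0 \<and>
        (\<lambda>k. L2_norm (evol_measure U B f s) (\<lambda>x. evol_Cb U B f s t (\<Phi> k) x - u x))
          \<longlonglongrightarrow> 0)"


definition partial_deriv :: "'n \<Rightarrow> (real^'n \<Rightarrow> real) \<Rightarrow> real^'n::finite \<Rightarrow> real" where
  "partial_deriv i u x = frechet_derivative u (at x) (axis i 1)"

definition partial_derivs :: "'n list \<Rightarrow> (real^'n \<Rightarrow> real) \<Rightarrow> real^'n::finite \<Rightarrow> real" where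
  "partial_derivs is u = foldr partial_deriv is u"

definition C_k :: "nat \<Rightarrow> (real^'n::finite \<Rightarrow> real) \<Rightarrow> bool" where
  "C_k k u \<longleftrightarrow>
     (\<forall>is. length is < k \<longrightarrow> partial_derivs is u differentiable_on UNIV) \<and>
     (\<forall>is. length is \<le> k \<longrightarrow> continuous_on UNIV (partial_derivs is u))"

definition mindex_order :: "('n::finite \<Rightarrow> nat) \<Rightarrow> nat" where
  "mindex_order \<alpha> = (\<Sum>i\<in>UNIV. \<alpha> i)"

text \<open>Differentiate \<open>\<alpha> i\<close> times in the direction \<open>i\<close>; the order in which this is done is
  irrelevant for functions of class \<open>C\<^sup>k\<close>, \<open>k = |\<alpha>|\<close>.\<close>

definition mindex_deriv ::
  "('n \<Rightarrow> nat) \<Rightarrow> (real^'n \<Rightarrow> real) \<Rightarrow> real^'n::finite \<Rightarrow> real" where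
  "mindex_deriv \<alpha> u = partial_derivs (SOME is. \<forall>i. count_list is i = \<alpha> i) u"

text \<open>The graph of \<open>D\<^sub>x\<^sup>\<alpha> P\<^bsub>s,t\<^esub>\<close>. An \<open>L\<^sup>2\<close> class is differentiated classically, via its
  representative of class \<open>C\<^sup>k\<close>, \<open>k = |\<alpha>|\<close>; the value is undefined if there is none. The
  representative is unique because the nondegenerate Gaussian measure \<open>\<nu>\<^sub>s\<close> has full support.\<close>

definition deriv_evol_L2 ::
  "(real \<Rightarrow> real \<Rightarrow> real^'n^'n) \<Rightarrow> (real \<Rightarrow> real^'n^'n) \<Rightarrow> (real \<Rightarrow> real^'n) \<Rightarrow> ('n \<Rightarrow> nat)
    \<Rightarrow> real \<Rightarrow> real \<Rightarrow> (real^'n \<Rightarrow> real) \<Rightarrow> (real^'n::finite \<Rightarrow> real) \<Rightarrow> bool" where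
  "deriv_evol_L2 U B f \<alpha> s t \<phi> v \<longleftrightarrow>
     (\<exists>u. evol_L2 U B f s t \<phi> u \<and> C_k (mindex_order \<alpha>) u \<and> v = mindex_deriv \<alpha> u)"

end

theory Submission
  imports Defs
begin

text \<open>
  Write \<open>P\<^bsub>s,t\<^esub>\<close> as an integral operator with the Gaussian kernel
  \<open>\<rho>(z - U(t,s)x - g(t,s))\<close>, \<open>\<rho>\<close> the density of \<open>N(0,Q(t,s))\<close>. Its \<open>x\<close>-derivatives of
  order \<open>k\<close> are \<open>\<rho>\<close> times a Hermite-like polynomial of size \<open>\<kappa>\<^sup>k\<close>, where \<open>\<kappa>\<close> bounds
  \<open>Q(t,s)\<^sup>-\<^sup>1\<^sup>/\<^sup>2 U(t,s)\<close>. Cauchy--Schwarz with respect to \<open>\<rho>\<close> gives the pointwise estimate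
  \<open>(D\<^sup>\<alpha> P \<phi>)\<^sup>2 \<le> c \<kappa>\<^sup>2\<^sup>k P(\<phi>\<^sup>2)\<close>, and the invariance \<open>\<integral> P \<psi> d\<nu>\<^sub>s = \<integral> \<psi> d\<nu>\<^sub>t\<close> turns it into the
  \<open>L\<^sup>2\<close> bound \<open>\<parallel>D\<^sup>\<alpha> P\<parallel> \<le> C \<kappa>\<^sup>k\<close>. Finally \<open>Q(t,s) \<ge> c min(t - s, 1)\<close>, so \<open>\<kappa> \<le> C (t - s)\<^sup>-\<^sup>1\<^sup>/\<^sup>2\<close> for
  small \<open>t - s\<close> and \<open>\<kappa> \<le> C exp(\<omega>(t - s))\<close> otherwise.
\<close>

section \<open>Derivatives of the Gaussian kernel\<close>

text \<open>Two demands shape the proof. The constant must be uniform in s and t, so the estimates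
  keep track of \<open>\<kappa>\<close>, and all else depends on k and n only. And phi is merely in
  L2(nu_t): all x-derivatives fall on the kernel, and phi must be integrable against kernels centred
  at every x, while L2(nu_t) speaks of one Gaussian. The exponents are a budget against the 1/2 of
  the Gaussian. A Hermite-like factor costs 1/16, leaving 7/16; moving x in a unit ball costs
  another 1/16, leaving 3/8. As 3/8 exceeds 1/4, phi exp(-3/8 |w|^2) is still integrable if phi^2
  exp(-1/2 |w|^2) is. In Cauchy--Schwarz the squared factor costs 1/8, and the remaining Gaussian
  integral is (4/3)^(n/2) whatever Q is. The operator is given as a closed graph, so its values must
  be identified: the kernel integral is a value at phi, and the only continuous one. For t - s > 1
  the smoothing is drawn from the last unit of time, while the decay of U is taken over the whole
  interval.\<close>

lemma has_derivative_partial_deriv: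
  fixes f :: "real^'n::finite \<Rightarrow> real"
  assumes "f differentiable (at x)"
  shows "(f has_derivative (\<lambda>h. \<Sum>i\<in>UNIV. h $ i * partial_deriv i f x)) (at x)"
proof -
  let ?D = "frechet_derivative f (at x)"
  have D: "(f has_derivative ?D) (at x)"
    using assms frechet_derivative_works by blast
  then have lin: "linear ?D"
    by (rule has_derivative_linear)
  have "?D h = (\<Sum>i\<in>UNIV. h $ i * partial_deriv i f x)" for h
  proof -
    have "?D h = ?D (\<Sum>i\<in>UNIV. h $ i *\<^sub>R axis i 1)"
      using basis_expansion[of h] by (simp add: scalar_mult_eq_scaleR)
    also have "\<dots> = (\<Sum>i\<in>UNIV. h $ i * partial_deriv i f x)"
      by (simp add: linear_sum[OF lin] linear_cmul[OF lin] partial_deriv_def)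
    finally show ?thesis .
  qed
  then show ?thesis
    using D by presburger
qed

lemma partial_deriv_eqI:
  assumes "(f has_derivative D) (at x)"
  shows "partial_deriv i f x = D (axis i 1)"
  using frechet_derivative_at[OF assms] by (simp add: partial_deriv_def)

lemma partial_derivs_Nil [simp]: "partial_derivs [] u = u"
  by (simp add: partial_derivs_def)

lemma partial_derivs_Cons [simp]:
  "partial_derivs (i # is) u = partial_deriv i (partial_derivs is u)"
  by (simp add: partial_derivs_def)

text \<open>\<open>weighted_poly e k C F\<close>: \<open>F\<close> is a polynomial in \<open>w\<close> built from the linear forms \<open>e i \<bullet> w\<close>
  (weight 1) and the constants \<open>e i \<bullet> e j\<close> (weight 2), homogeneous of weight \<open>k\<close>. The constant \<open>C\<close>
  counts monomials; it depends on \<open>k\<close> only and not on \<open>e\<close>, which later makes the estimates uniform in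
  \<open>s\<close> and \<open>t\<close>.\<close>

inductive weighted_poly ::
  "('n \<Rightarrow> 'a::real_inner) \<Rightarrow> nat \<Rightarrow> real \<Rightarrow> ('a \<Rightarrow> real) \<Rightarrow> bool" for e where
  zero: "weighted_poly e k 0 (\<lambda>w. 0)"
| one: "weighted_poly e 0 1 (\<lambda>w. 1)"
| lin: "weighted_poly e k C F \<Longrightarrow> weighted_poly e (Suc k) C (\<lambda>w. (e i \<bullet> w) * F w)"
| ip: "weighted_poly e k C F \<Longrightarrow> weighted_poly e (Suc (Suc k)) C (\<lambda>w. (e i \<bullet> e j) * F w)"
| add: "weighted_poly e k C F \<Longrightarrow> weighted_poly e k D G
    \<Longrightarrow> weighted_poly e k (C + D) (\<lambda>w. F w + G w)"
| neg: "weighted_poly e k C F \<Longrightarrow> weighted_poly e k C (\<lambda>w. - F w)"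
| mono: "weighted_poly e k C F \<Longrightarrow> C \<le> D \<Longrightarrow> weighted_poly e k D F"

lemma weighted_poly_nonneg: "weighted_poly e k C F \<Longrightarrow> 0 \<le> C"
  by (induction rule: weighted_poly.induct) auto

text \<open>A linear form is at most kappa |w| and a constant \<open>e i \<bullet> e j\<close> at
  most kappa^2; the weights 1 and 2 record exactly these powers of kappa. The summand 1 in
  \<open>1 + norm w\<close> absorbs monomials whose degree in w is below k.\<close>

lemma weighted_poly_bound:
  assumes "weighted_poly e k C F" and e: "\<And>i. norm (e i) \<le> \<kappa>" and "0 \<le> \<kappa>"
  shows "\<bar>F w\<bar> \<le> C * (\<kappa> * (1 + norm w)) ^ k"
  using assms(1)
proof (induction rule: weighted_poly.induct)
  case (lin k C F i)
  have "\<bar>e i \<bullet> w\<bar> \<le> \<kappa> * (1 + norm w)"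
    using Cauchy_Schwarz_ineq2[of "e i" w] mult_mono[OF e[of i] order_refl[of "norm w"]] \<open>0 \<le> \<kappa>\<close>
    by (simp add: algebra_simps)
  from mult_mono[OF this lin.IH] show ?case
    using \<open>0 \<le> \<kappa>\<close> by (simp add: abs_mult mult_ac)
next
  case (ip k C F i j)
  have "\<bar>e i \<bullet> e j\<bar> \<le> norm (e i) * norm (e j)"
    by (rule Cauchy_Schwarz_ineq2)
  also have "\<dots> \<le> (\<kappa> * (1 + norm w)) * (\<kappa> * (1 + norm w))"
  proof -
    have "norm (e i) \<le> \<kappa> * (1 + norm w)" for i
      using e[of i] mult_left_mono[of 1 "1 + norm w" \<kappa>] \<open>0 \<le> \<kappa>\<close> by simp
    then show ?thesis
      by (intro mult_mono) (auto simp: \<open>0 \<le> \<kappa>\<close>)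
  qed
  finally have "\<bar>e i \<bullet> e j\<bar> \<le> (\<kappa> * (1 + norm w)) * (\<kappa> * (1 + norm w))" .
  from mult_mono[OF this ip.IH] show ?case
    using \<open>0 \<le> \<kappa>\<close> by (simp add: abs_mult mult_ac)
next
  case (add k C F D G)
  then show ?case
    using abs_triangle_ineq[of "F w" "G w"] by (simp add: distrib_right)
next
  case (mono k C F D)
  have "C * (\<kappa> * (1 + norm w)) ^ k \<le> D * (\<kappa> * (1 + norm w)) ^ k"
    using mono \<open>0 \<le> \<kappa>\<close> by (intro mult_right_mono) auto
  then show ?case
    using mono by linarith
qed auto

text \<open>By the product rule, a derivative in direction \<open>e i\<close> replaces one linear
  factor (weight 1) by a constant (weight 2). A monomial of weight k has at most k linear factors,
  hence the factor k in the count.\<close>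

lemma weighted_poly_deriv:
  assumes "weighted_poly e k C F"
  shows "\<exists>DF. (\<forall>w. (F has_derivative DF w) (at w)) \<and>
           (\<forall>i. weighted_poly e (Suc k) (real k * C) (\<lambda>w. DF w (e i)))"
  using assms
proof (induction rule: weighted_poly.induct)
  case (zero k)
  then show ?case
    using weighted_poly.zero[of e "Suc k"] by (intro exI[of _ "\<lambda>w h. 0"]) auto
next
  case one
  then show ?case
    using weighted_poly.zero[of e "Suc 0"] by (intro exI[of _ "\<lambda>w h. 0"]) auto
next
  case (lin k C F i)
  then obtain DF where D: "\<And>w. (F has_derivative DF w) (at w)"
    and W: "\<And>i. weighted_poly e (Suc k) (real k * C) (\<lambda>w. DF w (e i))"
    by blast
  have "((\<lambda>w. (e i \<bullet> w) * F w) has_derivative (\<lambda>h. (e i \<bullet> h) * F w + (e i \<bullet> w) * DF w h)) (at w)"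
    for w
    by (auto intro!: derivative_eq_intros D simp: algebra_simps)
  moreover have "weighted_poly e (Suc (Suc k)) (real (Suc k) * C)
      (\<lambda>w. (e i \<bullet> e j) * F w + (e i \<bullet> w) * DF w (e j))" for j
    using weighted_poly.add[OF weighted_poly.ip[OF lin.hyps(1), of i j] weighted_poly.lin[OF W[of j], of i]]
    by (simp add: algebra_simps)
  ultimately show ?case
    by (intro exI[of _ "\<lambda>w h. (e i \<bullet> h) * F w + (e i \<bullet> w) * DF w h"]) blast
next
  case (ip k C F i j)
  then obtain DF where D: "\<And>w. (F has_derivative DF w) (at w)"
    and W: "\<And>i. weighted_poly e (Suc k) (real k * C) (\<lambda>w. DF w (e i))"
    by blast
  have le: "real k * C \<le> real (Suc (Suc k)) * C"
    using weighted_poly_nonneg[OF ip.hyps(1)] by (intro mult_right_mono) auto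
  have "((\<lambda>w. (e i \<bullet> e j) * F w) has_derivative (\<lambda>h. (e i \<bullet> e j) * DF w h)) (at w)" for w
    by (auto intro!: derivative_eq_intros D simp: algebra_simps)
  moreover have "weighted_poly e (Suc (Suc (Suc k))) (real (Suc (Suc k)) * C)
      (\<lambda>w. (e i \<bullet> e j) * DF w (e l))" for l
    by (rule weighted_poly.mono[OF weighted_poly.ip[OF W] le])
  ultimately show ?case
    by (intro exI[of _ "\<lambda>w h. (e i \<bullet> e j) * DF w h"]) blast
next
  case (add k C F D G)
  then obtain DF DG where D: "\<And>w. (F has_derivative DF w) (at w)" "\<And>w. (G has_derivative DG w) (at w)"
    and W: "\<And>i. weighted_poly e (Suc k) (real k * C) (\<lambda>w. DF w (e i))"
      "\<And>i. weighted_poly e (Suc k) (real k * D) (\<lambda>w. DG w (e i))"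
    by blast
  show ?case
    using weighted_poly.add[OF W]
    by (intro exI[of _ "\<lambda>w h. DF w h + DG w h"]) (auto intro!: derivative_intros D simp: algebra_simps)
next
  case (neg k C F)
  then obtain DF where D: "\<And>w. (F has_derivative DF w) (at w)"
    and W: "\<And>i. weighted_poly e (Suc k) (real k * C) (\<lambda>w. DF w (e i))"
    by blast
  show ?case
    using weighted_poly.neg[OF W]
    by (intro exI[of _ "\<lambda>w h. - DF w h"]) (auto intro!: derivative_intros D)
next
  case (mono k C F D)
  then obtain DF where D: "\<And>w. (F has_derivative DF w) (at w)"
    and W: "\<And>i. weighted_poly e (Suc k) (real k * C) (\<lambda>w. DF w (e i))"
    by blast
  have le: "real k * C \<le> real k * D"
    by (intro mult_left_mono mono.hyps) auto
  show ?case
    using D weighted_poly.mono[OF W le] by (intro exI[of _ DF]) auto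
qed

definition gauss_kernel :: "'a::real_inner \<Rightarrow> real" where
  "gauss_kernel w = exp (- (norm w)\<^sup>2 / 2)"

lemma has_derivative_gauss_kernel:
  "(gauss_kernel has_derivative (\<lambda>h. - (w \<bullet> h) * gauss_kernel w)) (at w)"
  unfolding gauss_kernel_def power2_norm_eq_inner
  by (auto intro!: derivative_eq_intros simp: inner_commute algebra_simps)

lemma has_derivative_matrix_vector_mult:
  fixes V :: "real^'m::finite^'n::finite"
  shows "((\<lambda>x. y - V *v x) has_derivative (\<lambda>h. - (V *v h))) (at x)"
  by (auto intro!: derivative_eq_intros bounded_linear_imp_has_derivative
      matrix_vector_mul_bounded_linear)

text \<open>The Hermite recursion F -> -DF(e_i) + (e_i . w) F; its count obeys k * k! + k! = (k+1)!.
  One F serves every y, as is needed once y becomes an integration variable.\<close>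

lemma partial_derivs_gauss_kernel:
  fixes V :: "real^'m::finite^'n::finite" and "is" :: "'m list"
  shows "\<exists>F. weighted_poly (\<lambda>i. V *v axis i 1) (length is) (fact (length is)) F \<and>
    (\<forall>y. partial_derivs is (\<lambda>x. gauss_kernel (y - V *v x)) =
       (\<lambda>x. F (y - V *v x) * gauss_kernel (y - V *v x)))"
proof (induction "is")
  case Nil
  then show ?case
    using weighted_poly.one by (intro exI[of _ "\<lambda>w. 1"]) auto
next
  case (Cons i "is")
  let ?e = "\<lambda>i. V *v axis i 1" and ?k = "length is"
  from Cons obtain F where F: "weighted_poly ?e ?k (fact ?k) F"
    and eq: "\<And>y. partial_derivs is (\<lambda>x. gauss_kernel (y - V *v x)) =
       (\<lambda>x. F (y - V *v x) * gauss_kernel (y - V *v x))"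
    by blast
  from weighted_poly_deriv[OF F] obtain DF where D: "\<And>w. (F has_derivative DF w) (at w)"
    and W: "\<And>i. weighted_poly ?e (Suc ?k) (real ?k * fact ?k) (\<lambda>w. DF w (?e i))"
    by blast
  let ?G = "\<lambda>w. - DF w (?e i) + (?e i \<bullet> w) * F w"
  have "partial_deriv i (\<lambda>x. F (y - V *v x) * gauss_kernel (y - V *v x)) x =
      ?G (y - V *v x) * gauss_kernel (y - V *v x)" for x y
  proof -
    let ?w = "y - V *v x"
    have lin: "linear (DF ?w)"
      by (rule has_derivative_linear[OF D])
    have "((\<lambda>x. F (y - V *v x) * gauss_kernel (y - V *v x)) has_derivative
       (\<lambda>h. F ?w * (- (?w \<bullet> (- (V *v h))) * gauss_kernel ?w) + DF ?w (- (V *v h)) * gauss_kernel ?w)) (at x)"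
      by (intro has_derivative_mult has_derivative_compose[OF has_derivative_matrix_vector_mult D]
          has_derivative_compose[OF has_derivative_matrix_vector_mult has_derivative_gauss_kernel])
    from partial_deriv_eqI[OF this, of i] show ?thesis
      by (simp add: linear_neg[OF lin] inner_commute algebra_simps)
  qed
  moreover have "weighted_poly ?e (Suc ?k) (fact (Suc ?k)) ?G"
    using weighted_poly.add[OF weighted_poly.neg[OF W[of i]] weighted_poly.lin[OF F, of i]]
    by (simp add: algebra_simps)
  ultimately show ?case
    by (intro exI[of _ ?G]) (auto simp: eq)
qed

section \<open>Absorbing polynomial factors into a Gaussian\<close>

lemma power_le_exp:
  fixes x :: real
  assumes "0 \<le> x"
  shows "x ^ k \<le> fact k * exp x"
proof -
  have "(\<Sum>n<Suc k. x ^ n / fact n) \<le> exp x"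
    using assms exp_lower_Taylor_quadratic
    by (metis (no_types, lifting) divide_nonneg_pos exp_converges fact_gt_zero inverse_eq_divide
        mult.commute divide_real_def real_scaleR_def sum_le_suminf sums_iff zero_le_power finite_lessThan
        sum.cong suminf_cong)
  moreover have "x ^ k / fact k \<le> (\<Sum>n<Suc k. x ^ n / fact n)"
    using assms by (intro member_le_sum[of k]) auto
  ultimately show ?thesis
    by (simp add: field_simps)
qed

text \<open>The exponent 1/16 is a choice: its double 1/8 has to stay below 1/2, with room for a
  shift of x. The base 32 comes from (1 + r)^2 <= 2 (1 + r^2) = 32 (1 + r^2) / 16.\<close>

lemma one_plus_power_le_exp:
  fixes r :: real
  assumes "0 \<le> r"
  shows "(1 + r) ^ k \<le> 32 ^ k * fact k * exp (1 / 16) * exp (r\<^sup>2 / 16)"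
proof -
  have "1 + r \<le> (1 + r)\<^sup>2"
    using assms by (simp add: power2_eq_square algebra_simps)
  also have "\<dots> \<le> 32 * ((1 + r\<^sup>2) / 16)"
    using sum_squares_ge_zero[of "1 - r" 0] by (simp add: power2_eq_square algebra_simps)
  finally have "(1 + r) ^ k \<le> (32 * ((1 + r\<^sup>2) / 16)) ^ k"
    using assms by (intro power_mono) auto
  also have "\<dots> = 32 ^ k * ((1 + r\<^sup>2) / 16) ^ k"
    by (rule power_mult_distrib)
  also have "\<dots> \<le> 32 ^ k * (fact k * exp ((1 + r\<^sup>2) / 16))"
    by (intro mult_left_mono power_le_exp) auto
  also have "\<dots> = 32 ^ k * fact k * exp (1 / 16) * exp (r\<^sup>2 / 16)"
    by (simp add: add_divide_distrib exp_add)
  finally show ?thesis .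
qed

text \<open>One factorial counts monomials, the other comes from x^k <= k! e^x.\<close>

definition herm_const :: "nat \<Rightarrow> real" where
  "herm_const k = (fact k)\<^sup>2 * 32 ^ k * exp (1 / 16)"

lemma herm_const_pos: "0 < herm_const k"
  by (simp add: herm_const_def)

lemma weighted_poly_exp_bound:
  assumes "weighted_poly e k (fact k) F" and "\<And>i. norm (e i) \<le> \<kappa>" and "0 \<le> \<kappa>"
  shows "\<bar>F w\<bar> \<le> herm_const k * \<kappa> ^ k * exp ((norm w)\<^sup>2 / 16)"
proof -
  have "\<bar>F w\<bar> \<le> fact k * (\<kappa> * (1 + norm w)) ^ k"
    by (rule weighted_poly_bound[OF assms])
  also have "\<dots> = fact k * \<kappa> ^ k * (1 + norm w) ^ k"
    by (simp add: power_mult_distrib)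
  also have "\<dots> \<le> fact k * \<kappa> ^ k * (32 ^ k * fact k * exp (1 / 16) * exp ((norm w)\<^sup>2 / 16))"
    using assms(3) by (intro mult_left_mono one_plus_power_le_exp) auto
  finally show ?thesis
    by (simp add: herm_const_def power2_eq_square mult_ac)
qed

section \<open>Differentiation under the integral\<close>

lemma onorm_sum_components_le:
  fixes a :: "'n::finite \<Rightarrow> real"
  assumes "\<And>i. \<bar>a i\<bar> \<le> b"
  shows "onorm (\<lambda>h::real^'n. \<Sum>i\<in>UNIV. h $ i * a i) \<le> real CARD('n) * b"
proof (rule onorm_le)
  fix h :: "real^'n"
  have "norm (\<Sum>i\<in>UNIV. h $ i * a i) \<le> (\<Sum>i\<in>(UNIV::'n set). norm h * b)"
  proof (rule sum_norm_le)
    fix i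
    show "norm (h $ i * a i) \<le> norm h * b"
      using component_le_norm_cart[of h i] assms[of i] by (simp add: abs_mult mult_mono)
  qed
  then show "norm (\<Sum>i\<in>UNIV. h $ i * a i) \<le> real CARD('n) * b * norm h"
    by (simp add: mult_ac)
qed

text \<open>A second order Taylor bound on the kernel replaces dominated convergence: integrating it
  against \<open>\<phi>\<close> yields the derivative of the integral directly.\<close>

lemma second_order_bound:
  fixes f :: "real^'n::finite \<Rightarrow> real"
  assumes f: "\<And>x. f differentiable (at x)"
    and pf: "\<And>i x. partial_deriv i f differentiable (at x)"
    and G: "\<And>i j \<xi>. \<xi> \<in> cball x 1 \<Longrightarrow> \<bar>partial_deriv j (partial_deriv i f) \<xi>\<bar> \<le> G"
    and h: "norm h \<le> 1"
  shows "\<bar>f (x + h) - f x - (\<Sum>i\<in>UNIV. h $ i * partial_deriv i f x)\<bar>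
      \<le> (real CARD('n))\<^sup>2 * G * (norm h)\<^sup>2"
proof -
  let ?S = "cball x (norm h)" and ?n = "real CARD('n)"
  let ?D = "\<lambda>f x h. \<Sum>i\<in>UNIV. h $ i * partial_deriv i f x"
  have G0: "0 \<le> G"
    using G[of x] by (force intro: order_trans[OF abs_ge_zero])
  \<comment> \<open>The mean value inequality is used twice: here for the first partials, then for f
    minus its linear part, whose derivative is controlled by this bound.\<close>
  have 1: "\<bar>partial_deriv i f \<xi> - partial_deriv i f x\<bar> \<le> ?n * G * norm h" if \<xi>: "\<xi> \<in> ?S" for i \<xi>
  proof -
    have "norm (partial_deriv i f \<xi> - partial_deriv i f x) \<le> ?n * G * norm (\<xi> - x)"
    proof (rule differentiable_bound[where S = ?S and f' = "\<lambda>\<xi>. ?D (partial_deriv i f) \<xi>"])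
      show "(partial_deriv i f has_derivative ?D (partial_deriv i f) y) (at y within ?S)" for y
        using has_derivative_partial_deriv[OF pf] has_derivative_at_withinI by blast
      show "onorm (?D (partial_deriv i f) y) \<le> ?n * G" if "y \<in> ?S" for y
        using that h by (intro onorm_sum_components_le G) (auto simp: dist_norm)
    qed (use \<xi> in auto)
    also have "\<dots> \<le> ?n * G * norm h"
      using \<xi> G0 by (intro mult_left_mono) (auto simp: dist_norm norm_minus_commute)
    finally show ?thesis
      by simp
  qed
  have "norm (f (x + h) - f x - ?D f x (x + h - x)) \<le> norm (x + h - x) * (?n * (?n * G * norm h))"
  proof (rule differentiable_bound_linearization[where S = ?S and f' = "\<lambda>\<xi>. ?D f \<xi>" and ?x0.0 = x])
    show "x + t *\<^sub>R (x + h - x) \<in> ?S" if "t \<in> {0..1}" for t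
      using that by (auto simp: dist_norm intro: mult_left_le_one_le)
    show "(f has_derivative ?D f y) (at y within ?S)" for y
      using has_derivative_partial_deriv[OF f] has_derivative_at_withinI by blast
    show "onorm (?D f y - ?D f x) \<le> ?n * (?n * G * norm h)" if "y \<in> ?S" for y
    proof -
      have "?D f y - ?D f x = (\<lambda>h. \<Sum>i\<in>UNIV. h $ i * (partial_deriv i f y - partial_deriv i f x))"
        by (auto simp: sum_subtractf right_diff_distrib)
      then show ?thesis
        using onorm_sum_components_le[of "\<lambda>i. partial_deriv i f y - partial_deriv i f x", OF 1[OF that]]
        by simp
    qed
  qed auto
  then show ?thesis
    by (simp add: power2_eq_square mult_ac)
qed

lemma has_derivative_quadratic_remainder:
  fixes f :: "'a::real_normed_vector \<Rightarrow> real"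
  assumes D: "bounded_linear D"
    and A: "\<And>h. norm h \<le> 1 \<Longrightarrow> \<bar>f (x + h) - f x - D h\<bar> \<le> A * (norm h)\<^sup>2"
  shows "(f has_derivative D) (at x)"
proof (rule has_derivativeI_sandwich[of 1, OF _ D])
  show "norm ((f y - f x) - D (y - x)) / norm (y - x) \<le> A * norm (y - x)"
    if "y \<in> UNIV" "y \<noteq> x" "dist y x < 1" for y
    using A[of "y - x"] that by (simp add: dist_norm power2_eq_square divide_le_eq mult_ac)
  have "((\<lambda>y. A * norm (y - x)) \<longlongrightarrow> A * norm (x - x)) (at x)"
    by (intro tendsto_intros)
  then show "((\<lambda>y. A * norm (y - x)) \<longlongrightarrow> 0) (at x)"
    by simp
qed simp

text \<open>The difference of the exponents is |a - 7b|^2 / 16 + 3/8 |b|^2. Giving up 1/16 of the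
  exponent makes the bound uniform for b in a bounded set, so kernels centred near x have a majorant
  centred at x.\<close>

lemma gauss_exp_shift:
  fixes a b :: "'a::real_inner"
  shows "exp (- (7 / 16) * (norm (a - b))\<^sup>2) \<le> exp (3 * (norm b)\<^sup>2) * exp (- (3 / 8) * (norm a)\<^sup>2)"
proof -
  have "0 \<le> (norm (a - 7 *\<^sub>R b))\<^sup>2"
    by simp
  then have "14 * (a \<bullet> b) \<le> a \<bullet> a + 49 * (b \<bullet> b)"
    unfolding power2_norm_eq_inner by (simp add: inner_diff inner_commute algebra_simps)
  moreover have "0 \<le> b \<bullet> b"
    by simp
  ultimately have "- (7 / 16) * (norm (a - b))\<^sup>2 \<le> 3 * (norm b)\<^sup>2 + - (3 / 8) * (norm a)\<^sup>2"
    unfolding power2_norm_eq_inner inner_diff inner_commute[of b a]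
    by (simp add: field_simps) (use inner_ge_zero[of b] in linarith)
  then show ?thesis
    unfolding exp_add[symmetric] by (rule iffD2[OF exp_le_cancel_iff])
qed

text \<open>Here 7/16 = 1/2 - 1/16. This bound only justifies differentiation under the integral, so
  C may depend on V.\<close>

lemma partial_derivs_gauss_kernel_bound:
  fixes V :: "real^'m::finite^'n::finite"
  shows "\<exists>C\<ge>0. \<forall>y x. \<bar>partial_derivs is (\<lambda>x. gauss_kernel (y - V *v x)) x\<bar>
    \<le> C * exp (- (7 / 16) * (norm (y - V *v x))\<^sup>2)"
proof -
  obtain F where F: "weighted_poly (\<lambda>i. V *v axis i 1) (length is) (fact (length is)) F"
    and eq: "\<And>y. partial_derivs is (\<lambda>x. gauss_kernel (y - V *v x)) =
       (\<lambda>x. F (y - V *v x) * gauss_kernel (y - V *v x))"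
    using partial_derivs_gauss_kernel[of V "is"] by blast
  let ?\<kappa> = "\<Sum>i\<in>UNIV. norm (V *v axis i 1)"
  let ?C = "herm_const (length is) * ?\<kappa> ^ length is"
  have \<kappa>: "norm (V *v axis i 1) \<le> ?\<kappa>" for i
    by (rule member_le_sum) auto
  have \<kappa>0: "0 \<le> ?\<kappa>"
    by (rule sum_nonneg) auto
  have "\<bar>F w * gauss_kernel w\<bar> \<le> ?C * exp (- (7 / 16) * (norm w)\<^sup>2)" for w
  proof -
    have "\<bar>F w * gauss_kernel w\<bar> \<le> ?C * exp ((norm w)\<^sup>2 / 16) * exp (- (norm w)\<^sup>2 / 2)"
      using weighted_poly_exp_bound[OF F \<kappa> \<kappa>0, of w]
      by (simp add: abs_mult gauss_kernel_def mult_right_mono)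
    also have "\<dots> = ?C * exp ((norm w)\<^sup>2 / 16 + (- (norm w)\<^sup>2 / 2))"
      by (simp only: exp_add mult.assoc)
    also have "(norm w)\<^sup>2 / 16 + (- (norm w)\<^sup>2 / 2) = - (7 / 16) * (norm w)\<^sup>2"
      by simp
    finally show ?thesis .
  qed
  then show ?thesis
    using \<kappa>0 herm_const_pos[of "length is"] by (intro exI[of _ ?C]) (auto simp: eq)
qed

lemma partial_derivs_gauss_kernel_differentiable:
  fixes V :: "real^'m::finite^'n::finite"
  shows "partial_derivs is (\<lambda>x. gauss_kernel (y - V *v x)) differentiable (at x)"
proof -
  obtain F where F: "weighted_poly (\<lambda>i. V *v axis i 1) (length is) (fact (length is)) F"
    and eq: "\<And>y. partial_derivs is (\<lambda>x. gauss_kernel (y - V *v x)) =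
       (\<lambda>x. F (y - V *v x) * gauss_kernel (y - V *v x))"
    using partial_derivs_gauss_kernel[of V "is"] by blast
  from weighted_poly_deriv[OF F] obtain DF where D: "\<And>w. (F has_derivative DF w) (at w)"
    by blast
  have "((\<lambda>x. F (y - V *v x)) has_derivative (\<lambda>h. DF (y - V *v x) (- (V *v h)))) (at x)"
    "((\<lambda>x. gauss_kernel (y - V *v x)) has_derivative
       (\<lambda>h. - ((y - V *v x) \<bullet> (- (V *v h))) * gauss_kernel (y - V *v x))) (at x)"
    by (rule has_derivative_compose[OF has_derivative_matrix_vector_mult D]
          has_derivative_compose[OF has_derivative_matrix_vector_mult has_derivative_gauss_kernel])+
  then show ?thesis
    unfolding eq differentiable_def using has_derivative_mult by blast
qed

lemma measurable_partial_derivs_gauss_kernel: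
  fixes V :: "real^'m::finite^'n::finite"
  assumes Y: "Y \<in> borel_measurable M"
  shows "(\<lambda>z. partial_derivs is (\<lambda>x. gauss_kernel (Y z - V *v x)) x) \<in> borel_measurable M"
proof -
  obtain F where F: "weighted_poly (\<lambda>i. V *v axis i 1) (length is) (fact (length is)) F"
    and eq: "\<And>y. partial_derivs is (\<lambda>x. gauss_kernel (y - V *v x)) =
       (\<lambda>x. F (y - V *v x) * gauss_kernel (y - V *v x))"
    using partial_derivs_gauss_kernel[of V "is"] by blast
  from weighted_poly_deriv[OF F] obtain DF where D: "\<And>w. (F has_derivative DF w) (at w)"
    by blast
  then have "continuous_on UNIV F"
    by (meson has_derivative_continuous continuous_at_imp_continuous_on)
  then have [measurable]: "F \<in> borel_measurable borel"
    by (rule borel_measurable_continuous_onI)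
  have [measurable]: "gauss_kernel \<in> borel_measurable borel"
    unfolding gauss_kernel_def by measurable
  show ?thesis
    unfolding eq using Y by measurable
qed

text \<open>Kernel integrals against an arbitrary measure. The hypothesis \<open>int\<close> has
  exponent 3/8 because that is the majorant left after differentiating (7/16) and moving x within
  the unit ball.\<close>

context
  fixes M :: "'a measure" and \<phi> :: "'a \<Rightarrow> real" and Y :: "'a \<Rightarrow> real^'n::finite"
    and V :: "real^'m::finite^'n"
  assumes \<phi>: "\<phi> \<in> borel_measurable M" and Y: "Y \<in> borel_measurable M"
    and int: "\<And>x. integrable M (\<lambda>z. \<phi> z * exp (- (3 / 8) * (norm (Y z - V *v x))\<^sup>2))"
begin

lemma partial_derivs_kernel_dominated:
  "\<exists>C\<ge>0. \<forall>\<xi>\<in>cball x 1. \<forall>z. \<bar>partial_derivs is (\<lambda>x. gauss_kernel (Y z - V *v x)) \<xi>\<bar>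
     \<le> C * exp (- (3 / 8) * (norm (Y z - V *v x))\<^sup>2)"
proof -
  obtain C where C: "0 \<le> C" "\<And>y x. \<bar>partial_derivs is (\<lambda>x. gauss_kernel (y - V *v x)) x\<bar>
    \<le> C * exp (- (7 / 16) * (norm (y - V *v x))\<^sup>2)"
    using partial_derivs_gauss_kernel_bound by blast
  obtain b where b: "0 < b" "\<And>h. norm (V *v h) \<le> norm h * b"
    using bounded_linear.pos_bounded[OF matrix_vector_mul_bounded_linear[of V]] by blast
  have "\<bar>partial_derivs is (\<lambda>x. gauss_kernel (Y z - V *v x)) \<xi>\<bar>
     \<le> (C * exp (3 * b\<^sup>2)) * exp (- (3 / 8) * (norm (Y z - V *v x))\<^sup>2)"
    if "\<xi> \<in> cball x 1" for \<xi> z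
  proof -
    have "norm (V *v (\<xi> - x)) \<le> norm (\<xi> - x) * b"
      by (rule b)
    also have "\<dots> \<le> 1 * b"
      using that b by (intro mult_right_mono) (auto simp: dist_norm norm_minus_commute)
    finally have *: "(norm (V *v (\<xi> - x)))\<^sup>2 \<le> b\<^sup>2"
      using b by (intro power_mono) auto
    have "exp (- (7 / 16) * (norm (Y z - V *v \<xi>))\<^sup>2)
        = exp (- (7 / 16) * (norm ((Y z - V *v x) - V *v (\<xi> - x)))\<^sup>2)"
      by (simp add: matrix_vector_mult_diff_distrib)
    also have "\<dots> \<le> exp (3 * (norm (V *v (\<xi> - x)))\<^sup>2) * exp (- (3 / 8) * (norm (Y z - V *v x))\<^sup>2)"
      by (rule gauss_exp_shift)
    also have "\<dots> \<le> exp (3 * b\<^sup>2) * exp (- (3 / 8) * (norm (Y z - V *v x))\<^sup>2)"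
      using * by (intro mult_right_mono) auto
    finally show ?thesis
      using C(2)[where y="Y z" and x=\<xi>] mult_left_mono[OF _ C(1)] unfolding mult.assoc by (meson order_trans)
  qed
  then show ?thesis
    using C(1) by (intro exI[of _ "C * exp (3 * b\<^sup>2)"]) auto
qed

lemma integrable_partial_derivs_kernel:
  "integrable M (\<lambda>z. \<phi> z * partial_derivs is (\<lambda>x. gauss_kernel (Y z - V *v x)) x)"
proof -
  obtain C where C: "0 \<le> C" "\<And>z. \<bar>partial_derivs is (\<lambda>x. gauss_kernel (Y z - V *v x)) x\<bar>
     \<le> C * exp (- (3 / 8) * (norm (Y z - V *v x))\<^sup>2)"
    using partial_derivs_kernel_dominated[of x "is"] by auto
  show ?thesis
  proof (rule Bochner_Integration.integrable_bound[OF integrable_mult_left[OF int[of x], of C]])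
    show "AE z in M. norm (\<phi> z * partial_derivs is (\<lambda>x. gauss_kernel (Y z - V *v x)) x)
       \<le> norm (\<phi> z * exp (- (3 / 8) * (norm (Y z - V *v x))\<^sup>2) * C)"
      using C mult_left_mono[OF C(2) abs_ge_zero[of "\<phi> z" for z]]
      by (auto simp: abs_mult mult_ac)
  qed (intro borel_measurable_times \<phi> measurable_partial_derivs_gauss_kernel Y)
qed

text \<open>The Taylor remainder of the kernel is at most a constant times |h|^2 exp(-3/8 |w|^2)
  with w taken at x, so its integral against phi is again O(|h|^2). Treating an arbitrary list of
  derivatives lets the step be iterated.\<close>

lemma has_derivative_kernel_integral:
  "((\<lambda>x. \<integral>z. \<phi> z * partial_derivs is (\<lambda>x. gauss_kernel (Y z - V *v x)) x \<partial>M) has_derivative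
    (\<lambda>h. \<Sum>i\<in>UNIV. h $ i *
       (\<integral>z. \<phi> z * partial_derivs (i # is) (\<lambda>x. gauss_kernel (Y z - V *v x)) x \<partial>M))) (at x)"
proof -
  let ?K = "\<lambda>is x z. partial_derivs is (\<lambda>x. gauss_kernel (Y z - V *v x)) x"
  let ?E = "\<lambda>z. exp (- (3 / 8) * (norm (Y z - V *v x))\<^sup>2)"
  obtain c where c: "\<And>l. 0 \<le> c l"
    "\<And>l \<xi> z. \<xi> \<in> cball x 1 \<Longrightarrow> \<bar>?K l \<xi> z\<bar> \<le> c l * ?E z"
    using partial_derivs_kernel_dominated[of x] by metis
  define C where "C = (\<Sum>i\<in>UNIV. \<Sum>j\<in>UNIV. c (j # i # is))"
  have C: "c (j # i # is) \<le> C" for i j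
  proof -
    have "c (j # i # is) \<le> (\<Sum>j\<in>UNIV. c (j # i # is))"
      by (rule member_le_sum) (auto intro: c)
    also have "\<dots> \<le> C"
      unfolding C_def by (rule member_le_sum[of i UNIV "\<lambda>i. \<Sum>j\<in>UNIV. c (j # i # is)"])
        (auto intro: c sum_nonneg)
    finally show ?thesis .
  qed
  let ?A = "(real CARD('m))\<^sup>2 * C * (\<integral>z. \<bar>\<phi> z\<bar> * ?E z \<partial>M)"
  have intE: "integrable M (\<lambda>z. \<bar>\<phi> z\<bar> * ?E z)"
    using integrable_abs[OF int[of x]] by (simp add: abs_mult)
  show ?thesis
  proof (rule has_derivative_quadratic_remainder[where A = ?A])
    show "bounded_linear (\<lambda>h. \<Sum>i\<in>UNIV. h $ i * (\<integral>z. \<phi> z * ?K (i # is) x z \<partial>M))"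
      by (intro bounded_linear_sum bounded_linear_mult_const bounded_linear_vec_nth)
    fix h :: "real^'m" assume h: "norm h \<le> 1"
    let ?R = "\<lambda>z. ?K is (x + h) z - ?K is x z - (\<Sum>i\<in>UNIV. h $ i * ?K (i # is) x z)"
    have R: "\<bar>?R z\<bar> \<le> (real CARD('m))\<^sup>2 * (C * ?E z) * (norm h)\<^sup>2" for z
    proof -
      have "\<bar>partial_deriv j (partial_deriv i (partial_derivs is (\<lambda>x. gauss_kernel (Y z - V *v x)))) \<xi>\<bar> \<le> C * ?E z"
        if "\<xi> \<in> cball x 1" for i j \<xi>
        using order_trans[OF c(2)[OF that, of "j # i # is" z] mult_right_mono[OF C[of j i]]] by simp
      from second_order_bound[OF partial_derivs_gauss_kernel_differentiable
          partial_derivs_gauss_kernel_differentiable[of "_ # is", unfolded partial_derivs_Cons] this h]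
      show ?thesis
        by simp
    qed
    note I = integrable_partial_derivs_kernel
    have Ii: "integrable M (\<lambda>z. h $ i * (\<phi> z * ?K (i # is) x z))" for i
      by (rule integrable_mult_right[OF I])
    have eq: "\<phi> z * ?R z = \<phi> z * ?K is (x + h) z - \<phi> z * ?K is x z
         - (\<Sum>i\<in>UNIV. h $ i * (\<phi> z * ?K (i # is) x z))" for z
      by (simp add: right_diff_distrib sum_distrib_left mult_ac)
    have intR: "integrable M (\<lambda>z. \<phi> z * ?R z)"
      unfolding eq by (intro Bochner_Integration.integrable_diff Bochner_Integration.integrable_sum Ii I)
    have "(\<integral>z. \<phi> z * ?K is (x + h) z \<partial>M) - (\<integral>z. \<phi> z * ?K is x z \<partial>M)
        - (\<Sum>i\<in>UNIV. h $ i * (\<integral>z. \<phi> z * ?K (i # is) x z \<partial>M)) = (\<integral>z. \<phi> z * ?R z \<partial>M)"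
      unfolding eq
      by (subst Bochner_Integration.integral_diff Bochner_Integration.integral_sum,
          (intro Bochner_Integration.integrable_diff Bochner_Integration.integrable_sum Ii I)+)+
        simp
    also have "\<bar>\<dots>\<bar> \<le> (\<integral>z. (real CARD('m))\<^sup>2 * C * (norm h)\<^sup>2 * (\<bar>\<phi> z\<bar> * ?E z) \<partial>M)"
    proof (rule order_trans[OF integral_abs_bound integral_mono])
      show "\<bar>\<phi> z * ?R z\<bar> \<le> (real CARD('m))\<^sup>2 * C * (norm h)\<^sup>2 * (\<bar>\<phi> z\<bar> * ?E z)" for z
        using mult_left_mono[OF R[of z] abs_ge_zero[of "\<phi> z"]] by (simp add: abs_mult mult_ac)
    qed (use intR intE in auto)
    also have "\<dots> = ?A * (norm h)\<^sup>2"
      by simp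
    finally show "\<bar>(\<integral>z. \<phi> z * ?K is (x + h) z \<partial>M) - (\<integral>z. \<phi> z * ?K is x z \<partial>M)
        - (\<Sum>i\<in>UNIV. h $ i * (\<integral>z. \<phi> z * ?K (i # is) x z \<partial>M))\<bar> \<le> ?A * (norm h)\<^sup>2" .
  qed
qed

lemma partial_derivs_kernel_integral:
  "partial_derivs is (\<lambda>x. \<integral>z. \<phi> z * gauss_kernel (Y z - V *v x) \<partial>M) =
     (\<lambda>x. \<integral>z. \<phi> z * partial_derivs is (\<lambda>x. gauss_kernel (Y z - V *v x)) x \<partial>M)"
proof (induction "is")
  case (Cons i "is")
  have "partial_deriv i (\<lambda>x. \<integral>z. \<phi> z * partial_derivs is (\<lambda>x. gauss_kernel (Y z - V *v x)) x \<partial>M) x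
      = (\<integral>z. \<phi> z * partial_derivs (i # is) (\<lambda>x. gauss_kernel (Y z - V *v x)) x \<partial>M)" for x
    using partial_deriv_eqI[OF has_derivative_kernel_integral, of i "is" x]
    by (simp add: axis_def if_distrib[of "\<lambda>a. a * b" for b] cong: if_cong)
  then show ?case
    unfolding partial_derivs_Cons[of i "is" "\<lambda>x. \<integral>z. \<phi> z * gauss_kernel (Y z - V *v x) \<partial>M"] Cons.IH
    by blast
qed simp

lemma C_k_kernel_integral: "C_k k (\<lambda>x. \<integral>z. \<phi> z * gauss_kernel (Y z - V *v x) \<partial>M)"
proof -
  have "partial_derivs is (\<lambda>x. \<integral>z. \<phi> z * gauss_kernel (Y z - V *v x) \<partial>M) differentiable (at x)" for "is" x
    unfolding partial_derivs_kernel_integral differentiable_def using has_derivative_kernel_integral by blast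
  then show ?thesis
    unfolding C_k_def differentiable_on_def
    by (meson continuous_at_imp_continuous_on differentiable_imp_continuous_within differentiable_at_withinI)
qed

end

section \<open>Gaussian densities\<close>

definition posdef :: "real^'n^'n \<Rightarrow> bool" where
  "posdef S \<longleftrightarrow> transpose S = S \<and> (\<forall>x. x \<noteq> 0 \<longrightarrow> 0 < x \<bullet> (S *v x))"

lemma inner_matrix_vector_mult:
  fixes A :: "real^'n^'m"
  shows "x \<bullet> (A *v y) = (transpose A *v x) \<bullet> y"
  by (metis dot_lmul_matrix transpose_matrix_vector)

lemma posdef_inner_commute:
  assumes "posdef S"
  shows "x \<bullet> (S *v y) = y \<bullet> (S *v x)"
  using assms inner_matrix_vector_mult[of x S y] by (simp add: posdef_def inner_commute)

lemma posdef_inner_nonneg: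
  assumes "posdef S"
  shows "0 \<le> x \<bullet> (S *v x)"
  using assms by (cases "x = 0") (auto simp: posdef_def less_imp_le)

text \<open>Gram--Schmidt for the inner product x . (S y), one index at a time. It yields a
  factorisation of S without diagonalising it.\<close>

lemma posdef_orthonormal_family:
  fixes S :: "real^'n::finite^'n" and I :: "'n set"
  assumes S: "posdef S" and "finite I"
  shows "\<exists>b. \<forall>i\<in>I. \<forall>j\<in>I. b i \<bullet> (S *v b j) = (if i = j then 1 else 0)"
  using \<open>finite I\<close>
proof (induction I rule: finite_induct)
  case (insert k I)
  then obtain b where b: "\<And>i j. i \<in> I \<Longrightarrow> j \<in> I \<Longrightarrow> b i \<bullet> (S *v b j) = (if i = j then 1 else 0)"
    by blast
  \<comment> \<open>As k lies outside I, fewer than n vectors are present, so some v is outside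
    their span.\<close>
  have "card I < CARD('n)"
    using insert by (metis UNIV_I card_mono card_seteq finite less_le_not_le linorder_not_less top_greatest)
  then have "dim (b ` I) < DIM(real^'n)"
    using dim_le_card[of "b ` I" "b ` I"] card_image_le[of I b] span_superset[of "b ` I"] insert
    by (simp add: le_less_trans)
  then have "span (b ` I) \<noteq> UNIV"
    by (metis dim_UNIV dim_span less_irrefl)
  then obtain v where v: "v \<notin> span (b ` I)"
    by blast
  define w where "w = v - (\<Sum>j\<in>I. (v \<bullet> (S *v b j)) *\<^sub>R b j)"
  have "(\<Sum>j\<in>I. (v \<bullet> (S *v b j)) *\<^sub>R b j) \<in> span (b ` I)"
    by (intro span_sum span_scale span_base) auto
  then have "w \<noteq> 0"
    using v by (auto simp: w_def)
  then have pos: "0 < w \<bullet> (S *v w)"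
    using S by (simp add: posdef_def)
  have ort: "w \<bullet> (S *v b i) = 0" if "i \<in> I" for i
  proof -
    have "(\<Sum>j\<in>I. (v \<bullet> (S *v b j)) * (b j \<bullet> (S *v b i))) = (\<Sum>j\<in>I. if j = i then v \<bullet> (S *v b i) else 0)"
      using that by (intro sum.cong) (auto simp: b)
    then show ?thesis
      using that insert by (simp add: w_def inner_diff_left inner_sum_left)
  qed
  then have ort': "b i \<bullet> (S *v w) = 0" if "i \<in> I" for i
    using that posdef_inner_commute[OF S] by metis
  define u where "u = (1 / sqrt (w \<bullet> (S *v w))) *\<^sub>R w"
  have u: "u \<bullet> (S *v b i) = 0" "b i \<bullet> (S *v u) = 0" if "i \<in> I" for i
    using that by (auto simp: u_def matrix_vector_mult_scaleR ort ort')
  have "u \<bullet> (S *v u) = (w \<bullet> (S *v w)) / (sqrt (w \<bullet> (S *v w)) * sqrt (w \<bullet> (S *v w)))"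
    by (simp add: u_def matrix_vector_mult_scaleR)
  also have "\<dots> = 1"
    using pos by (metis less_eq_real_def less_irrefl right_inverse_eq real_sqrt_mult_self abs_of_pos)
  finally have uu: "u \<bullet> (S *v u) = 1" .
  show ?case
  proof (intro exI[of _ "b(k := u)"] ballI)
    fix i j assume "i \<in> insert k I" "j \<in> insert k I"
    then show "(b(k := u)) i \<bullet> (S *v (b(k := u)) j) = (if i = j then 1 else 0)"
      using insert.hyps b u uu by auto
  qed
qed auto

lemma matrix_inv_eqI:
  fixes A :: "real^'n::finite^'n"
  assumes "A ** B = mat 1"
  shows "matrix_inv A = B"
proof -
  have "B ** A = mat 1"
    using assms matrix_left_right_inverse by blast
  then have "\<exists>C. A ** C = mat 1 \<and> C ** A = mat 1"
    using assms by blast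
  then have "A ** matrix_inv A = mat 1"
    unfolding matrix_inv_def by (rule someI2_ex) blast
  then have "B ** (A ** matrix_inv A) = B"
    by simp
  then show ?thesis
    using \<open>B ** A = mat 1\<close> by (simp add: matrix_mul_assoc)
qed

text \<open>The rows of N are a Q-orthonormal basis, so N Q N^T = 1 and R = Q N^T inverts N. Thus N
  is a (not necessarily symmetric) Q^(-1/2), and |N w|^2 = w . Q^(-1) w.\<close>

lemma posdef_factor:
  fixes Q :: "real^'n::finite^'n"
  assumes "posdef Q"
  obtains R N :: "real^'n^'n" where "R ** N = mat 1" "N ** R = mat 1" "Q = R ** transpose R"
    "matrix_inv Q = transpose N ** N"
proof -
  obtain b where b: "\<And>i j::'n. b i \<bullet> (Q *v b j) = (if i = j then 1 else 0)"
    using posdef_orthonormal_family[OF assms, of UNIV] by auto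
  define N where "N = (\<chi> i. b i)"
  define R where "R = Q ** transpose N"
  have "(N ** R) $ i $ j = mat 1 $ i $ j" for i j
  proof -
    have "(N ** R) $ i $ j = ((N ** R) *v axis j 1) $ i"
      unfolding matrix_vector_mult_basis by (simp add: column_def)
    also have "\<dots> = (N *v (Q *v (transpose N *v axis j 1))) $ i"
      unfolding R_def matrix_vector_mul_assoc[symmetric] by (rule refl)
    also have "\<dots> = b i \<bullet> (Q *v b j)"
      by (simp add: N_def matrix_vector_mult_basis column_def transpose_def inner_vec_def
          matrix_vector_mult_def[of "\<chi> i. b i"])
    finally show ?thesis
      by (simp add: b mat_def)
  qed
  then have NR: "N ** R = mat 1"
    by (simp add: vec_eq_iff)
  then have RN: "R ** N = mat 1"
    using matrix_left_right_inverse by blast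
  have Qs: "transpose Q = Q"
    using assms by (simp add: posdef_def)
  have Rt: "transpose R = N ** Q"
    by (simp add: R_def matrix_transpose_mul Qs)
  have QR: "Q = R ** transpose R"
    unfolding Rt by (simp add: matrix_mul_assoc RN)
  have "Q ** (transpose N ** N) = R ** N"
    by (simp add: matrix_mul_assoc R_def)
  then have "matrix_inv Q = transpose N ** N"
    using RN by (intro matrix_inv_eqI) simp
  then show thesis
    by (rule that[OF RN NR QR])
qed

lemma inner_gram:
  fixes N :: "real^'n^'m"
  shows "x \<bullet> ((transpose N ** N) *v y) = (N *v x) \<bullet> (N *v y)"
  by (metis inner_matrix_vector_mult matrix_vector_mul_assoc transpose_transpose)

section \<open>Linear change of variables for Lebesgue measure\<close>

lemma borel_measurable_matrix_vector_mult [measurable]: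
  fixes A :: "real^'n::finite^'m::finite"
  shows "(*v) A \<in> borel_measurable borel"
  by (intro borel_measurable_continuous_onI matrix_vector_mult_linear_continuous_on)

text \<open>The library proves the linear change of variables only for well-ordered index types.\<close>

lemma nn_integral_lborel_shear:
  fixes h :: "'a::euclidean_space \<Rightarrow> ennreal"
  assumes h [measurable]: "h \<in> borel_measurable borel" and b: "b \<in> Basis" "b' \<in> Basis" "b \<noteq> b'"
  shows "(\<integral>\<^sup>+x. h (x + (x \<bullet> b') *\<^sub>R b) \<partial>lborel) = (\<integral>\<^sup>+x. h x \<partial>lborel)"
proof -
  interpret product_sigma_finite "\<lambda>_::'a. lborel :: real measure"
    by standard
  let ?B = "Basis - {b}" and ?P = "\<lambda>I. \<Pi>\<^sub>M b\<in>I. (lborel :: real measure)"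
  let ?e = "\<lambda>y::'a \<Rightarrow> real. \<Sum>c\<in>Basis. y c *\<^sub>R c" and ?s = "\<lambda>x::'a. x + (x \<bullet> b') *\<^sub>R b"
  have B: "insert b ?B = (Basis :: 'a set)" "finite ?B" "b \<notin> ?B"
    using b by auto
  have e: "?e (y(b := t)) = (\<Sum>c\<in>?B. y c *\<^sub>R c) + t *\<^sub>R b" for y t
  proof -
    have "?e (y(b := t)) = (\<Sum>c\<in>insert b ?B. (y(b := t)) c *\<^sub>R c)"
      by (simp only: B)
    also have "\<dots> = t *\<^sub>R b + (\<Sum>c\<in>?B. (y(b := t)) c *\<^sub>R c)"
      by (subst sum.insert) auto
    also have "(\<Sum>c\<in>?B. (y(b := t)) c *\<^sub>R c) = (\<Sum>c\<in>?B. y c *\<^sub>R c)"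
      by (intro sum.cong) auto
    finally show ?thesis
      by (simp add: add.commute)
  qed
  have ip: "?e y \<bullet> b' = y b'" for y
    using b by (simp add: inner_sum_left_Basis)
  \<comment> \<open>Fubini with coordinate b innermost: once the other coordinates are fixed, b'
    among them, the shear translates t by \<open>y b'\<close>, which preserves the inner
    integral.\<close>
  have L: "(\<integral>\<^sup>+x. g x \<partial>lborel) = (\<integral>\<^sup>+y. \<integral>\<^sup>+t. g (?e (y(b := t))) \<partial>lborel \<partial>?P ?B)"
    if [measurable]: "g \<in> borel_measurable borel" for g :: "'a \<Rightarrow> ennreal"
  proof -
    have "(\<integral>\<^sup>+x. g x \<partial>lborel) = (\<integral>\<^sup>+y. g (?e y) \<partial>?P Basis)"
      by (subst lborel_eq) (simp add: nn_integral_distr)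
    also have "\<dots> = (\<integral>\<^sup>+y. g (?e y) \<partial>?P (insert b ?B))"
      by (simp only: B)
    also have "\<dots> = (\<integral>\<^sup>+y. \<integral>\<^sup>+t. g (?e (y(b := t))) \<partial>lborel \<partial>?P ?B)"
      by (rule product_nn_integral_insert[OF B(2,3)]) (simp add: B(1))
    finally show ?thesis .
  qed
  have "(\<integral>\<^sup>+t. h (?s (?e (y(b := t)))) \<partial>lborel) = (\<integral>\<^sup>+t. h (?e (y(b := t))) \<partial>lborel)" for y
  proof -
    have "?s (?e (y(b := t))) = ?e (y(b := y b' + 1 * t))" for t
      using b unfolding ip unfolding e by (simp add: algebra_simps)
    then have "(\<integral>\<^sup>+t. h (?s (?e (y(b := t)))) \<partial>lborel)
        = ennreal \<bar>1\<bar> * (\<integral>\<^sup>+t. h (?e (y(b := y b' + 1 * t))) \<partial>lborel)"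
      by simp
    also have "\<dots> = (\<integral>\<^sup>+t. h (?e (y(b := t))) \<partial>lborel)"
      unfolding e by (rule nn_integral_real_affine[symmetric]) auto
    finally show ?thesis .
  qed
  then show ?thesis
    by (subst (1 2) L) auto
qed

lemma nn_integral_lborel_linear:
  fixes f :: "real^'n::finite \<Rightarrow> real^'n" and h :: "real^'n \<Rightarrow> ennreal"
  assumes "linear f" and "det (matrix f) \<noteq> 0" and "h \<in> borel_measurable borel"
  shows "ennreal \<bar>det (matrix f)\<bar> * (\<integral>\<^sup>+x. h (f x) \<partial>lborel) = (\<integral>\<^sup>+x. h x \<partial>lborel)"
proof -
  \<comment> \<open>Composition applies the claim for f to h and the claim for g to h o f, so h is
    quantified inside P. The determinant condition is an implication inside P because the elementary
    maps include singular ones.\<close>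
  define P where "P f \<longleftrightarrow> (det (matrix f) \<noteq> 0 \<longrightarrow> (\<forall>h \<in> borel_measurable borel.
      ennreal \<bar>det (matrix f)\<bar> * (\<integral>\<^sup>+x. h (f x) \<partial>lborel) = (\<integral>\<^sup>+x. h x \<partial>lborel)))"
    for f :: "real^'n \<Rightarrow> real^'n"
  have meas: "linear f \<Longrightarrow> f \<in> borel_measurable borel" for f :: "real^'n \<Rightarrow> real^'n"
    by (simp add: borel_measurable_continuous_onI linear_continuous_on linear_conv_bounded_linear)
  have "P f"
  proof (rule induct_linear_elementary[OF \<open>linear f\<close>])
    fix f g :: "real^'n \<Rightarrow> real^'n"
    assume lin: "linear f" "linear g" and P: "P f" "P g"
    have d: "det (matrix (f \<circ> g)) = det (matrix f) * det (matrix g)"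
      by (simp add: matrix_compose[OF lin(2,1)] det_mul)
    show "P (f \<circ> g)"
      unfolding P_def d
    proof (intro impI ballI)
      fix h :: "real^'n \<Rightarrow> ennreal" assume nz: "det (matrix f) * det (matrix g) \<noteq> 0" and h: "h \<in> borel_measurable borel"
      have hf: "(\<lambda>x. h (f x)) \<in> borel_measurable borel"
        using measurable_compose[OF meas[OF lin(1)] h] .
      have "ennreal \<bar>det (matrix f) * det (matrix g)\<bar> * (\<integral>\<^sup>+x. h ((f \<circ> g) x) \<partial>lborel)
          = ennreal \<bar>det (matrix f)\<bar> * (ennreal \<bar>det (matrix g)\<bar> * (\<integral>\<^sup>+x. h (f (g x)) \<partial>lborel))"
        by (simp add: abs_mult ennreal_mult mult.assoc)
      also have "\<dots> = (\<integral>\<^sup>+x. h x \<partial>lborel)"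
      proof -
        have nz': "det (matrix f) \<noteq> 0" "det (matrix g) \<noteq> 0"
          using nz by auto
        have "ennreal \<bar>det (matrix g)\<bar> * (\<integral>\<^sup>+x. h (f (g x)) \<partial>lborel) = (\<integral>\<^sup>+x. h (f x) \<partial>lborel)"
          by (rule P(2)[unfolded P_def, rule_format, OF nz'(2) hf])
        moreover have "ennreal \<bar>det (matrix f)\<bar> * (\<integral>\<^sup>+x. h (f x) \<partial>lborel) = (\<integral>\<^sup>+x. h x \<partial>lborel)"
          by (rule P(1)[unfolded P_def, rule_format, OF nz'(1) h])
        ultimately show ?thesis
          by simp
      qed
      finally show "ennreal \<bar>det (matrix f) * det (matrix g)\<bar> * (\<integral>\<^sup>+x. h ((f \<circ> g) x) \<partial>lborel)
         = (\<integral>\<^sup>+x. h x \<partial>lborel)" .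
    qed
  next
    fix f :: "real^'n \<Rightarrow> real^'n" and i assume "linear f" and 0: "\<And>x. f x $ i = 0"
    then have "\<not> inj f"
      by (metis (full_types) linear_injective_imp_surjective one_neq_zero surjE vec_component)
    then show "P f"
      using det_nz_iff_inj[OF \<open>linear f\<close>] by (simp add: P_def)
  next
    fix c :: "'n \<Rightarrow> real"
    let ?f = "\<lambda>x. \<chi> i. c i * x $ i"
    have d: "det (matrix ?f) = prod c UNIV"
      by (subst det_diagonal) (auto simp: matrix_def axis_def)
    show "P ?f"
      unfolding P_def d
    proof (intro impI ballI)
      fix h :: "real^'n \<Rightarrow> ennreal" assume nz: "prod c UNIV \<noteq> 0" and [measurable]: "h \<in> borel_measurable borel"
      have [measurable]: "?f \<in> borel_measurable borel"
        by (intro meas linearI) (auto simp: vec_eq_iff algebra_simps)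
      \<comment> \<open>\<open>lborel_affine_euclidean\<close> indexes scaling factors by basis
        vectors, so c is transported along i -> \<open>axis i 1\<close>.\<close>
      define c' where "c' b = c (THE i. b = axis i 1)" for b :: "real^'n"
      have c': "c' (axis i 1) = c i" for i
        by (simp add: c'_def axis_eq_axis)
      have bas: "(Basis :: (real^'n) set) = range (\<lambda>i. axis i 1)" and inj: "inj (\<lambda>i::'n. axis i (1::real))"
        by (auto simp: Basis_vec_def inj_on_def axis_eq_axis)
      have f: "?f = (\<lambda>x. 0 + (\<Sum>j\<in>Basis. (c' j * (x \<bullet> j)) *\<^sub>R j))"
      proof
        fix x :: "real^'n"
        have "?f x = (\<Sum>i\<in>UNIV. (c i * x $ i) *\<^sub>R axis i 1)"
          using basis_expansion[of "?f x"] by (simp add: scalar_mult_eq_scaleR)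
        also have "\<dots> = (\<Sum>j\<in>Basis. (c' j * (x \<bullet> j)) *\<^sub>R j)"
          unfolding bas by (subst sum.reindex[OF inj]) (simp only: o_def c' inner_axis inner_real_def mult_1_right)
        finally show "?f x = 0 + (\<Sum>j\<in>Basis. (c' j * (x \<bullet> j)) *\<^sub>R j)"
          by simp
      qed
      have p: "(\<Prod>j\<in>Basis. \<bar>c' j\<bar>) = \<bar>prod c UNIV\<bar>"
        unfolding bas by (subst prod.reindex[OF inj]) (simp only: o_def c' abs_prod)
      have "lborel = density (distr lborel borel ?f) (\<lambda>_. ennreal \<bar>prod c UNIV\<bar>)"
        unfolding f p[symmetric] using nz by (intro lborel_affine_euclidean) (auto simp: bas c')
      then have "(\<integral>\<^sup>+x. h x \<partial>lborel) = (\<integral>\<^sup>+x. h x \<partial>density (distr lborel borel ?f) (\<lambda>_. ennreal \<bar>prod c UNIV\<bar>))"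
        by simp
      also have "\<dots> = ennreal \<bar>prod c UNIV\<bar> * (\<integral>\<^sup>+x. h (?f x) \<partial>lborel)"
        by (simp add: nn_integral_density nn_integral_distr nn_integral_cmult)
      finally show "ennreal \<bar>prod c UNIV\<bar> * (\<integral>\<^sup>+x. h (?f x) \<partial>lborel) = (\<integral>\<^sup>+x. h x \<partial>lborel)" ..
    qed
  next
    fix m n :: 'n assume "m \<noteq> n"
    let ?t = "Transposition.transpose m n"
    let ?f = "\<lambda>x::real^'n. \<chi> i. x $ ?t i"
    have lin: "linear ?f"
      by (rule linearI) (auto simp: vec_eq_iff)
    have tt: "?t (?t i) = i" for i
      by (rule transpose_involutory)
    have ff: "?f (?f x) = x" for x
      by (simp add: vec_eq_iff tt)
    \<comment> \<open>Swapping two coordinates is an involution, so the determinant is 1 or -1; the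
      claim involves its absolute value.\<close>
    have "det (matrix ?f) * det (matrix ?f) = 1"
    proof -
      have "matrix ?f ** matrix ?f = matrix (?f \<circ> ?f)"
        by (rule matrix_compose[OF lin lin, symmetric])
      also have "?f \<circ> ?f = (\<lambda>x. mat 1 *v x)"
        by (simp add: fun_eq_iff ff)
      finally show ?thesis
        by (metis det_I det_mul matrix_of_matrix_vector_mul)
    qed
    then have d: "\<bar>det (matrix ?f)\<bar> = 1"
      by (auto simp: square_eq_1_iff)
    have "lborel = distr lborel borel ?f"
    proof (rule lborel_eqI)
      fix l u :: "real^'n" assume le: "\<And>b. b \<in> Basis \<Longrightarrow> l \<bullet> b \<le> u \<bullet> b"
      have le': "l $ i \<le> u $ i" for i
        using le[of "axis i 1"] by (simp add: inner_axis)
      have bas: "(Basis :: (real^'n) set) = range (\<lambda>i. axis i 1)" and inj: "inj (\<lambda>i::'n. axis i (1::real))"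
        by (auto simp: Basis_vec_def inj_on_def axis_eq_axis)
      have vim: "?f -` box l u = box (?f l) (?f u)"
        by (auto simp: mem_box_cart) (metis tt)+
      have "emeasure (distr lborel borel ?f) (box l u) = emeasure lborel (box (?f l) (?f u))"
        using meas[OF lin] by (simp add: emeasure_distr vim)
      also have "\<dots> = (\<Prod>b\<in>Basis. (?f u - ?f l) \<bullet> b)"
        by (rule emeasure_lborel_box) (auto simp: bas inner_axis le')
      also have "(\<Prod>b\<in>Basis. (?f u - ?f l) \<bullet> b) = (\<Prod>i\<in>UNIV. (u - l) $ (?t i))"
        unfolding bas by (subst prod.reindex[OF inj]) (simp add: o_def inner_axis)
      also have "\<dots> = (\<Prod>i\<in>UNIV. (u - l) $ i)"
        by (rule prod.reindex_bij_betw) simp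
      also have "\<dots> = (\<Prod>b\<in>Basis. (u - l) \<bullet> b)"
        unfolding bas by (subst prod.reindex[OF inj]) (simp add: o_def inner_axis)
      finally show "emeasure (distr lborel borel ?f) (box l u) = (\<Prod>b\<in>Basis. (u - l) \<bullet> b)" .
    qed simp
    then have "(\<integral>\<^sup>+x. h (?f x) \<partial>lborel) = (\<integral>\<^sup>+x. h x \<partial>lborel)" if "h \<in> borel_measurable borel"
      for h :: "real^'n \<Rightarrow> ennreal"
      using that meas[OF lin] nn_integral_distr[of ?f lborel borel h] by simp
    then show "P ?f"
      by (simp add: P_def d)
  next
    fix m n :: 'n assume mn: "m \<noteq> n"
    let ?f = "\<lambda>x::real^'n. \<chi> i. if i = m then x $ m + x $ n else x $ i"
    have f: "?f x = x + (x \<bullet> axis n 1) *\<^sub>R axis m 1" for x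
      using mn by (simp add: vec_eq_iff inner_axis) (simp add: axis_def)
    have "matrix ?f $ i $ j = (\<chi> k. if k = m then row m (mat 1) + 1 *s row n (mat 1) else row k (mat 1)) $ i $ j"
      for i j
      by (cases "i = m") (simp_all add: matrix_def row_def mat_def axis_def)
    then have "matrix ?f = (\<chi> k. if k = m then row m (mat 1) + 1 *s row n (mat 1) else row k (mat 1))"
      unfolding vec_eq_iff by blast
    then have d: "det (matrix ?f) = 1"
      using det_row_operation[OF mn, of "mat 1" "1::real"] by simp
    have "(\<integral>\<^sup>+x. h (?f x) \<partial>lborel) = (\<integral>\<^sup>+x. h x \<partial>lborel)" if "h \<in> borel_measurable borel"
      for h :: "real^'n \<Rightarrow> ennreal"
      unfolding f using mn that by (intro nn_integral_lborel_shear) (auto simp: axis_eq_axis)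
    then show "P ?f"
      by (simp add: P_def d)
  qed
  from this[unfolded P_def, rule_format, OF assms(2,3)] show ?thesis .
qed

section \<open>Gaussian integrals and normalisation\<close>

lemma nn_integral_exp_neg_square:
  fixes a :: real
  assumes "0 < a"
  shows "(\<integral>\<^sup>+x. ennreal (exp (- a * x\<^sup>2)) \<partial>lborel) = ennreal (sqrt (pi / a))"
proof -
  let ?\<sigma> = "sqrt (1 / (2 * a))"
  have \<sigma>: "0 < ?\<sigma>" "?\<sigma>\<^sup>2 = 1 / (2 * a)"
    using assms by auto
  have eq: "exp (- a * x\<^sup>2) = sqrt (pi / a) * normal_density 0 ?\<sigma> x" for x
    using assms by (simp add: normal_density_def \<sigma>(2) del: real_sqrt_divide)
  have "(\<integral>\<^sup>+x. ennreal (exp (- a * x\<^sup>2)) \<partial>lborel) = ennreal (\<integral>x. exp (- a * x\<^sup>2) \<partial>lborel)"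
    unfolding eq using \<sigma> by (intro nn_integral_eq_integral integrable_mult_right) auto
  also have "\<dots> = ennreal (sqrt (pi / a))"
    unfolding eq using \<sigma> by simp
  finally show ?thesis .
qed

lemma nn_integral_exp_neg_norm_square:
  fixes a :: real
  assumes "0 < a"
  shows "(\<integral>\<^sup>+x. ennreal (exp (- a * (norm x)\<^sup>2)) \<partial>(lborel :: (real^'n::finite) measure))
    = ennreal (sqrt (pi / a) ^ CARD('n))"
proof -
  have "ennreal (exp (- a * (norm x)\<^sup>2)) = (\<Prod>b\<in>Basis. ennreal (exp (- a * (x \<bullet> b)\<^sup>2)))" for x :: "real^'n"
  proof -
    have "- a * (norm x)\<^sup>2 = (\<Sum>b\<in>Basis. - a * (x \<bullet> b)\<^sup>2)"
      unfolding power2_norm_eq_inner euclidean_inner[of x x] by (simp add: sum_distrib_left power2_eq_square)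
    then show ?thesis
      by (simp add: exp_sum prod_ennreal)
  qed
  then have "(\<integral>\<^sup>+x. ennreal (exp (- a * (norm x)\<^sup>2)) \<partial>(lborel :: (real^'n) measure))
      = (\<integral>\<^sup>+x. (\<Prod>b\<in>Basis. ennreal (exp (- a * (x \<bullet> b)\<^sup>2))) \<partial>(lborel :: (real^'n) measure))"
    by (simp only:)
  also have "\<dots> = (\<Prod>b\<in>(Basis :: (real^'n) set). \<integral>\<^sup>+x. ennreal (exp (- a * x\<^sup>2)) \<partial>lborel)"
    by (rule nn_integral_lborel_prod) auto
  also have "\<dots> = ennreal (sqrt (pi / a) ^ CARD('n))"
    unfolding nn_integral_exp_neg_square[OF assms] using assms by (simp add: ennreal_power)
  finally show ?thesis .
qed

text \<open>Substituting N x turns the form of Q^(-1) into the squared norm; the Jacobian is |det R|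
  = sqrt (det Q).\<close>

lemma nn_integral_gaussian:
  fixes Q :: "real^'n::finite^'n" and a :: real
  assumes "posdef Q" and a: "0 < a"
  shows "(\<integral>\<^sup>+x. ennreal (exp (- a * (x \<bullet> (matrix_inv Q *v x)))) \<partial>lborel)
    = ennreal (sqrt (pi / a) ^ CARD('n) * sqrt (det Q))"
proof -
  obtain R N :: "real^'n^'n" where RN: "R ** N = mat 1" and "N ** R = mat 1"
    and Q: "Q = R ** transpose R" and inv: "matrix_inv Q = transpose N ** N"
    by (rule posdef_factor[OF assms(1)])
  have detRN: "det R * det N = 1"
    using RN by (metis det_I det_mul)
  have "(\<integral>\<^sup>+x. ennreal (exp (- a * (x \<bullet> (matrix_inv Q *v x)))) \<partial>lborel)
      = (\<integral>\<^sup>+x. ennreal (exp (- a * (norm (N *v x))\<^sup>2)) \<partial>lborel)"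
    by (simp add: inv inner_gram power2_norm_eq_inner)
  also have "\<dots> = ennreal (\<bar>det R\<bar> * \<bar>det N\<bar>) * (\<integral>\<^sup>+x. ennreal (exp (- a * (norm (N *v x))\<^sup>2)) \<partial>lborel)"
    using detRN by (simp flip: abs_mult)
  also have "\<dots> = ennreal \<bar>det R\<bar> * (\<integral>\<^sup>+x. ennreal (exp (- a * (norm x)\<^sup>2)) \<partial>(lborel :: (real^'n) measure))"
  proof -
    have "det N \<noteq> 0"
      using detRN by auto
    then show ?thesis
      using nn_integral_lborel_linear[of "(*v) N" "\<lambda>x. ennreal (exp (- a * (norm x)\<^sup>2))"]
      by (simp add: ennreal_mult mult.assoc)
  qed
  also have "\<dots> = ennreal \<bar>det R\<bar> * ennreal (sqrt (pi / a) ^ CARD('n))"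
    by (simp only: nn_integral_exp_neg_norm_square[OF a])
  also have "\<dots> = ennreal (sqrt (pi / a) ^ CARD('n) * sqrt (det Q))"
  proof -
    have "sqrt (det Q) = \<bar>det R\<bar>"
      unfolding Q det_mul det_transpose by (rule real_sqrt_abs2)
    then show ?thesis
      using a by (simp only: mult.commute[of _ "\<bar>det R\<bar>"]) (simp add: ennreal_mult')
  qed
  finally show ?thesis .
qed

lemma posdef_det_pos:
  fixes Q :: "real^'n::finite^'n"
  assumes "posdef Q"
  shows "0 < det Q"
proof -
  obtain R N :: "real^'n^'n" where RN: "R ** N = mat 1" and "N ** R = mat 1"
    and Q: "Q = R ** transpose R" and "matrix_inv Q = transpose N ** N"
    by (rule posdef_factor[OF assms])
  have "det R * det N = 1"
    using RN by (metis det_I det_mul)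
  then have "det R \<noteq> 0"
    by auto
  moreover have "det Q = (det R)\<^sup>2"
    unfolding Q det_mul det_transpose by (rule power2_eq_square[symmetric])
  ultimately show ?thesis
    by simp
qed

definition gauss_density :: "real^'n::finite^'n \<Rightarrow> real^'n \<Rightarrow> real" where
  "gauss_density Q w = exp (- (w \<bullet> (matrix_inv Q *v w)) / 2) / sqrt ((2 * pi) ^ CARD('n) * det Q)"

lemma gaussian_posdef:
  fixes Q :: "real^'n::finite^'n"
  assumes "posdef Q"
  shows "gaussian m Q = density lborel (\<lambda>x. ennreal (gauss_density Q (x - m)))"
proof -
  have "Q \<noteq> 0"
  proof
    assume Q0: "Q = 0"
    obtain x :: "real^'n" where "x \<in> Basis"
      using nonempty_Basis by blast
    then have "x \<noteq> 0"
      by (rule nonzero_Basis)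
    then have "0 < x \<bullet> (Q *v x)"
      using assms unfolding posdef_def by blast
    then show False
      by (simp add: Q0)
  qed
  then show ?thesis
    by (simp add: gaussian_def gauss_density_def)
qed

lemma gauss_density_pos: "posdef Q \<Longrightarrow> 0 < gauss_density Q w"
  by (simp add: gauss_density_def posdef_det_pos)

lemma borel_measurable_gauss_density [measurable]: "gauss_density Q \<in> borel_measurable borel"
  unfolding gauss_density_def by measurable

text \<open>An exponential moment whose value is free of Q, the source of uniformity in s and t.
  With b = 0 it is the normalisation; with b = 1/8 it bounds the second moment of the Hermite-like
  factor.\<close>

lemma nn_integral_gauss_density_exp:
  fixes Q :: "real^'n::finite^'n"
  assumes Q: "posdef Q" and b: "b < 1 / 2"
  shows "(\<integral>\<^sup>+x. ennreal (gauss_density Q x * exp (b * (x \<bullet> (matrix_inv Q *v x)))) \<partial>lborel)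
    = ennreal (sqrt (1 / (1 - 2 * b)) ^ CARD('n))"
proof -
  let ?q = "\<lambda>x. x \<bullet> (matrix_inv Q *v x)" and ?c = "sqrt ((2 * pi) ^ CARD('n) * det Q)"
  have "0 < (2 * pi) ^ CARD('n) * det Q"
    by (intro mult_pos_pos zero_less_power posdef_det_pos[OF Q]) auto
  then have c: "0 < ?c" "?c = sqrt (2 * pi) ^ CARD('n) * sqrt (det Q)"
    by (rule real_sqrt_gt_zero, unfold real_sqrt_mult[of "_ ^ _"] real_sqrt_power) (rule refl)
  have "gauss_density Q x * exp (b * ?q x) = (1 / ?c) * exp (- (1 / 2 - b) * ?q x)" for x
  proof -
    have "- ?q x / 2 + b * ?q x = - (1 / 2 - b) * ?q x"
      by (simp add: left_diff_distrib)
    then have "exp (- ?q x / 2) * exp (b * ?q x) = exp (- (1 / 2 - b) * ?q x)"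
      unfolding exp_add[symmetric] by (rule arg_cong)
    then show ?thesis
      unfolding gauss_density_def by (simp only: times_divide_eq_left times_divide_eq_right mult_1)
  qed
  then have "(\<integral>\<^sup>+x. ennreal (gauss_density Q x * exp (b * ?q x)) \<partial>lborel)
      = (\<integral>\<^sup>+x. ennreal (1 / ?c) * ennreal (exp (- (1 / 2 - b) * ?q x)) \<partial>lborel)"
    using c(1) by (simp only: ennreal_mult' divide_nonneg_pos zero_le_one)
  also have "\<dots> = ennreal (1 / ?c) * (\<integral>\<^sup>+x. ennreal (exp (- (1 / 2 - b) * ?q x)) \<partial>lborel)"
    by (rule nn_integral_cmult) measurable
  also have "\<dots> = ennreal (1 / ?c) * ennreal (sqrt (pi / (1 / 2 - b)) ^ CARD('n) * sqrt (det Q))"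
    using b by (subst nn_integral_gaussian[OF Q]) auto
  also have "\<dots> = ennreal ((1 / ?c) * (sqrt (pi / (1 / 2 - b)) ^ CARD('n) * sqrt (det Q)))"
    using c(1) by (intro ennreal_mult'[symmetric]) auto
  also have "1 / ?c * (sqrt (pi / (1 / 2 - b)) ^ CARD('n) * sqrt (det Q))
      = (sqrt (pi / (1 / 2 - b)) / sqrt (2 * pi)) ^ CARD('n)"
    unfolding c(2) using posdef_det_pos[OF Q] by (simp add: power_divide)
  also have "sqrt (pi / (1 / 2 - b)) / sqrt (2 * pi) = sqrt (1 / (1 - 2 * b))"
    unfolding real_sqrt_divide[symmetric] using b by (intro arg_cong[where f = sqrt]) (simp add: field_simps)
  finally show ?thesis .
qed

lemma nn_integral_gauss_density:
  "posdef Q \<Longrightarrow> (\<integral>\<^sup>+x. ennreal (gauss_density Q (x :: real^'n::finite)) \<partial>lborel) = 1"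
  using nn_integral_gauss_density_exp[of Q 0] by simp

section \<open>Convolution of Gaussian densities\<close>

lemma transpose_add: "transpose (A + B) = transpose A + transpose (B :: real^'n^'m)"
  by (simp add: transpose_def vec_eq_iff)

lemma matrix_add_rdistrib: "(A + B) ** C = A ** C + B ** (C :: real^'n^'m::finite)"
  by (simp add: matrix_matrix_mult_def vec_eq_iff distrib_right sum.distrib)

lemma matrix_diff_ldistrib: "A ** (B - C) = A ** B - A ** (C :: real^'n^'m::finite)"
  by (simp add: matrix_matrix_mult_def vec_eq_iff right_diff_distrib sum_subtractf)

lemma posdef_matrix_inv:
  fixes Q :: "real^'n::finite^'n"
  assumes "posdef Q"
  shows "posdef (matrix_inv Q)" and "Q ** matrix_inv Q = mat 1" and "matrix_inv Q ** Q = mat 1"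
    and "matrix_inv (matrix_inv Q) = Q"
proof -
  obtain R N :: "real^'n^'n" where RN: "R ** N = mat 1" and NR: "N ** R = mat 1"
    and Q: "Q = R ** transpose R" and inv: "matrix_inv Q = transpose N ** N"
    by (rule posdef_factor[OF assms])
  have "Q ** matrix_inv Q = R ** (transpose (N ** R)) ** N"
    unfolding inv matrix_transpose_mul by (simp add: Q matrix_mul_assoc)
  then show 1: "Q ** matrix_inv Q = mat 1"
    by (simp add: NR RN)
  then show 2: "matrix_inv Q ** Q = mat 1"
    using matrix_left_right_inverse by blast
  from 2 show "matrix_inv (matrix_inv Q) = Q"
    by (rule matrix_inv_eqI)
  have "N *v x \<noteq> 0" if "x \<noteq> 0" for x
  proof
    assume "N *v x = 0"
    then have "R *v (N *v x) = 0"
      by simp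
    with that show False
      by (simp add: matrix_vector_mul_assoc RN)
  qed
  then show "posdef (matrix_inv Q)"
    by (auto simp: posdef_def inv inner_gram matrix_transpose_mul)
qed

lemma posdef_add_congruence:
  fixes Q1 :: "real^'m::finite^'m" and Q2 :: "real^'n::finite^'n"
  assumes "posdef Q1" "posdef Q2"
  shows "posdef (Q2 + U ** Q1 ** transpose U)"
  unfolding posdef_def
proof (intro conjI allI impI)
  show "transpose (Q2 + U ** Q1 ** transpose U) = Q2 + U ** Q1 ** transpose U"
    using assms by (simp add: posdef_def transpose_add matrix_transpose_mul matrix_mul_assoc)
  fix x :: "real^'n" assume "x \<noteq> 0"
  then have "0 < x \<bullet> (Q2 *v x)"
    using assms(2) unfolding posdef_def by blast
  moreover have "x \<bullet> ((U ** Q1 ** transpose U) *v x) = (transpose U *v x) \<bullet> (Q1 *v (transpose U *v x))"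
    by (simp only: inner_matrix_vector_mult[of x U] matrix_vector_mul_assoc[symmetric])
  moreover have "0 \<le> (transpose U *v x) \<bullet> (Q1 *v (transpose U *v x))"
    by (rule posdef_inner_nonneg[OF assms(1)])
  ultimately show "0 < x \<bullet> ((Q2 + U ** Q1 ** transpose U) *v x)"
    by (simp add: matrix_vector_mult_add_rdistrib inner_add_right)
qed

text \<open>Let x have covariance Q1 and let z be U x plus independent noise of covariance Q2. Then
  S^(-1) is the covariance of x given z, S^(-1) U^T Q2^(-1) z its conditional mean (both centred),
  and Q3 the covariance of z. The identity compares the two factorisations of the joint
  exponent.\<close>

lemma complete_square:
  fixes Q1 :: "real^'m::finite^'m" and Q2 :: "real^'n::finite^'n" and U :: "real^'m^'n"
  assumes Q1: "posdef Q1" and Q2: "posdef Q2"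
  defines "S \<equiv> matrix_inv Q1 + transpose U ** matrix_inv Q2 ** U"
    and "Q3 \<equiv> Q2 + U ** Q1 ** transpose U"
  shows "x \<bullet> (matrix_inv Q1 *v x) + (z - U *v x) \<bullet> (matrix_inv Q2 *v (z - U *v x))
    = (x - (matrix_inv S ** transpose U ** matrix_inv Q2) *v z) \<bullet>
        (S *v (x - (matrix_inv S ** transpose U ** matrix_inv Q2) *v z)) + z \<bullet> (matrix_inv Q3 *v z)"
proof -
  define S1 S2 where "S1 = matrix_inv Q1" and "S2 = matrix_inv Q2"
  define L where "L = matrix_inv S ** transpose U ** S2"
  \<comment> \<open>The Woodbury expression Q2^(-1) - Q2^(-1) U S^(-1) U^T Q2^(-1) for Q3^(-1),
    confirmed below by checking Q3 T = 1.\<close>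
  define T where "T = S2 ** (mat 1 - U ** L)"
  have S1: "posdef S1" and S2: "posdef S2"
    using posdef_matrix_inv(1) Q1 Q2 by (auto simp: S1_def S2_def)
  have S: "S = S1 + transpose U ** S2 ** transpose (transpose U)"
    by (simp add: S_def S1_def S2_def)
  have pS: "posdef S"
    unfolding S by (rule posdef_add_congruence[OF S2 S1])
  have SL: "S ** L = transpose U ** S2"
    by (simp add: L_def matrix_mul_assoc posdef_matrix_inv(2)[OF pS])
  have S1L: "transpose U ** S2 ** (mat 1 - U ** L) = S1 ** L"
    using SL by (simp add: S matrix_mul_assoc matrix_diff_ldistrib matrix_add_rdistrib diff_eq_eq)
  have "Q3 ** T = (Q2 ** S2) ** (mat 1 - U ** L) + U ** Q1 ** (transpose U ** S2 ** (mat 1 - U ** L))"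
    by (simp add: Q3_def T_def matrix_add_rdistrib matrix_mul_assoc)
  also have "\<dots> = (mat 1 - U ** L) + U ** (Q1 ** S1) ** L"
    unfolding S1L by (simp add: S2_def posdef_matrix_inv(2)[OF Q2] matrix_mul_assoc)
  also have "\<dots> = mat 1"
    by (simp add: S1_def posdef_matrix_inv(2)[OF Q1])
  finally have T: "matrix_inv Q3 = T"
    by (rule matrix_inv_eqI)
  have x_z: "x \<bullet> (S *v (L *v z)) = (U *v x) \<bullet> (S2 *v z)" for x
    unfolding matrix_vector_mul_assoc SL
    by (metis inner_matrix_vector_mult matrix_vector_mul_assoc transpose_transpose)
  have "x \<bullet> ((transpose U ** S2 ** U) *v x) = (U *v x) \<bullet> (S2 *v (U *v x))"
    by (metis inner_matrix_vector_mult matrix_vector_mul_assoc transpose_transpose)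
  then have x_x: "x \<bullet> (S *v x) = x \<bullet> (S1 *v x) + (U *v x) \<bullet> (S2 *v (U *v x))"
    by (simp add: S matrix_vector_mult_add_rdistrib inner_add_right)
  have z_z: "z \<bullet> (T *v z) = z \<bullet> (S2 *v z) - (U *v (L *v z)) \<bullet> (S2 *v z)"
    using posdef_inner_commute[OF S2, of z "U *v (L *v z)"]
    by (simp add: T_def matrix_vector_mult_diff_rdistrib matrix_vector_mult_diff_distrib inner_diff_right
        flip: matrix_vector_mul_assoc)
  have "(x - L *v z) \<bullet> (S *v (x - L *v z)) = x \<bullet> (S *v x) - 2 * (x \<bullet> (S *v (L *v z))) + (L *v z) \<bullet> (S *v (L *v z))"
    using posdef_inner_commute[OF pS, of "L *v z" x]
    by (simp add: matrix_vector_mult_diff_distrib inner_diff)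
  moreover have "(z - U *v x) \<bullet> (S2 *v (z - U *v x))
      = z \<bullet> (S2 *v z) - 2 * ((U *v x) \<bullet> (S2 *v z)) + (U *v x) \<bullet> (S2 *v (U *v x))"
    using posdef_inner_commute[OF S2, of z "U *v x"]
    by (simp add: matrix_vector_mult_diff_distrib inner_diff)
  ultimately show ?thesis
    unfolding T S1_def[symmetric] S2_def[symmetric] unfolding L_def[symmetric] x_x x_z z_z
    by simp
qed

lemma nn_integral_lborel_translate:
  fixes f :: "'a::euclidean_space \<Rightarrow> ennreal"
  assumes [measurable]: "f \<in> borel_measurable borel"
  shows "(\<integral>\<^sup>+x. f (x - a) \<partial>lborel) = (\<integral>\<^sup>+x. f x \<partial>lborel)"
proof -
  have "(\<integral>\<^sup>+x. f x \<partial>lborel) = (\<integral>\<^sup>+x. f x \<partial>distr lborel borel ((+) (- a)))"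
    by (simp only: lborel_distr_plus)
  also have "\<dots> = (\<integral>\<^sup>+x. f (x - a) \<partial>lborel)"
    by (subst nn_integral_distr) auto
  finally show ?thesis ..
qed

text \<open>Bayes' formula: prior times likelihood equals posterior times marginal. The exponents
  agree by \<open>complete_square\<close>, so only a normalising factor K remains to be
  determined.\<close>

lemma gauss_density_disintegration:
  fixes Q1 :: "real^'m::finite^'m" and Q2 :: "real^'n::finite^'n" and U :: "real^'m^'n"
  assumes Q1: "posdef Q1" and Q2: "posdef Q2"
  shows "\<exists>Q4 L. posdef Q4 \<and> (\<forall>x z. gauss_density Q1 x * gauss_density Q2 (z - U *v x)
      = gauss_density Q4 (x - L *v z) * gauss_density (Q2 + U ** Q1 ** transpose U) z)"
proof -
  define S where "S = matrix_inv Q1 + transpose U ** matrix_inv Q2 ** U"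
  define Q3 where "Q3 = Q2 + U ** Q1 ** transpose U"
  define Q4 where "Q4 = matrix_inv S"
  define L where "L = matrix_inv S ** transpose U ** matrix_inv Q2"
  have pS: "posdef S"
    using posdef_add_congruence[OF posdef_matrix_inv(1)[OF Q2] posdef_matrix_inv(1)[OF Q1], of "transpose U"]
    by (simp add: S_def)
  have Q4: "posdef Q4" and invQ4: "matrix_inv Q4 = S"
    using posdef_matrix_inv[OF pS] by (auto simp: Q4_def)
  have Q3: "posdef Q3"
    unfolding Q3_def by (rule posdef_add_congruence[OF Q1 Q2])
  let ?c = "\<lambda>n d. sqrt ((2 * pi) ^ n * d)"
  define K where "K = ?c CARD('m) (det Q4) * ?c CARD('n) (det Q3) / (?c CARD('m) (det Q1) * ?c CARD('n) (det Q2))"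
  have c: "?c n (det Q1) \<noteq> 0" "?c n (det Q2) \<noteq> 0" "?c n (det Q3) \<noteq> 0" "?c n (det Q4) \<noteq> 0" for n
    using posdef_det_pos[OF Q1] posdef_det_pos[OF Q2] posdef_det_pos[OF Q3] posdef_det_pos[OF Q4] by auto
  have K0: "0 \<le> K"
    using posdef_det_pos[OF Q1] posdef_det_pos[OF Q2] posdef_det_pos[OF Q3] posdef_det_pos[OF Q4]
    by (auto simp: K_def)
  have eq: "gauss_density Q1 x * gauss_density Q2 (z - U *v x)
      = K * (gauss_density Q4 (x - L *v z) * gauss_density Q3 z)" for x z
  proof -
    have "exp (- (x \<bullet> (matrix_inv Q1 *v x)) / 2) * exp (- ((z - U *v x) \<bullet> (matrix_inv Q2 *v (z - U *v x))) / 2)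
        = exp (- ((x - L *v z) \<bullet> (S *v (x - L *v z))) / 2) * exp (- (z \<bullet> (matrix_inv Q3 *v z)) / 2)"
      unfolding exp_add[symmetric]
      using complete_square[OF Q1 Q2, of x z U, folded S_def Q3_def, folded L_def]
      by (intro arg_cong[where f = exp]) (simp add: field_simps)
    then show ?thesis
      using c unfolding gauss_density_def invQ4 K_def by (simp add: divide_simps)
  qed
  have one: "(\<integral>\<^sup>+x. ennreal (gauss_density Q (x - a)) \<partial>lborel) = 1" if "posdef Q" for Q :: "real^'k::finite^'k" and a
    using nn_integral_lborel_translate[of "\<lambda>x. ennreal (gauss_density Q x)" a] nn_integral_gauss_density[OF that]
    by simp
  have nn: "0 \<le> gauss_density Q1 x" "0 \<le> gauss_density Q2 z" "0 \<le> gauss_density Q3 z" "0 \<le> gauss_density Q4 x" for x z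
    using Q1 Q2 Q3 Q4 by (auto intro: less_imp_le gauss_density_pos)
  \<comment> \<open>Both sides of \<open>eq\<close> integrate to 1 over \<open>(x, z)\<close> up to the factor \<open>K\<close>, so no determinant identity is needed.\<close>
  have "1 = (\<integral>\<^sup>+x. ennreal (gauss_density Q1 x) * (\<integral>\<^sup>+z. ennreal (gauss_density Q2 (z - U *v x)) \<partial>lborel) \<partial>lborel)"
    by (simp add: one[OF Q2] nn_integral_gauss_density[OF Q1])
  also have "\<dots> = (\<integral>\<^sup>+x. \<integral>\<^sup>+z. ennreal (gauss_density Q1 x * gauss_density Q2 (z - U *v x)) \<partial>lborel \<partial>lborel)"
    by (simp add: nn ennreal_mult' nn_integral_cmult)
  also have "\<dots> = (\<integral>\<^sup>+z. \<integral>\<^sup>+x. ennreal (gauss_density Q1 x * gauss_density Q2 (z - U *v x)) \<partial>lborel \<partial>lborel)"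
    by (rule lborel_pair.Fubini') measurable
  also have "\<dots> = (\<integral>\<^sup>+z. ennreal (K * gauss_density Q3 z) * (\<integral>\<^sup>+x. ennreal (gauss_density Q4 (x - L *v z)) \<partial>lborel) \<partial>lborel)"
    unfolding eq using K0 by (subst nn_integral_cmult[symmetric]) (auto simp: nn mult_ac simp flip: ennreal_mult')
  also have "\<dots> = ennreal K"
    using K0 by (simp add: one[OF Q4] nn ennreal_mult' nn_integral_cmult nn_integral_gauss_density[OF Q3])
  finally have "K = 1"
    using K0 by simp
  with Q4 eq show ?thesis
    unfolding Q3_def by (intro exI[of _ Q4] exI[of _ L]) simp
qed

text \<open>After Fubini and Bayes' formula the posterior density integrates to 1 in x. With Q1, m
  taken from nu_s this is the invariance that carries nu_s-averages of P psi to nu_t-averages of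
  psi.\<close>

lemma nn_integral_gauss_convolution:
  fixes Q1 :: "real^'m::finite^'m" and Q2 :: "real^'n::finite^'n" and U :: "real^'m^'n"
  assumes Q1: "posdef Q1" and Q2: "posdef Q2" and \<psi> [measurable]: "\<psi> \<in> borel_measurable borel"
  shows "(\<integral>\<^sup>+x. ennreal (gauss_density Q1 (x - m)) *
      (\<integral>\<^sup>+z. \<psi> z * ennreal (gauss_density Q2 (z - U *v x - g)) \<partial>lborel) \<partial>lborel)
    = (\<integral>\<^sup>+z. \<psi> z * ennreal (gauss_density (Q2 + U ** Q1 ** transpose U) (z - (U *v m + g))) \<partial>lborel)"
proof -
  obtain Q4 :: "real^'m^'m" and L :: "real^'n^'m" where Q4: "posdef Q4"
    and eq: "\<And>x z. gauss_density Q1 x * gauss_density Q2 (z - U *v x)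
      = gauss_density Q4 (x - L *v z) * gauss_density (Q2 + U ** Q1 ** transpose U) z"
    using gauss_density_disintegration[OF Q1 Q2, of U] by blast
  let ?m = "U *v m + g"
  note nn = gauss_density_pos[OF Q1, THEN less_imp_le] gauss_density_pos[OF Q2, THEN less_imp_le]
    gauss_density_pos[OF Q4, THEN less_imp_le]
  have e: "gauss_density Q1 (x - m) * gauss_density Q2 (z - U *v x - g)
     = gauss_density Q4 (x - (m + L *v (z - ?m))) * gauss_density (Q2 + U ** Q1 ** transpose U) (z - ?m)" for x z
    using eq[of "x - m" "z - ?m"] by (simp add: matrix_vector_mult_diff_distrib algebra_simps)
  have "(\<integral>\<^sup>+x. ennreal (gauss_density Q1 (x - m)) *
      (\<integral>\<^sup>+z. \<psi> z * ennreal (gauss_density Q2 (z - U *v x - g)) \<partial>lborel) \<partial>lborel)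
    = (\<integral>\<^sup>+x. \<integral>\<^sup>+z. \<psi> z * ennreal (gauss_density Q1 (x - m) * gauss_density Q2 (z - U *v x - g)) \<partial>lborel \<partial>lborel)"
    by (subst nn_integral_cmult[symmetric]) (auto simp: nn ennreal_mult' mult_ac)
  also have "\<dots> = (\<integral>\<^sup>+z. \<integral>\<^sup>+x. \<psi> z * ennreal (gauss_density Q1 (x - m) * gauss_density Q2 (z - U *v x - g)) \<partial>lborel \<partial>lborel)"
    by (rule lborel_pair.Fubini') measurable
  also have "\<dots> = (\<integral>\<^sup>+z. (\<psi> z * ennreal (gauss_density (Q2 + U ** Q1 ** transpose U) (z - ?m))) *
      (\<integral>\<^sup>+x. ennreal (gauss_density Q4 (x - (m + L *v (z - ?m)))) \<partial>lborel) \<partial>lborel)"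
    unfolding e by (subst nn_integral_cmult[symmetric]) (auto simp: nn ennreal_mult' mult_ac)
  also have "\<dots> = (\<integral>\<^sup>+z. \<psi> z * ennreal (gauss_density (Q2 + U ** Q1 ** transpose U) (z - ?m)) \<partial>lborel)"
    using nn_integral_lborel_translate[of "\<lambda>x. ennreal (gauss_density Q4 x)"]
    by (simp add: nn_integral_gauss_density[OF Q4])
  finally show ?thesis .
qed

lemma gauss_density_le:
  "posdef Q \<Longrightarrow> gauss_density Q w \<le> gauss_density Q 0"
  using posdef_inner_nonneg[OF posdef_matrix_inv(1), of Q w] posdef_det_pos[of Q]
  by (auto simp: gauss_density_def intro!: divide_right_mono)

text \<open>Makes the point evaluations \<open>\<phi> \<mapsto> P(\<phi>\<^sup>2)(x)\<close> finite for \<open>\<phi> \<in> L\<^sup>2(\<nu>\<^sub>t)\<close>.\<close>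

lemma gauss_density_harnack:
  fixes Q1 :: "real^'m::finite^'m" and Q2 :: "real^'n::finite^'n" and U :: "real^'m^'n"
  assumes Q1: "posdef Q1" and Q2: "posdef Q2"
  obtains c where "0 \<le> c" and
    "\<And>z. gauss_density Q2 (z - U *v x - g)
       \<le> c * gauss_density (Q2 + U ** Q1 ** transpose U) (z - (U *v m + g))"
proof -
  obtain Q4 :: "real^'m^'m" and L :: "real^'n^'m" where Q4: "posdef Q4"
    and eq: "\<And>x z. gauss_density Q1 x * gauss_density Q2 (z - U *v x)
      = gauss_density Q4 (x - L *v z) * gauss_density (Q2 + U ** Q1 ** transpose U) z"
    using gauss_density_disintegration[OF Q1 Q2, of U] by blast
  let ?m = "U *v m + g" and ?Q3 = "Q2 + U ** Q1 ** transpose U"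
  \<comment> \<open>Bayes' formula divided by the prior density at x, with the posterior density
    bounded by its maximum. This c depends on x, so it serves finiteness only and never enters the
    final estimate.\<close>
  let ?c = "gauss_density Q4 0 / gauss_density Q1 (x - m)"
  have pos: "0 < gauss_density Q1 (x - m)" "0 < gauss_density Q4 0"
    using Q1 Q4 by (auto intro: gauss_density_pos)
  have "gauss_density Q2 (z - U *v x - g) \<le> ?c * gauss_density ?Q3 (z - ?m)" for z
  proof -
    have "gauss_density Q1 (x - m) * gauss_density Q2 (z - U *v x - g)
        = gauss_density Q4 (x - m - L *v (z - ?m)) * gauss_density ?Q3 (z - ?m)"
      using eq[of "x - m" "z - ?m"] by (simp add: matrix_vector_mult_diff_distrib algebra_simps)
    also have "\<dots> \<le> gauss_density Q4 0 * gauss_density ?Q3 (z - ?m)"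
      by (intro mult_right_mono gauss_density_le Q4 less_imp_le gauss_density_pos posdef_add_congruence Q1 Q2)
    finally show ?thesis
      using pos by (simp add: field_simps)
  qed
  then show thesis
    using pos by (intro that[of ?c]) auto
qed

section \<open>Gaussian integral operators\<close>

text \<open>The operator P_{s,t} for Q = Q(t,s), U = U(t,s), g = g(t,s), with x moved into the
  density: derivatives then act on a smooth kernel and phi need only be measurable.\<close>

definition gauss_op ::
  "real^'n::finite^'n \<Rightarrow> real^'m::finite^'n \<Rightarrow> real^'n \<Rightarrow> (real^'n \<Rightarrow> real) \<Rightarrow> real^'m \<Rightarrow> real" where
  "gauss_op Q U g \<phi> x = (\<integral>z. \<phi> z * gauss_density Q (z - U *v x - g) \<partial>lborel)"

text \<open>The square root of the second moment of the Hermite-like factor for kappa = 1: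
  sqrt(4/3)^n is the exponential moment at b = 1/8.\<close>

definition smoothing_const :: "'n::finite itself \<Rightarrow> nat \<Rightarrow> real" where
  "smoothing_const _ k = herm_const k * sqrt (sqrt (4 / 3) ^ CARD('n))"

lemma smoothing_const_pos: "0 < smoothing_const TYPE('n::finite) k"
  by (simp add: smoothing_const_def herm_const_pos)

lemma gauss_density_eq_kernel:
  fixes Q :: "real^'n::finite^'n"
  assumes "matrix_inv Q = transpose N ** N"
  shows "gauss_density Q w = gauss_density Q 0 * gauss_kernel (N *v w)"
  by (simp add: gauss_density_def gauss_kernel_def assms inner_gram power2_norm_eq_inner)

lemma integrable_exp_neg_gram:
  fixes N :: "real^'n::finite^'n"
  assumes Q: "posdef Q" and N: "matrix_inv Q = transpose N ** N" and a: "0 < a"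
  shows "integrable lborel (\<lambda>z. exp (- a * (norm (N *v (z - y)))\<^sup>2))"
proof (rule integrableI_nonneg)
  let ?f = "\<lambda>z. ennreal (exp (- a * (z \<bullet> (matrix_inv Q *v z))))"
  have eq: "ennreal (exp (- a * (norm (N *v z))\<^sup>2)) = ?f z" for z
    by (simp add: N inner_gram power2_norm_eq_inner)
  have "(\<integral>\<^sup>+z. ?f (z - y) \<partial>lborel) = (\<integral>\<^sup>+z. ?f z \<partial>lborel)"
    by (rule nn_integral_lborel_translate) measurable
  then show "(\<integral>\<^sup>+z. ennreal (exp (- a * (norm (N *v (z - y)))\<^sup>2)) \<partial>lborel) < \<infinity>"
    unfolding eq nn_integral_gaussian[OF Q a] by simp
qed auto

text \<open>The pair (m, Q1) describes nu_s; \<open>fin\<close> says that phi is in L2 of the image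
  Gaussian, which will be nu_t.\<close>

context
  fixes Q1 :: "real^'m::finite^'m" and Q2 :: "real^'n::finite^'n" and U :: "real^'m^'n"
    and m :: "real^'m" and g :: "real^'n" and \<phi> :: "real^'n \<Rightarrow> real"
  assumes Q1: "posdef Q1" and Q2: "posdef Q2" and \<phi> [measurable]: "\<phi> \<in> borel_measurable borel"
    and fin: "(\<integral>\<^sup>+z. ennreal ((\<phi> z)\<^sup>2) *
      ennreal (gauss_density (Q2 + U ** Q1 ** transpose U) (z - (U *v m + g))) \<partial>lborel) < \<infinity>"
begin

lemma integrable_square_gauss_density: "integrable lborel (\<lambda>z. (\<phi> z)\<^sup>2 * gauss_density Q2 (z - U *v x - g))"
proof (rule integrableI_nonneg)
  obtain c where c: "0 \<le> c" "\<And>z. gauss_density Q2 (z - U *v x - g)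
       \<le> c * gauss_density (Q2 + U ** Q1 ** transpose U) (z - (U *v m + g))"
    using gauss_density_harnack[OF Q1 Q2, of U x g m] by blast
  have "(\<integral>\<^sup>+z. ennreal ((\<phi> z)\<^sup>2 * gauss_density Q2 (z - U *v x - g)) \<partial>lborel)
     \<le> (\<integral>\<^sup>+z. ennreal c * (ennreal ((\<phi> z)\<^sup>2) *
      ennreal (gauss_density (Q2 + U ** Q1 ** transpose U) (z - (U *v m + g)))) \<partial>lborel)"
  proof (rule nn_integral_mono)
    fix z
    have "(\<phi> z)\<^sup>2 * gauss_density Q2 (z - U *v x - g)
        \<le> c * ((\<phi> z)\<^sup>2 * gauss_density (Q2 + U ** Q1 ** transpose U) (z - (U *v m + g)))"
      using mult_left_mono[OF c(2)[of z], of "(\<phi> z)\<^sup>2"] by (simp add: mult_ac)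
    then show "ennreal ((\<phi> z)\<^sup>2 * gauss_density Q2 (z - U *v x - g)) \<le> ennreal c * (ennreal ((\<phi> z)\<^sup>2) *
      ennreal (gauss_density (Q2 + U ** Q1 ** transpose U) (z - (U *v m + g))))"
      using c(1) by (simp add: ennreal_leI flip: ennreal_mult')
  qed
  also have "\<dots> < \<infinity>"
    using fin by (subst nn_integral_cmult) (auto simp: ennreal_mult_less_top)
  finally show "(\<integral>\<^sup>+z. ennreal ((\<phi> z)\<^sup>2 * gauss_density Q2 (z - U *v x - g)) \<partial>lborel) < \<infinity>" .
qed (auto intro!: mult_nonneg_nonneg less_imp_le[OF gauss_density_pos[OF Q2]])

text \<open>The hypothesis on kappa bounds the columns of Q2^(-1/2) U, the vectors from which the
  Hermite-like polynomial F is built. The derivative is the rho-integral of phi F, so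
  Cauchy--Schwarz in L2(rho) separates phi from F.\<close>

lemma
  assumes \<kappa>: "0 \<le> \<kappa>" "\<And>i. (U *v axis i 1) \<bullet> (matrix_inv Q2 *v (U *v axis i 1)) \<le> \<kappa>\<^sup>2"
  shows C_k_gauss_op: "C_k k (gauss_op Q2 U g \<phi>)"
    and gauss_op_integrable: "integrable lborel (\<lambda>z. \<phi> z * gauss_density Q2 (z - U *v x - g))"
    and gauss_op_deriv_bound: "ennreal ((partial_derivs is (gauss_op Q2 U g \<phi>) x)\<^sup>2)
      \<le> ennreal ((smoothing_const TYPE('n) (length is) * \<kappa> ^ length is)\<^sup>2) *
        (\<integral>\<^sup>+z. ennreal ((\<phi> z)\<^sup>2) * ennreal (gauss_density Q2 (z - U *v x - g)) \<partial>lborel)"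
proof -
  obtain R N :: "real^'n^'n" where "R ** N = mat 1" and "N ** R = mat 1"
    and "Q2 = R ** transpose R" and N: "matrix_inv Q2 = transpose N ** N"
    by (rule posdef_factor[OF Q2])
  \<comment> \<open>Whitening: in the variable w = Y z - V x the density becomes a multiple of the
    standard kernel.\<close>
  define V where "V = N ** U"
  define Y where "Y z = N *v (z - g)" for z
  define c where "c = gauss_density Q2 0"
  have c: "0 < c"
    unfolding c_def by (rule gauss_density_pos[OF Q2])
  have w: "Y z - V *v x = N *v (z - (U *v x + g))" for z x
    by (simp add: Y_def V_def algebra_simps matrix_vector_mult_diff_distrib flip: matrix_vector_mul_assoc)
  have dens: "gauss_density Q2 (z - U *v x - g) = c * gauss_kernel (Y z - V *v x)" for z x
    using gauss_density_eq_kernel[OF N, of "z - U *v x - g"]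
    by (simp add: w c_def algebra_simps)
  have Y [measurable]: "Y \<in> borel_measurable borel"
    unfolding Y_def by measurable
  let ?\<psi> = "\<lambda>z. c * \<phi> z"
  have int: "integrable lborel (\<lambda>z. ?\<psi> z * exp (- (3 / 8) * (norm (Y z - V *v x))\<^sup>2))" for x
  proof -
    let ?n = "\<lambda>z. (norm (Y z - V *v x))\<^sup>2"
    \<comment> \<open>With n = |w|^2, |phi| exp(-3n/8) = (|phi| exp(-n/4)) exp(-n/8) <= phi^2
      exp(-n/2) + exp(-n/4). The first term is controlled by phi in L2, the second is a
      Gaussian.\<close>
    have "integrable lborel (\<lambda>z. (\<phi> z)\<^sup>2 * gauss_density Q2 (z - U *v x - g) + c * exp (- (1 / 4) * ?n z))"
      unfolding w by (intro Bochner_Integration.integrable_add integrable_mult_right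
          integrable_square_gauss_density integrable_exp_neg_gram[OF Q2 N]) simp
    then show ?thesis
    proof (rule Bochner_Integration.integrable_bound)
      show "AE z in lborel. norm (?\<psi> z * exp (- (3 / 8) * ?n z))
          \<le> norm ((\<phi> z)\<^sup>2 * gauss_density Q2 (z - U *v x - g) + c * exp (- (1 / 4) * ?n z))"
      proof (rule AE_I2)
        fix z
        let ?a = "\<bar>\<phi> z\<bar> * exp (- (1 / 4) * ?n z)" and ?b = "exp (- (1 / 8) * ?n z)"
        have e: "exp (- (1 / 4) * ?n z) * ?b = exp (- (3 / 8) * ?n z)"
          "exp (- (1 / 4) * ?n z) * exp (- (1 / 4) * ?n z) = exp (- ?n z / 2)"
          "?b * ?b = exp (- (1 / 4) * ?n z)"
          unfolding exp_add[symmetric] by (rule arg_cong[where f = exp], simp)+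
        have "a * b \<le> a * a + b * b" if "0 \<le> a" "0 \<le> b" for a b :: real
          using mult_nonneg_nonneg[OF that] zero_le_square[of "a - b"] by (simp add: algebra_simps)
        then have "?a * ?b \<le> ?a * ?a + ?b * ?b"
          by (simp only: abs_ge_zero exp_ge_zero mult_nonneg_nonneg)
        moreover have "?a * ?b = \<bar>\<phi> z\<bar> * exp (- (3 / 8) * ?n z)"
          unfolding e(1)[symmetric] by (simp only: mult.assoc)
        moreover have "?a * ?a = (\<phi> z)\<^sup>2 * exp (- ?n z / 2)"
          unfolding e(2)[symmetric] by (simp add: power2_eq_square mult_ac)
        ultimately have "\<bar>\<phi> z\<bar> * exp (- (3 / 8) * ?n z) \<le> (\<phi> z)\<^sup>2 * exp (- ?n z / 2) + exp (- (1 / 4) * ?n z)"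
          by (simp only: e(3))
        then have "c * (\<bar>\<phi> z\<bar> * exp (- (3 / 8) * ?n z)) \<le> c * ((\<phi> z)\<^sup>2 * exp (- ?n z / 2) + exp (- (1 / 4) * ?n z))"
          using c by (intro mult_left_mono) auto
        then show "norm (?\<psi> z * exp (- (3 / 8) * ?n z))
          \<le> norm ((\<phi> z)\<^sup>2 * gauss_density Q2 (z - U *v x - g) + c * exp (- (1 / 4) * ?n z))"
          unfolding dens gauss_kernel_def using c by (simp add: abs_mult algebra_simps)
      qed
    qed measurable
  qed
  have op: "gauss_op Q2 U g \<phi> = (\<lambda>x. \<integral>z. ?\<psi> z * gauss_kernel (Y z - V *v x) \<partial>lborel)"
    by (rule ext) (simp only: gauss_op_def dens mult_ac)
  have \<psi>: "?\<psi> \<in> borel_measurable lborel" and Y': "Y \<in> borel_measurable lborel"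
    by measurable
  show "C_k k (gauss_op Q2 U g \<phi>)"
    unfolding op by (rule C_k_kernel_integral[OF \<psi> Y' int])
  show "integrable lborel (\<lambda>z. \<phi> z * gauss_density Q2 (z - U *v x - g))"
    using integrable_partial_derivs_kernel[OF \<psi> Y' int, of "[]" x] by (simp add: dens mult_ac)
  let ?k = "length is"
  obtain F where F: "weighted_poly (\<lambda>i. V *v axis i 1) ?k (fact ?k) F"
    and eq: "\<And>y. partial_derivs is (\<lambda>x. gauss_kernel (y - V *v x)) =
       (\<lambda>x. F (y - V *v x) * gauss_kernel (y - V *v x))"
    using partial_derivs_gauss_kernel[of V "is"] by blast
  from weighted_poly_deriv[OF F] obtain DF where D: "\<And>w. (F has_derivative DF w) (at w)"
    by blast
  then have "continuous_on UNIV F"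
    by (meson has_derivative_continuous continuous_at_imp_continuous_on)
  then have [measurable]: "F \<in> borel_measurable borel"
    by (rule borel_measurable_continuous_onI)
  have e: "norm (V *v axis i 1) \<le> \<kappa>" for i
  proof -
    have "(norm (V *v axis i 1))\<^sup>2 \<le> \<kappa>\<^sup>2"
      using \<kappa>(2)[of i, unfolded N inner_gram] by (simp only: V_def power2_norm_eq_inner matrix_vector_mul_assoc)
    then show ?thesis
      using \<kappa>(1) by (rule power2_le_imp_le)
  qed
  let ?\<rho> = "\<lambda>z. gauss_density Q2 (z - U *v x - g)" and ?w = "\<lambda>z. Y z - V *v x"
  let ?H = "herm_const ?k * \<kappa> ^ ?k"
  have \<rho>: "0 \<le> ?\<rho> z" for z
    using gauss_density_pos[OF Q2] by (rule less_imp_le)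
  have deriv: "partial_derivs is (gauss_op Q2 U g \<phi>) x = (\<integral>z. \<phi> z * F (?w z) * ?\<rho> z \<partial>lborel)"
    unfolding op partial_derivs_kernel_integral[OF \<psi> Y' int] eq by (simp add: dens mult_ac)
  \<comment> \<open>If the integrand were not integrable, its Bochner integral would be 0 by
    convention and the bound would hold trivially.\<close>
  have "ennreal \<bar>partial_derivs is (gauss_op Q2 U g \<phi>) x\<bar> \<le> (\<integral>\<^sup>+z. ennreal (norm (\<phi> z * F (?w z) * ?\<rho> z)) \<partial>lborel)"
    unfolding deriv using integral_norm_bound_ennreal[of lborel "\<lambda>z. \<phi> z * F (?w z) * ?\<rho> z"]
    by (cases "integrable lborel (\<lambda>z. \<phi> z * F (?w z) * ?\<rho> z)") (auto simp: not_integrable_integral_eq)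
  also have "\<dots> = (\<integral>\<^sup>+z. ennreal (\<bar>\<phi> z\<bar> * sqrt (?\<rho> z)) * ennreal (\<bar>F (?w z)\<bar> * sqrt (?\<rho> z)) \<partial>lborel)"
  proof (rule nn_integral_cong)
    fix z
    have "norm (\<phi> z * F (?w z) * ?\<rho> z) = (\<bar>\<phi> z\<bar> * sqrt (?\<rho> z)) * (\<bar>F (?w z)\<bar> * sqrt (?\<rho> z))"
      using \<rho>[of z] by (simp add: abs_mult)
    then show "ennreal (norm (\<phi> z * F (?w z) * ?\<rho> z)) =
        ennreal (\<bar>\<phi> z\<bar> * sqrt (?\<rho> z)) * ennreal (\<bar>F (?w z)\<bar> * sqrt (?\<rho> z))"
      using \<rho>[of z] by (simp only: ennreal_mult' real_sqrt_ge_zero abs_ge_zero mult_nonneg_nonneg)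
  qed
  finally have "(ennreal \<bar>partial_derivs is (gauss_op Q2 U g \<phi>) x\<bar>)\<^sup>2
      \<le> (\<integral>\<^sup>+z. ennreal (\<bar>\<phi> z\<bar> * sqrt (?\<rho> z)) * ennreal (\<bar>F (?w z)\<bar> * sqrt (?\<rho> z)) \<partial>lborel)\<^sup>2"
    by (rule power_mono) simp
  also have "\<dots> \<le> (\<integral>\<^sup>+z. (ennreal (\<bar>\<phi> z\<bar> * sqrt (?\<rho> z)))\<^sup>2 \<partial>lborel) * (\<integral>\<^sup>+z. (ennreal (\<bar>F (?w z)\<bar> * sqrt (?\<rho> z)))\<^sup>2 \<partial>lborel)"
    by (rule Cauchy_Schwarz_nn_integral) measurable
  also have "(\<integral>\<^sup>+z. (ennreal (\<bar>\<phi> z\<bar> * sqrt (?\<rho> z)))\<^sup>2 \<partial>lborel) = (\<integral>\<^sup>+z. ennreal ((\<phi> z)\<^sup>2) * ennreal (?\<rho> z) \<partial>lborel)"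
    using \<rho> by (simp add: ennreal_power power_mult_distrib ennreal_mult')
  finally have CS: "(ennreal \<bar>partial_derivs is (gauss_op Q2 U g \<phi>) x\<bar>)\<^sup>2
      \<le> (\<integral>\<^sup>+z. ennreal ((\<phi> z)\<^sup>2) * ennreal (?\<rho> z) \<partial>lborel) *
        (\<integral>\<^sup>+z. (ennreal (\<bar>F (?w z)\<bar> * sqrt (?\<rho> z)))\<^sup>2 \<partial>lborel)" .
  \<comment> \<open>Squaring the bound on F doubles the exponent 1/16 to 1/8, within the range b <
    1/2 of the exponential moment.\<close>
  have "(\<integral>\<^sup>+z. (ennreal (\<bar>F (?w z)\<bar> * sqrt (?\<rho> z)))\<^sup>2 \<partial>lborel)
      \<le> (\<integral>\<^sup>+z. ennreal (?H\<^sup>2) * ennreal (?\<rho> z * exp (1 / 8 * (norm (?w z))\<^sup>2)) \<partial>lborel)"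
  proof (rule nn_integral_mono)
    fix z
    have "\<bar>F (?w z)\<bar>\<^sup>2 \<le> (?H * exp ((norm (?w z))\<^sup>2 / 16))\<^sup>2"
      by (intro power_mono weighted_poly_exp_bound[OF F e \<kappa>(1)]) simp
    also have "\<dots> = ?H\<^sup>2 * exp (1 / 8 * (norm (?w z))\<^sup>2)"
      by (simp add: power_mult_distrib flip: exp_double)
    finally have "\<bar>F (?w z)\<bar>\<^sup>2 * ?\<rho> z \<le> ?H\<^sup>2 * exp (1 / 8 * (norm (?w z))\<^sup>2) * ?\<rho> z"
      using \<rho> by (rule mult_right_mono)
    then show "(ennreal (\<bar>F (?w z)\<bar> * sqrt (?\<rho> z)))\<^sup>2 \<le> ennreal (?H\<^sup>2) * ennreal (?\<rho> z * exp (1 / 8 * (norm (?w z))\<^sup>2))"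
      using \<rho>[of z] by (simp add: ennreal_power power_mult_distrib mult_ac ennreal_leI flip: ennreal_mult')
  qed
  also have "\<dots> = ennreal (?H\<^sup>2) * (\<integral>\<^sup>+z. ennreal (?\<rho> z * exp (1 / 8 * (norm (?w z))\<^sup>2)) \<partial>lborel)"
    by (rule nn_integral_cmult) measurable
  also have "(\<integral>\<^sup>+z. ennreal (?\<rho> z * exp (1 / 8 * (norm (?w z))\<^sup>2)) \<partial>lborel)
      = ennreal (sqrt (4 / 3) ^ CARD('n))"
  proof -
    let ?f = "\<lambda>z. ennreal (gauss_density Q2 z * exp (1 / 8 * (z \<bullet> (matrix_inv Q2 *v z))))"
    have "(\<integral>\<^sup>+z. ?f (z - (U *v x + g)) \<partial>lborel) = (\<integral>\<^sup>+z. ?f z \<partial>lborel)"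
      by (rule nn_integral_lborel_translate) measurable
    then show ?thesis
      using nn_integral_gauss_density_exp[OF Q2, of "1 / 8"]
      by (simp add: w N inner_gram power2_norm_eq_inner diff_diff_eq)
  qed
  also have "ennreal (?H\<^sup>2) * ennreal (sqrt (4 / 3) ^ CARD('n)) = ennreal ((smoothing_const TYPE('n) ?k * \<kappa> ^ ?k)\<^sup>2)"
    by (simp add: smoothing_const_def power_mult_distrib mult_ac flip: ennreal_mult')
  finally have J: "(\<integral>\<^sup>+z. (ennreal (\<bar>F (?w z)\<bar> * sqrt (?\<rho> z)))\<^sup>2 \<partial>lborel)
      \<le> ennreal ((smoothing_const TYPE('n) ?k * \<kappa> ^ ?k)\<^sup>2)" .
  show "ennreal ((partial_derivs is (gauss_op Q2 U g \<phi>) x)\<^sup>2)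
      \<le> ennreal ((smoothing_const TYPE('n) ?k * \<kappa> ^ ?k)\<^sup>2) *
        (\<integral>\<^sup>+z. ennreal ((\<phi> z)\<^sup>2) * ennreal (?\<rho> z) \<partial>lborel)"
    using order_trans[OF CS mult_left_mono[OF J zero_le]] by (simp add: ennreal_power mult.commute)
qed

lemma borel_measurable_partial_derivs_gauss_op:
  "partial_derivs is (gauss_op Q2 U g \<phi>) \<in> borel_measurable borel"
proof -
  let ?q = "\<lambda>i. (U *v axis i 1) \<bullet> (matrix_inv Q2 *v (U *v axis i 1))"
  have q: "0 \<le> ?q i" for i
    by (rule posdef_inner_nonneg[OF posdef_matrix_inv(1)[OF Q2]])
  \<comment> \<open>\<open>C_k_gauss_op\<close> asks for some kappa; the square root of the summed
    forms dominates each of them.\<close>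
  then have "?q i \<le> (sqrt (\<Sum>i\<in>UNIV. ?q i))\<^sup>2" for i
    using member_le_sum[of i UNIV ?q] by (simp add: sum_nonneg)
  then have "C_k (length is) (gauss_op Q2 U g \<phi>)"
    using q by (intro C_k_gauss_op[of "sqrt (\<Sum>i\<in>UNIV. ?q i)"]) (auto intro: sum_nonneg)
  then show ?thesis
    unfolding C_k_def by (intro borel_measurable_continuous_onI) blast
qed

text \<open>The pointwise bound by P(phi^2) is integrated against the Gaussian with data (m, Q1),
  where the convolution identity applies with no loss of constants.\<close>

lemma gauss_op_L2_bound:
  assumes \<kappa>: "0 \<le> \<kappa>" "\<And>i. (U *v axis i 1) \<bullet> (matrix_inv Q2 *v (U *v axis i 1)) \<le> \<kappa>\<^sup>2"
  shows "(\<integral>\<^sup>+x. ennreal ((partial_derivs is (gauss_op Q2 U g \<phi>) x)\<^sup>2) * ennreal (gauss_density Q1 (x - m)) \<partial>lborel)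
    \<le> ennreal ((smoothing_const TYPE('n) (length is) * \<kappa> ^ length is)\<^sup>2) *
      (\<integral>\<^sup>+z. ennreal ((\<phi> z)\<^sup>2) *
        ennreal (gauss_density (Q2 + U ** Q1 ** transpose U) (z - (U *v m + g))) \<partial>lborel)"
proof -
  let ?C = "ennreal ((smoothing_const TYPE('n) (length is) * \<kappa> ^ length is)\<^sup>2)"
  let ?I = "\<lambda>x. \<integral>\<^sup>+z. ennreal ((\<phi> z)\<^sup>2) * ennreal (gauss_density Q2 (z - U *v x - g)) \<partial>lborel"
  have "(\<integral>\<^sup>+x. ennreal ((partial_derivs is (gauss_op Q2 U g \<phi>) x)\<^sup>2) * ennreal (gauss_density Q1 (x - m)) \<partial>lborel)
     \<le> (\<integral>\<^sup>+x. ?C * (ennreal (gauss_density Q1 (x - m)) * ?I x) \<partial>lborel)"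
  proof (rule nn_integral_mono)
    fix x
    show "ennreal ((partial_derivs is (gauss_op Q2 U g \<phi>) x)\<^sup>2) * ennreal (gauss_density Q1 (x - m))
        \<le> ?C * (ennreal (gauss_density Q1 (x - m)) * ?I x)"
      using mult_right_mono[OF gauss_op_deriv_bound[OF \<kappa>, of "is" x], of "ennreal (gauss_density Q1 (x - m))"]
      by (simp add: mult_ac)
  qed
  also have "\<dots> = ?C * (\<integral>\<^sup>+x. ennreal (gauss_density Q1 (x - m)) * ?I x \<partial>lborel)"
    by (rule nn_integral_cmult) measurable
  also have "(\<integral>\<^sup>+x. ennreal (gauss_density Q1 (x - m)) * ?I x \<partial>lborel)
     = (\<integral>\<^sup>+z. ennreal ((\<phi> z)\<^sup>2) *
        ennreal (gauss_density (Q2 + U ** Q1 ** transpose U) (z - (U *v m + g))) \<partial>lborel)"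
    by (rule nn_integral_gauss_convolution[OF Q1 Q2]) measurable
  finally show ?thesis .
qed

end

section \<open>The operators on L2\<close>

lemma L2_space_iff:
  "\<phi> \<in> L2_space M \<longleftrightarrow> \<phi> \<in> borel_measurable M \<and> (\<integral>\<^sup>+x. ennreal ((\<phi> x)\<^sup>2) \<partial>M) < \<infinity>"
  by (auto simp: L2_space_def integrable_iff_bounded)

lemma L2_norm_nonneg: "0 \<le> L2_norm M \<phi>"
  by (simp add: L2_norm_def)

lemma L2_norm_power2: "(L2_norm M \<phi>)\<^sup>2 = (\<integral>x. (\<phi> x)\<^sup>2 \<partial>M)"
  by (simp add: L2_norm_def)

lemma L2_norm_square:
  "\<phi> \<in> L2_space M \<Longrightarrow> ennreal ((L2_norm M \<phi>)\<^sup>2) = (\<integral>\<^sup>+x. ennreal ((\<phi> x)\<^sup>2) \<partial>M)"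
  by (simp add: L2_space_def L2_norm_def nn_integral_eq_integral)

lemma L2_bounded:
  assumes "\<phi> \<in> L2_space M" and "v \<in> borel_measurable N" and "0 \<le> K"
    and le: "(\<integral>\<^sup>+x. ennreal ((v x)\<^sup>2) \<partial>N) \<le> ennreal (K\<^sup>2) * (\<integral>\<^sup>+x. ennreal ((\<phi> x)\<^sup>2) \<partial>M)"
  shows "v \<in> L2_space N" and "L2_norm N v \<le> K * L2_norm M \<phi>"
proof -
  have eq: "ennreal (K\<^sup>2) * (\<integral>\<^sup>+x. ennreal ((\<phi> x)\<^sup>2) \<partial>M) = ennreal ((K * L2_norm M \<phi>)\<^sup>2)"
    by (simp add: power_mult_distrib ennreal_mult' flip: L2_norm_square[OF assms(1)])
  then show v: "v \<in> L2_space N"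
    using assms(2) le by (auto simp: L2_space_iff intro: le_less_trans)
  have "ennreal ((L2_norm N v)\<^sup>2) \<le> ennreal ((K * L2_norm M \<phi>)\<^sup>2)"
    using le eq by (simp add: L2_norm_square[OF v])
  then have "(L2_norm N v)\<^sup>2 \<le> (K * L2_norm M \<phi>)\<^sup>2"
    by (simp add: ennreal_le_iff)
  then show "L2_norm N v \<le> K * L2_norm M \<phi>"
    by (rule power2_le_imp_le) (simp add: \<open>0 \<le> K\<close> L2_norm_nonneg)
qed

text \<open>A triangle inequality for squares with factor 2; it takes the place of Minkowski's
  inequality and suffices for uniqueness of limits and for density.\<close>

lemma square_diff_le: "(a - b)\<^sup>2 \<le> 2 * (a - c)\<^sup>2 + 2 * (c - b)\<^sup>2" for a b c :: real
proof -
  have "0 \<le> ((a - c) - (c - b))\<^sup>2"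
    by simp
  then show ?thesis
    by (simp add: power2_eq_square algebra_simps)
qed

lemma L2_space_diff:
  assumes "\<phi> \<in> L2_space M" "\<psi> \<in> L2_space M"
  shows "(\<lambda>x. \<phi> x - \<psi> x) \<in> L2_space M"
proof -
  have [measurable]: "\<phi> \<in> borel_measurable M" "\<psi> \<in> borel_measurable M"
    using assms by (auto simp: L2_space_def)
  have "integrable M (\<lambda>x. 2 * (\<phi> x)\<^sup>2 + 2 * (\<psi> x)\<^sup>2)"
    using assms by (auto simp: L2_space_def)
  then have "integrable M (\<lambda>x. (\<phi> x - \<psi> x)\<^sup>2)"
  proof (rule Bochner_Integration.integrable_bound)
    show "AE x in M. norm ((\<phi> x - \<psi> x)\<^sup>2) \<le> norm (2 * (\<phi> x)\<^sup>2 + 2 * (\<psi> x)\<^sup>2)"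
      using square_diff_le[of "\<phi> x" "\<psi> x" 0 for x] by auto
  qed measurable
  then show ?thesis
    by (simp add: L2_space_def)
qed

lemma L2_norm_diff_le:
  assumes "\<phi> \<in> L2_space M" "\<psi> \<in> L2_space M" "\<eta> \<in> L2_space M"
  shows "(L2_norm M (\<lambda>x. \<phi> x - \<psi> x))\<^sup>2
    \<le> 2 * (L2_norm M (\<lambda>x. \<phi> x - \<eta> x))\<^sup>2 + 2 * (L2_norm M (\<lambda>x. \<eta> x - \<psi> x))\<^sup>2"
proof -
  note d = L2_space_diff[OF assms(1,2)] L2_space_diff[OF assms(1,3)] L2_space_diff[OF assms(3,2)]
  then have "(\<integral>x. (\<phi> x - \<psi> x)\<^sup>2 \<partial>M) \<le> (\<integral>x. 2 * (\<phi> x - \<eta> x)\<^sup>2 + 2 * (\<eta> x - \<psi> x)\<^sup>2 \<partial>M)"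
    by (intro integral_mono square_diff_le) (auto simp: L2_space_def)
  also have "\<dots> = 2 * (\<integral>x. (\<phi> x - \<eta> x)\<^sup>2 \<partial>M) + 2 * (\<integral>x. (\<eta> x - \<psi> x)\<^sup>2 \<partial>M)"
    using d by (simp add: L2_space_def)
  finally show ?thesis
    by (simp add: L2_norm_def)
qed

lemma L2_limit_unique:
  assumes "\<phi> \<in> L2_space M" "\<psi> \<in> L2_space M" "\<And>k. \<eta> k \<in> L2_space M"
    and "(\<lambda>k. L2_norm M (\<lambda>x. \<eta> k x - \<phi> x)) \<longlonglongrightarrow> 0" "(\<lambda>k. L2_norm M (\<lambda>x. \<eta> k x - \<psi> x)) \<longlonglongrightarrow> 0"
  shows "AE x in M. \<phi> x = \<psi> x"
proof -
  have comm: "L2_norm M (\<lambda>x. \<phi> x - \<eta> k x) = L2_norm M (\<lambda>x. \<eta> k x - \<phi> x)" for k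
    by (simp add: L2_norm_def power2_commute)
  have "(\<lambda>k. 2 * (L2_norm M (\<lambda>x. \<eta> k x - \<phi> x))\<^sup>2 + 2 * (L2_norm M (\<lambda>x. \<eta> k x - \<psi> x))\<^sup>2) \<longlonglongrightarrow> 2 * 0\<^sup>2 + 2 * 0\<^sup>2"
    by (intro tendsto_intros assms)
  moreover have "(L2_norm M (\<lambda>x. \<phi> x - \<psi> x))\<^sup>2
      \<le> 2 * (L2_norm M (\<lambda>x. \<eta> k x - \<phi> x))\<^sup>2 + 2 * (L2_norm M (\<lambda>x. \<eta> k x - \<psi> x))\<^sup>2" for k
    using L2_norm_diff_le[OF assms(1,2) assms(3)[of k]] by (simp only: comm)
  ultimately have "(L2_norm M (\<lambda>x. \<phi> x - \<psi> x))\<^sup>2 \<le> 2 * 0\<^sup>2 + 2 * 0\<^sup>2"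
    by (intro LIMSEQ_le_const) auto
  then have "(\<integral>x. (\<phi> x - \<psi> x)\<^sup>2 \<partial>M) = 0"
    unfolding L2_norm_power2 by (intro antisym) auto
  then have "AE x in M. (\<phi> x - \<psi> x)\<^sup>2 = 0"
    using L2_space_diff[OF assms(1,2)] by (subst (asm) integral_nonneg_eq_0_iff_AE) (auto simp: L2_space_def)
  then show ?thesis
    by simp
qed

lemma bcontfun_L2_space:
  fixes \<Phi> :: "'a::euclidean_space \<Rightarrow> real"
  assumes "\<Phi> \<in> bcontfun" "finite_measure M" "sets M = sets borel"
  shows "\<Phi> \<in> L2_space M"
proof -
  interpret finite_measure M by fact
  obtain b where b: "\<And>x. \<bar>\<Phi> x\<bar> \<le> b"
    using assms(1) by (auto simp: bcontfun_def bounded_iff)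
  have meas: "\<Phi> \<in> borel_measurable borel"
    using assms(1) by (simp add: bcontfun_def borel_measurable_continuous_onI)
  then have [measurable]: "\<Phi> \<in> borel_measurable M"
    by (simp cong: measurable_cong_sets add: assms(3))
  have "(\<Phi> x)\<^sup>2 \<le> b\<^sup>2" for x
    using b[of x] by (simp add: abs_le_square_iff[symmetric])
  then have "integrable M (\<lambda>x. (\<Phi> x)\<^sup>2)"
    by (intro integrable_const_bound[of _ "b\<^sup>2"]) auto
  then show ?thesis
    by (simp add: L2_space_def)
qed

section \<open>Density of bounded continuous functions in L2\<close>

definition trunc :: "nat \<Rightarrow> real \<Rightarrow> real" where
  "trunc n x = max (- real n) (min (real n) x)"

lemma trunc_bounds: "\<bar>trunc n x\<bar> \<le> real n" "\<bar>trunc n x - x\<bar> \<le> \<bar>x\<bar>"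
  by (auto simp: trunc_def)

lemma continuous_trunc: "continuous_on UNIV (trunc n)"
  unfolding trunc_def by (intro continuous_intros)

lemma trunc_tendsto: "(\<lambda>n. trunc n x) \<longlonglongrightarrow> x"
proof (rule tendsto_eventually)
  obtain N where N: "\<bar>x\<bar> \<le> real N"
    using real_arch_simple by blast
  show "\<forall>\<^sub>F n in sequentially. trunc n x = x"
    using eventually_ge_at_top[of N] by eventually_elim (use N in \<open>auto simp: trunc_def\<close>)
qed

text \<open>First phi is truncated, dominated by phi^2; then continuous functions converging a.e. to
  phi are truncated at the same level, dominated by a constant on a finite measure.
  \<open>ac\<close> turns Lebesgue-null exceptional sets into M-null ones.\<close>

lemma bcontfun_dense_L2:
  fixes M :: "'a::euclidean_space measure"
  assumes fin: "finite_measure M" and sets: "sets M = sets borel"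
    and ac: "\<And>P. (AE x in lborel. P x) \<Longrightarrow> AE x in M. P x"
    and \<phi>: "\<phi> \<in> L2_space M" and e: "0 < e"
  shows "\<exists>\<Phi>\<in>bcontfun. L2_norm M (\<lambda>x. \<Phi> x - \<phi> x) < e"
proof -
  interpret finite_measure M by fact
  have msets: "borel_measurable M = borel_measurable borel"
    by (rule measurable_cong_sets[OF sets refl])
  have [measurable]: "\<phi> \<in> borel_measurable M" and \<phi>2: "integrable M (\<lambda>x. (\<phi> x)\<^sup>2)"
    using \<phi> by (auto simp: L2_space_def)
  have tr: "trunc n \<in> borel_measurable borel" for n
    by (intro borel_measurable_continuous_onI continuous_trunc)
  note [measurable] = tr
  have "(\<lambda>n. \<integral>x. (trunc n (\<phi> x) - \<phi> x)\<^sup>2 \<partial>M) \<longlonglongrightarrow> (\<integral>x. 0 \<partial>M)"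
  proof (rule integral_dominated_convergence[OF _ _ \<phi>2])
    have "(\<lambda>n. (trunc n (\<phi> x) - \<phi> x)\<^sup>2) \<longlonglongrightarrow> (\<phi> x - \<phi> x)\<^sup>2" for x
      by (intro tendsto_intros trunc_tendsto)
    then show "AE x in M. (\<lambda>n. (trunc n (\<phi> x) - \<phi> x)\<^sup>2) \<longlonglongrightarrow> 0"
      by simp
    show "AE x in M. norm ((trunc n (\<phi> x) - \<phi> x)\<^sup>2) \<le> (\<phi> x)\<^sup>2" for n
      using trunc_bounds(2) by (simp add: abs_le_square_iff)
  qed measurable
  then have "\<forall>\<^sub>F n in sequentially. (\<integral>x. (trunc n (\<phi> x) - \<phi> x)\<^sup>2 \<partial>M) < e\<^sup>2 / 4"
    using e by (intro order_tendstoD(2)) auto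
  then obtain n where n: "(\<integral>x. (trunc n (\<phi> x) - \<phi> x)\<^sup>2 \<partial>M) < e\<^sup>2 / 4"
    by (auto simp: eventually_sequentially)
  have "\<phi> \<in> borel_measurable lebesgue"
    using \<open>\<phi> \<in> borel_measurable M\<close> unfolding msets by (simp add: measurable_completion)
  \<comment> \<open>By definition of \<open>measurable_on\<close>, phi is the limit of continuous
    functions off a negligible set.\<close>
  then have "\<phi> measurable_on UNIV"
    by (intro lebesgue_measurable_imp_measurable_on) auto
  then obtain N G where N: "negligible N" and G: "\<And>j. continuous_on UNIV (G j)"
    and lim: "\<And>x. x \<notin> N \<Longrightarrow> (\<lambda>j. G j x) \<longlonglongrightarrow> \<phi> x"
    unfolding measurable_on_def by auto
  have "AE x in lebesgue. x \<notin> N"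
    using N by (intro AE_not_in) (simp add: negligible_iff_null_sets)
  then have AEN: "AE x in M. x \<notin> N"
    by (intro ac) (simp add: AE_completion_iff)
  have [measurable]: "G j \<in> borel_measurable M" for j
    unfolding msets by (intro borel_measurable_continuous_onI G)
  have "(\<lambda>j. \<integral>x. (trunc n (G j x) - trunc n (\<phi> x))\<^sup>2 \<partial>M) \<longlonglongrightarrow> (\<integral>x. 0 \<partial>M)"
  proof (rule integral_dominated_convergence[where w = "\<lambda>_. (2 * real n)\<^sup>2"])
    have "(\<lambda>j. (trunc n (G j x) - trunc n (\<phi> x))\<^sup>2) \<longlonglongrightarrow> (trunc n (\<phi> x) - trunc n (\<phi> x))\<^sup>2" if "x \<notin> N" for x
      using continuous_on_tendsto_compose[OF continuous_trunc lim[OF that]] by (intro tendsto_intros) auto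
    then show "AE x in M. (\<lambda>j. (trunc n (G j x) - trunc n (\<phi> x))\<^sup>2) \<longlonglongrightarrow> 0"
      using AEN by auto
    have "\<bar>trunc n a - trunc n b\<bar> \<le> \<bar>2 * real n\<bar>" for a b
      using trunc_bounds(1)[of n a] trunc_bounds(1)[of n b] by linarith
    then show "AE x in M. norm ((trunc n (G j x) - trunc n (\<phi> x))\<^sup>2) \<le> (2 * real n)\<^sup>2" for j
      unfolding abs_le_square_iff by auto
  qed auto
  then have "\<forall>\<^sub>F j in sequentially. (\<integral>x. (trunc n (G j x) - trunc n (\<phi> x))\<^sup>2 \<partial>M) < e\<^sup>2 / 4"
    using e by (intro order_tendstoD(2)) auto
  then obtain j where j: "(\<integral>x. (trunc n (G j x) - trunc n (\<phi> x))\<^sup>2 \<partial>M) < e\<^sup>2 / 4"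
    by (auto simp: eventually_sequentially)
  let ?\<Phi> = "\<lambda>x. trunc n (G j x)"
  have \<Phi>: "?\<Phi> \<in> bcontfun"
    unfolding bcontfun_def bounded_iff
    using continuous_on_compose2[OF continuous_trunc G[of j], of n] trunc_bounds(1)[of n] by auto
  have tL2: "(\<lambda>x. trunc n (\<phi> x)) \<in> L2_space M"
  proof -
    have "(trunc n a)\<^sup>2 \<le> (real n)\<^sup>2" for a
      using trunc_bounds(1)[of n a] unfolding abs_le_square_iff[symmetric] by simp
    then have "integrable M (\<lambda>x. (trunc n (\<phi> x))\<^sup>2)"
      by (intro integrable_const_bound[of _ "(real n)\<^sup>2"]) auto
    then show ?thesis
      by (simp add: L2_space_def)
  qed
  \<comment> \<open>The tolerances e^2/4 meet the factors 2 of \<open>L2_norm_diff_le\<close>: 2 *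
    e^2/4 + 2 * e^2/4 = e^2.\<close>
  have "(L2_norm M (\<lambda>x. ?\<Phi> x - \<phi> x))\<^sup>2 < e\<^sup>2"
    using L2_norm_diff_le[OF bcontfun_L2_space[OF \<Phi> fin sets] \<phi> tL2] n j
    unfolding L2_norm_power2 by linarith
  then have "L2_norm M (\<lambda>x. ?\<Phi> x - \<phi> x) < e"
    by (rule power_less_imp_less_base) (use e in simp)
  with \<Phi> show ?thesis
    by (intro bexI[of _ ?\<Phi>])
qed

section \<open>Identification of the L2 extension with the kernel operator\<close>

lemma continuous_AE_eq_imp_eq:
  fixes u v :: "'a::euclidean_space \<Rightarrow> 'b::t2_space"
  assumes "continuous_on UNIV u" "continuous_on UNIV v" "AE x in lborel. u x = v x"
  shows "u = v"
proof
  fix x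
  have "closed {x. u x = v x}"
    using assms(1,2) by (rule closed_Collect_eq)
  moreover have "AE x in lebesgue. x \<in> {x. u x = v x}"
    using AE_completion[OF assms(3)] by simp
  ultimately have "x \<in> {x. u x = v x}"
    by (rule mem_closed_if_AE_lebesgue)
  then show "u x = v x"
    by simp
qed

text \<open>The density is strictly positive, so the Gaussian and Lebesgue measure have the same
  null sets. Hence continuous functions that agree nu_s-a.e. are equal.\<close>

lemma AE_gaussian_iff:
  fixes Q :: "real^'n::finite^'n"
  assumes "posdef Q"
  shows "(AE x in gaussian m Q. P x) \<longleftrightarrow> (AE x in lborel. P x)"
  unfolding gaussian_posdef[OF assms] using gauss_density_pos[OF assms]
  by (subst AE_density) (auto simp: ennreal_0)

lemma sets_gaussian [simp]: "sets (gaussian m Q) = sets borel"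
  by (simp add: gaussian_def)

lemma nn_integral_gaussian_measure:
  fixes Q :: "real^'n::finite^'n"
  assumes "posdef Q" "f \<in> borel_measurable borel"
  shows "(\<integral>\<^sup>+x. f x \<partial>gaussian m Q) = (\<integral>\<^sup>+x. f x * ennreal (gauss_density Q (x - m)) \<partial>lborel)"
  unfolding gaussian_posdef[OF assms(1)] using assms(2)
  by (subst nn_integral_density) (auto simp: mult.commute)

lemma finite_measure_gaussian:
  fixes Q :: "real^'n::finite^'n"
  assumes "posdef Q"
  shows "finite_measure (gaussian m Q)"
proof (rule finite_measureI)
  have "emeasure (gaussian m Q) (space (gaussian m Q)) = (\<integral>\<^sup>+x. 1 \<partial>gaussian m Q)"
    by simp
  also have "\<dots> = (\<integral>\<^sup>+x. ennreal (gauss_density Q (x - m)) \<partial>lborel)"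
    by (subst nn_integral_gaussian_measure[OF assms]) auto
  also have "\<dots> = 1"
    using nn_integral_lborel_translate[of "\<lambda>x. ennreal (gauss_density Q x)" m] nn_integral_gauss_density[OF assms]
    by simp
  finally show "emeasure (gaussian m Q) (space (gaussian m Q)) \<noteq> \<infinity>"
    by simp
qed

text \<open>Translation invariance of Lebesgue measure moves the shift by g(t,s) from the argument
  of the test function into the density.\<close>

lemma evol_Cb_eq_gauss_op:
  fixes \<Phi> :: "real^'n::finite \<Rightarrow> real"
  assumes Q: "posdef (Q_int U B t {s..t})" and [measurable]: "\<Phi> \<in> borel_measurable borel"
  shows "evol_Cb U B f s t \<Phi> = gauss_op (Q_int U B t {s..t}) (U t s) (g_int U f t {s..t}) \<Phi>"
proof
  fix x
  let ?Q = "Q_int U B t {s..t}" and ?g = "g_int U f t {s..t}"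
  have "evol_Cb U B f s t \<Phi> x = (\<integral>y. gauss_density ?Q (y - U t s *v x) * \<Phi> (?g + y) \<partial>lborel)"
    unfolding evol_Cb_def gaussian_posdef[OF Q] using gauss_density_pos[OF Q]
    by (subst integral_density) (auto simp: less_imp_le add.commute)
  also have "\<dots> = (\<integral>z. gauss_density ?Q (z - U t s *v x - ?g) * \<Phi> z \<partial>distr lborel borel ((+) ?g))"
    by (subst integral_distr) (auto simp: algebra_simps)
  also have "\<dots> = gauss_op ?Q (U t s) ?g \<Phi> x"
    by (simp add: lborel_distr_plus gauss_op_def mult.commute)
  finally show "evol_Cb U B f s t \<Phi> x = gauss_op ?Q (U t s) ?g \<Phi> x" .
qed

lemma gauss_op_diff:
  assumes "integrable lborel (\<lambda>z. \<phi> z * gauss_density Q (z - U *v x - g))"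
    and "integrable lborel (\<lambda>z. \<psi> z * gauss_density Q (z - U *v x - g))"
  shows "gauss_op Q U g (\<lambda>z. \<phi> z - \<psi> z) x = gauss_op Q U g \<phi> x - gauss_op Q U g \<psi> x"
  using assms by (simp add: gauss_op_def left_diff_distrib)

text \<open>The choice in \<open>mindex_deriv\<close> is realised: a multiset with multiplicities
  alpha can be listed. This makes the order of differentiation, hence the power of kappa, equal to
  |alpha|.\<close>

lemma length_mindex_list:
  fixes \<alpha> :: "'n::finite \<Rightarrow> nat"
  shows "length (SOME is. \<forall>i. count_list is i = \<alpha> i) = mindex_order \<alpha>"
proof -
  obtain xs where "mset xs = (\<Sum>i\<in>UNIV. replicate_mset (\<alpha> i) i)"
    using ex_mset by blast
  then have "\<forall>i. count_list xs i = \<alpha> i"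
    by (auto simp: count_sum simp flip: count_mset)
  then have "\<forall>i. count_list (SOME is. \<forall>i. count_list is i = \<alpha> i) i = \<alpha> i"
    by (rule someI)
  then show ?thesis
    using sum_count_set[of "SOME is. \<forall>i. count_list is i = \<alpha> i" UNIV] by (simp add: mindex_order_def)
qed

text \<open>The passage from kernel estimates to the graph-defined operator. The hypotheses
  \<open>Q\<close> and \<open>g\<close> say that nu_t is the Gaussian obtained from nu_s by the
  affine map U(t,s) x + g(t,s) plus independent noise of covariance Q(t,s).\<close>

lemma L2_op_norm_deriv_evol_le:
  fixes U :: "real \<Rightarrow> real \<Rightarrow> real^'n::finite^'n"
  defines "K \<equiv> \<lambda>k \<kappa>. smoothing_const TYPE('n) k * \<kappa> ^ k"
  assumes Q1: "posdef (Q_int U B s {..s})" and Q2: "posdef (Q_int U B t {s..t})"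
    and Q: "Q_int U B t {..t} = Q_int U B t {s..t} + U t s ** Q_int U B s {..s} ** transpose (U t s)"
    and g: "g_int U f t {..t} = U t s *v g_int U f s {..s} + g_int U f t {s..t}"
    and \<kappa>: "0 \<le> \<kappa>" "\<And>i. (U t s *v axis i 1) \<bullet> (matrix_inv (Q_int U B t {s..t}) *v (U t s *v axis i 1)) \<le> \<kappa>\<^sup>2"
  shows "L2_op_norm (evol_measure U B f t) (evol_measure U B f s) (deriv_evol_L2 U B f \<alpha> s t)
    \<le> ennreal (K (mindex_order \<alpha>) \<kappa>)"
proof -
  let ?M = "evol_measure U B f t" and ?N = "evol_measure U B f s"
  let ?Q1 = "Q_int U B s {..s}" and ?Q2 = "Q_int U B t {s..t}" and ?V = "U t s"
    and ?m = "g_int U f s {..s}" and ?g = "g_int U f t {s..t}"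
  let ?P = "gauss_op ?Q2 ?V ?g"
  have Q3: "posdef (Q_int U B t {..t})"
    unfolding Q by (rule posdef_add_congruence[OF Q1 Q2])
  have sets: "sets ?M = sets borel" "sets ?N = sets borel"
    by (simp_all add: evol_measure_def)
  have meas: "borel_measurable ?M = borel_measurable borel" "borel_measurable ?N = borel_measurable borel"
    by (rule measurable_cong_sets[OF sets(1) refl] measurable_cong_sets[OF sets(2) refl])+
  have fin: "finite_measure ?M"
    unfolding evol_measure_def by (rule finite_measure_gaussian[OF Q3])
  have AE: "(AE x in ?M. R x) \<longleftrightarrow> (AE x in lborel. R x)" "(AE x in ?N. R x) \<longleftrightarrow> (AE x in lborel. R x)" for R
    unfolding evol_measure_def by (rule AE_gaussian_iff[OF Q3] AE_gaussian_iff[OF Q1])+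
  have K0: "0 \<le> K k \<kappa>" for k
    unfolding K_def using \<kappa>(1) smoothing_const_pos[where 'n = 'n, of k] by simp
  have L2: "\<phi> \<in> borel_measurable borel"
    "(\<integral>\<^sup>+z. ennreal ((\<phi> z)\<^sup>2) * ennreal (gauss_density (?Q2 + ?V ** ?Q1 ** transpose ?V) (z - (?V *v ?m + ?g))) \<partial>lborel)
      = (\<integral>\<^sup>+z. ennreal ((\<phi> z)\<^sup>2) \<partial>?M)"
    "(\<integral>\<^sup>+z. ennreal ((\<phi> z)\<^sup>2) * ennreal (gauss_density (?Q2 + ?V ** ?Q1 ** transpose ?V) (z - (?V *v ?m + ?g))) \<partial>lborel) < \<infinity>"
    if "\<phi> \<in> L2_space ?M" for \<phi>
  proof -
    show 1 [measurable]: "\<phi> \<in> borel_measurable borel"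
      using that by (simp add: L2_space_def meas)
    show 2: "(\<integral>\<^sup>+z. ennreal ((\<phi> z)\<^sup>2) * ennreal (gauss_density (?Q2 + ?V ** ?Q1 ** transpose ?V) (z - (?V *v ?m + ?g))) \<partial>lborel)
      = (\<integral>\<^sup>+z. ennreal ((\<phi> z)\<^sup>2) \<partial>?M)"
      unfolding evol_measure_def by (subst nn_integral_gaussian_measure[OF Q3]) (auto simp: Q g)
    show "(\<integral>\<^sup>+z. ennreal ((\<phi> z)\<^sup>2) * ennreal (gauss_density (?Q2 + ?V ** ?Q1 ** transpose ?V) (z - (?V *v ?m + ?g))) \<partial>lborel) < \<infinity>"
      unfolding 2 using that by (simp add: L2_space_iff)
  qed
  have bound: "partial_derivs is (?P \<phi>) \<in> L2_space ?N"
    "L2_norm ?N (partial_derivs is (?P \<phi>)) \<le> K (length is) \<kappa> * L2_norm ?M \<phi>"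
    if \<phi>: "\<phi> \<in> L2_space ?M" for \<phi> "is"
  proof -
    note h = Q1 Q2 L2(1)[OF \<phi>] L2(3)[OF \<phi>]
    have [measurable]: "partial_derivs is (?P \<phi>) \<in> borel_measurable borel"
      by (rule borel_measurable_partial_derivs_gauss_op[OF h])
    then have m: "partial_derivs is (?P \<phi>) \<in> borel_measurable ?N"
      by (simp add: meas)
    have le: "(\<integral>\<^sup>+x. ennreal ((partial_derivs is (?P \<phi>) x)\<^sup>2) \<partial>?N)
        \<le> ennreal ((K (length is) \<kappa>)\<^sup>2) * (\<integral>\<^sup>+z. ennreal ((\<phi> z)\<^sup>2) \<partial>?M)"
      using gauss_op_L2_bound[OF h \<kappa>, of "is"] unfolding L2(2)[OF \<phi>] K_def evol_measure_def
      by (subst nn_integral_gaussian_measure[OF Q1]) auto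
    show "partial_derivs is (?P \<phi>) \<in> L2_space ?N"
      "L2_norm ?N (partial_derivs is (?P \<phi>)) \<le> K (length is) \<kappa> * L2_norm ?M \<phi>"
      by (rule L2_bounded[OF \<phi> m K0 le])+
  qed
  have smooth: "C_k k (?P \<phi>)" if "\<phi> \<in> L2_space ?M" for \<phi> k
    by (rule C_k_gauss_op[OF Q1 Q2 L2(1)[OF that] L2(3)[OF that] \<kappa>])
  \<comment> \<open>The order-zero estimate applied to a difference: P is Lipschitz from L2(nu_t) to
    L2(nu_s), so limits along \<open>bcontfun\<close> pass through it.\<close>
  have diff: "L2_norm ?N (\<lambda>x. ?P \<phi> x - ?P \<psi> x) \<le> K 0 \<kappa> * L2_norm ?M (\<lambda>x. \<phi> x - \<psi> x)"
    if \<phi>: "\<phi> \<in> L2_space ?M" and \<psi>: "\<psi> \<in> L2_space ?M" for \<phi> \<psi>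
  proof -
    have "?P (\<lambda>x. \<phi> x - \<psi> x) = (\<lambda>x. ?P \<phi> x - ?P \<psi> x)"
      by (intro ext gauss_op_diff gauss_op_integrable[OF Q1 Q2 L2(1)[OF \<phi>] L2(3)[OF \<phi>] \<kappa>]
          gauss_op_integrable[OF Q1 Q2 L2(1)[OF \<psi>] L2(3)[OF \<psi>] \<kappa>])
    then show ?thesis
      using bound(2)[OF L2_space_diff[OF \<phi> \<psi>], of "[]"] by simp
  qed
  have Cb: "\<Phi> \<in> L2_space ?M" "evol_Cb U B f s t \<Phi> = ?P \<Phi>" if "\<Phi> \<in> bcontfun" for \<Phi>
  proof -
    show "\<Phi> \<in> L2_space ?M"
      by (rule bcontfun_L2_space[OF that fin sets(1)])
    then show "evol_Cb U B f s t \<Phi> = ?P \<Phi>"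
      by (intro evol_Cb_eq_gauss_op Q2 L2)
  qed
  have conv: "(\<lambda>k. L2_norm ?N (\<lambda>x. evol_Cb U B f s t (\<Phi> k) x - ?P \<phi> x)) \<longlonglongrightarrow> 0"
    if \<phi>: "\<phi> \<in> L2_space ?M" and \<Phi>: "\<And>k. \<Phi> k \<in> bcontfun"
      and lim: "(\<lambda>k. L2_norm ?M (\<lambda>x. \<Phi> k x - \<phi> x)) \<longlonglongrightarrow> 0" for \<phi> \<Phi>
  proof (rule tendsto_sandwich[OF _ _ tendsto_const])
    show "(\<lambda>k. K 0 \<kappa> * L2_norm ?M (\<lambda>x. \<Phi> k x - \<phi> x)) \<longlonglongrightarrow> 0"
      using tendsto_mult_left[OF lim, of "K 0 \<kappa>"] by simp
    show "\<forall>\<^sub>F k in sequentially. L2_norm ?N (\<lambda>x. evol_Cb U B f s t (\<Phi> k) x - ?P \<phi> x)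
        \<le> K 0 \<kappa> * L2_norm ?M (\<lambda>x. \<Phi> k x - \<phi> x)"
      using diff[OF Cb(1)[OF \<Phi>] \<phi>] by (simp add: Cb(2)[OF \<Phi>])
  qed (simp add: L2_norm_nonneg)
  have ex: "evol_L2 U B f s t \<phi> (?P \<phi>)" if \<phi>: "\<phi> \<in> L2_space ?M" for \<phi>
  proof -
    have "\<exists>\<Phi>\<in>bcontfun. L2_norm ?M (\<lambda>x. \<Phi> x - \<phi> x) < 1 / real (Suc k)" for k
      by (rule bcontfun_dense_L2[OF fin sets(1) _ \<phi>]) (auto simp: AE)
    then obtain \<Phi> where \<Phi>: "\<And>k. \<Phi> k \<in> bcontfun" "\<And>k. L2_norm ?M (\<lambda>x. \<Phi> k x - \<phi> x) < 1 / real (Suc k)"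
      by metis
    have lim: "(\<lambda>k. L2_norm ?M (\<lambda>x. \<Phi> k x - \<phi> x)) \<longlonglongrightarrow> 0"
    proof (rule tendsto_sandwich[OF _ _ tendsto_const])
      show "(\<lambda>k. 1 / real (Suc k)) \<longlonglongrightarrow> 0"
        using LIMSEQ_inverse_real_of_nat by (simp add: inverse_eq_divide)
      show "\<forall>\<^sub>F k in sequentially. L2_norm ?M (\<lambda>x. \<Phi> k x - \<phi> x) \<le> 1 / real (Suc k)"
        by (intro always_eventually allI less_imp_le \<Phi>(2))
    qed (simp add: L2_norm_nonneg)
    show ?thesis
      unfolding evol_L2_def using \<phi> bound(1)[OF \<phi>, of "[]"] bound(1)[OF Cb(1)[OF \<Phi>(1)], of "[]"]
        lim conv[OF \<phi> \<Phi>(1) lim] \<Phi>(1)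
      by (intro conjI exI[of _ \<Phi>] allI) (auto simp: Cb(2)[OF \<Phi>(1)])
  qed
  \<comment> \<open>The operator norm quantifies over every value in the graph, so any smooth
    representative must be shown to be the kernel integral: L2 limits agree a.e., and continuity
    removes the exceptional set.\<close>
  have uniq: "u = ?P \<phi>" if u: "evol_L2 U B f s t \<phi> u" and Ck: "C_k k u" for \<phi> u k
  proof -
    have \<phi>: "\<phi> \<in> L2_space ?M" and uL2: "u \<in> L2_space ?N"
      using u by (auto simp: evol_L2_def)
    obtain \<Phi> where \<Phi>: "\<And>k. \<Phi> k \<in> bcontfun" "\<And>k. evol_Cb U B f s t (\<Phi> k) \<in> L2_space ?N"
      and lim: "(\<lambda>k. L2_norm ?M (\<lambda>x. \<Phi> k x - \<phi> x)) \<longlonglongrightarrow> 0"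
        "(\<lambda>k. L2_norm ?N (\<lambda>x. evol_Cb U B f s t (\<Phi> k) x - u x)) \<longlonglongrightarrow> 0"
      using u unfolding evol_L2_def by blast
    have "AE x in ?N. u x = ?P \<phi> x"
      using bound(1)[OF \<phi>, of "[]"]
      by (intro L2_limit_unique[OF uL2 _ \<Phi>(2) lim(2) conv[OF \<phi> \<Phi>(1) lim(1)]]) simp
    moreover have "continuous_on UNIV v" if "C_k j v" for v :: "real^'n \<Rightarrow> real" and j
      using that unfolding C_k_def by (auto dest!: conjunct2 dest: spec[of _ "[]"])
    ultimately show ?thesis
      using Ck smooth[OF \<phi>, of 0] by (intro continuous_AE_eq_imp_eq) (auto simp: AE)
  qed
  let ?is = "SOME is. \<forall>i. count_list is i = \<alpha> i" and ?k = "mindex_order \<alpha>"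
  have "(\<exists>v. deriv_evol_L2 U B f \<alpha> s t \<phi> v) \<and>
     (\<forall>v. deriv_evol_L2 U B f \<alpha> s t \<phi> v \<longrightarrow> v \<in> L2_space ?N \<and> L2_norm ?N v \<le> K ?k \<kappa> * L2_norm ?M \<phi>)"
    if \<phi>: "\<phi> \<in> L2_space ?M" for \<phi>
  proof (intro conjI allI impI)
    show "\<exists>v. deriv_evol_L2 U B f \<alpha> s t \<phi> v"
      unfolding deriv_evol_L2_def using ex[OF \<phi>] smooth[OF \<phi>] by blast
    fix v assume "deriv_evol_L2 U B f \<alpha> s t \<phi> v"
    then have v: "v = partial_derivs ?is (?P \<phi>)"
      using uniq unfolding deriv_evol_L2_def mindex_deriv_def by metis
    show "v \<in> L2_space ?N" "L2_norm ?N v \<le> K ?k \<kappa> * L2_norm ?M \<phi>"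
      using bound[OF \<phi>, of ?is] unfolding v length_mindex_list by auto
  qed
  then show ?thesis
    unfolding L2_op_norm_def using K0 by (intro Inf_lower) blast
qed

section \<open>The evolution family\<close>

lemma bounded_bilinear_matrix_vector:
  "bounded_bilinear ((*v) :: real^'n::finite^'m::finite \<Rightarrow> _)"
  by (subst bilinear_conv_bounded_bilinear[symmetric])
    (auto simp: bilinear_def intro!: linearI simp: algebra_simps matrix_vector_mult_scaleR scaleR_matrix_vector_assoc)

lemma bounded_bilinear_matrix_matrix:
  "bounded_bilinear ((**) :: real^'n::finite^'m::finite \<Rightarrow> real^'k::finite^'n \<Rightarrow> _)"
  by (subst bilinear_conv_bounded_bilinear[symmetric])
    (auto simp: bilinear_def matrix_matrix_mult_def vec_eq_iff sum_distrib_left mult_ac distrib_left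
       sum.distrib intro!: linearI)

lemma bounded_linear_transpose: "bounded_linear (transpose :: real^'n::finite^'m::finite \<Rightarrow> _)"
  by (subst linear_conv_bounded_linear[symmetric]) (auto intro!: linearI simp: transpose_def vec_eq_iff)

lemma matrix_bounded_range:
  fixes A :: "real \<Rightarrow> real^'n::finite^'m::finite"
  assumes "bounded (range A)"
  obtains a where "0 < a" "\<And>t x. norm (A t *v x) \<le> a * norm x"
proof -
  obtain c where c: "0 < c" "\<And>t. norm (A t) \<le> c"
    using assms by (auto simp: bounded_pos)
  obtain K where K: "0 < K" "\<And>(M :: real^'n^'m) x. norm (M *v x) \<le> norm M * norm x * K"
    using bounded_bilinear.pos_bounded[OF bounded_bilinear_matrix_vector[where 'n = 'n and 'm = 'm]] by blast
  have "norm (A t *v x) \<le> c * K * norm x" for t x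
  proof -
    have "norm (A t) * norm x * K \<le> c * norm x * K"
      using c K(1) by (intro mult_right_mono) auto
    then show ?thesis
      using K(2)[of "A t" x] by (simp add: mult_ac)
  qed
  with c(1) K(1) show thesis
    by (intro that[of "c * K"]) auto
qed

lemma transpose_norm_le:
  fixes M :: "real^'n::finite^'m::finite"
  assumes "\<And>x. norm (M *v x) \<le> b * norm x"
  shows "norm (transpose M *v y) \<le> b * norm y"
proof (cases "transpose M *v y = 0")
  case True
  have "0 \<le> b * norm (axis undefined 1 :: real^'n)"
    using assms norm_ge_zero order_trans by blast
  then show ?thesis
    using True by (simp add: norm_axis_1)
next
  case False
  let ?v = "transpose M *v y"
  have "norm ?v * norm ?v = y \<bullet> (M *v ?v)"
    by (simp add: inner_matrix_vector_mult power2_norm_eq_inner flip: power2_eq_square)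
  also have "\<dots> \<le> norm y * norm (M *v ?v)"
    by (rule norm_cauchy_schwarz)
  also have "\<dots> \<le> norm y * (b * norm ?v)"
    by (intro mult_left_mono assms) simp
  finally have "norm ?v * norm ?v \<le> (b * norm y) * norm ?v"
    by (simp add: mult_ac)
  then show ?thesis
    using False by simp
qed

text \<open>The lower bound makes M injective, hence surjective in finite dimension. Writing y = M
  x, |y|^2 = x . (M^T y) <= |x| |M^T y| and c |x| <= |y|. It transfers the bound on B to B^*, which
  is what occurs in Q.\<close>

lemma transpose_norm_ge:
  fixes M :: "real^'n::finite^'n"
  assumes c: "0 < c" and M: "\<And>x. c * norm x \<le> norm (M *v x)"
  shows "c * norm y \<le> norm (transpose M *v y)"
proof -
  have "x = 0" if "M *v x = 0" for x
  proof -
    have "c * norm x \<le> 0"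
      using M[of x] that by simp
    then show "x = 0"
      using c by (simp add: mult_le_0_iff)
  qed
  then have "inj ((*v) M)"
    by (simp add: linear_injective_0)
  then have "surj ((*v) M)"
    by (simp add: linear_injective_imp_surjective)
  then obtain x where x: "y = M *v x"
    by (metis surjD)
  have "c * (norm y * norm y) = c * (x \<bullet> (transpose M *v y))"
    using inner_matrix_vector_mult[of y M x]
    by (simp add: x inner_commute power2_norm_eq_inner flip: power2_eq_square)
  also have "\<dots> \<le> c * (norm x * norm (transpose M *v y))"
    using c by (intro mult_left_mono norm_cauchy_schwarz) auto
  also have "\<dots> \<le> norm y * norm (transpose M *v y)"
    unfolding mult.assoc[symmetric] x by (intro mult_right_mono M) simp
  finally have "norm y * (c * norm y) \<le> norm y * norm (transpose M *v y)"
    by (simp add: mult_ac)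
  then show ?thesis
    by (cases "y = 0") auto
qed

text \<open>The norm of the matrix type is Euclidean in the entries; this converts operator bounds
  into it, for integrability of matrix-valued functions.\<close>

lemma matrix_norm_le:
  fixes M :: "real^'n::finite^'m::finite"
  assumes "\<And>x. norm (M *v x) \<le> b * norm x"
  shows "norm M \<le> real CARD('m) * (real CARD('n) * b)"
proof -
  have e: "\<bar>M $ i $ j\<bar> \<le> b" for i j
    using order_trans[OF component_le_norm_cart assms[of "axis j 1"], of i]
    by (simp add: matrix_vector_mult_basis column_def norm_axis_1)
  have "norm M = L2_set (\<lambda>i. norm (M $ i)) UNIV"
    by (rule norm_vec_def)
  also have "\<dots> \<le> (\<Sum>i\<in>UNIV. norm (M $ i))"
    by (rule L2_set_le_sum) simp
  also have "\<dots> \<le> (\<Sum>i\<in>(UNIV :: 'm set). real CARD('n) * b)"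
  proof (rule sum_mono)
    fix i
    have "norm (M $ i) \<le> (\<Sum>j\<in>UNIV. \<bar>M $ i $ j\<bar>)"
      by (rule norm_le_l1_cart)
    also have "\<dots> \<le> (\<Sum>j\<in>(UNIV :: 'n set). b)"
      by (intro sum_mono e)
    finally show "norm (M $ i) \<le> real CARD('n) * b"
      by simp
  qed
  finally show ?thesis
    by simp
qed

text \<open>Q >= l implies Q^(-1) <= 1/l: for v = Q w, l |w|^2 <= w . v gives l |w| <= |v|.\<close>

lemma posdef_inverse_form_le:
  fixes Q :: "real^'n::finite^'n"
  assumes Q: "posdef Q" and l: "0 < l" and ge: "\<And>x. l * (norm x)\<^sup>2 \<le> x \<bullet> (Q *v x)"
  shows "v \<bullet> (matrix_inv Q *v v) \<le> (norm v)\<^sup>2 / l"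
proof -
  define w where "w = matrix_inv Q *v v"
  have v: "v = Q *v w"
    by (simp add: w_def matrix_vector_mul_assoc posdef_matrix_inv(2)[OF Q])
  have "l * (norm w * norm w) \<le> w \<bullet> v"
    using ge[of w] by (simp add: v power2_eq_square)
  also have "\<dots> \<le> norm w * norm v"
    by (rule norm_cauchy_schwarz)
  finally have "norm w * (l * norm w) \<le> norm w * norm v"
    by (simp add: mult_ac)
  then have "l * norm w \<le> norm v"
    by (cases "w = 0") auto
  then have "norm v * (l * norm w) \<le> norm v * norm v"
    by (rule mult_left_mono) simp
  moreover have "v \<bullet> w \<le> norm v * norm w"
    by (rule norm_cauchy_schwarz)
  then have "l * (v \<bullet> w) \<le> l * (norm v * norm w)"
    using l by (intro mult_left_mono) auto
  ultimately have "l * (v \<bullet> w) \<le> (norm v)\<^sup>2"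
    by (simp add: power2_eq_square mult_ac)
  then show ?thesis
    using l by (simp add: w_def[symmetric] field_simps)
qed

section \<open>Gronwall's inequality and integrals with exponential decay\<close>

lemma ode_gronwall:
  fixes y :: "real \<Rightarrow> 'a::real_inner"
  assumes y: "\<And>t. (y has_vector_derivative y' t) (at t)" and a: "\<And>t. norm (y' t) \<le> a * norm (y t)"
  shows "norm (y t) \<le> exp (a * \<bar>t - s\<bar>) * norm (y s)"
proof -
  have ip: "\<bar>y t \<bullet> y' t\<bar> \<le> a * (y t \<bullet> y t)" for t
  proof -
    have "\<bar>y t \<bullet> y' t\<bar> \<le> norm (y t) * norm (y' t)"
      by (rule Cauchy_Schwarz_ineq2)
    also have "\<dots> \<le> norm (y t) * (a * norm (y t))"
      by (intro mult_left_mono a) simp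
    finally show ?thesis
      by (simp add: mult_ac power2_norm_eq_inner flip: power2_eq_square)
  qed
  have d: "((\<lambda>t. exp (c * t) * (y t \<bullet> y t)) has_real_derivative
      exp (c * t) * (c * (y t \<bullet> y t) + 2 * (y t \<bullet> y' t))) (at t)" for c t
  proof -
    have "((\<lambda>t. y t \<bullet> y t) has_real_derivative 2 * (y t \<bullet> y' t)) (at t)"
      using y[of t] unfolding has_vector_derivative_def has_field_derivative_def
      by (auto intro!: derivative_eq_intros simp: inner_commute)
    then show ?thesis
      by (auto intro!: derivative_eq_intros simp: algebra_simps)
  qed
  \<comment> \<open>The weight e^(ct) makes |y|^2 monotone: c = -2a forwards in time, c = 2a
    backwards. Both directions are needed, since inverting U(t,s) runs time backwards.\<close>
  have le: "exp (c * t) * (y t \<bullet> y t) \<le> exp (c * s) * (y s \<bullet> y s)"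
    if c: "s \<le> t \<and> c = - 2 * a \<or> t \<le> s \<and> c = 2 * a" for c
    using c
  proof
    assume st: "s \<le> t \<and> c = - 2 * a"
    show ?thesis
    proof (rule DERIV_nonpos_imp_nonincreasing[of s t])
      show "\<exists>z. ((\<lambda>t. exp (c * t) * (y t \<bullet> y t)) has_real_derivative z) (at x) \<and> z \<le> 0" for x
        by (rule exI, rule conjI[OF d[of c x]]) (use ip[of x] st in \<open>auto simp: mult_le_0_iff\<close>)
    qed (use st in auto)
  next
    assume st: "t \<le> s \<and> c = 2 * a"
    show ?thesis
    proof (rule DERIV_nonneg_imp_nondecreasing[of t s])
      show "\<exists>z. ((\<lambda>t. exp (c * t) * (y t \<bullet> y t)) has_real_derivative z) (at x) \<and> 0 \<le> z" for x
        by (rule exI, rule conjI[OF d[of c x]]) (use ip[of x] st in \<open>auto simp: zero_le_mult_iff\<close>)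
    qed (use st in auto)
  qed
  have "y t \<bullet> y t \<le> exp (2 * (a * \<bar>t - s\<bar>)) * (y s \<bullet> y s)"
  proof -
    define c where "c = (if s \<le> t then - 2 * a else 2 * a)"
    have e: "exp (- c * t) * exp (c * s) = exp (2 * (a * \<bar>t - s\<bar>))"
      by (auto simp: c_def algebra_simps simp flip: exp_add)
    have "y t \<bullet> y t = exp (- c * t) * (exp (c * t) * (y t \<bullet> y t))"
      by (simp flip: mult.assoc exp_add)
    also have "\<dots> \<le> exp (- c * t) * (exp (c * s) * (y s \<bullet> y s))"
      by (intro mult_left_mono le) (auto simp: c_def)
    finally show ?thesis
      by (simp only: mult.assoc[symmetric] e)
  qed
  then have "(norm (y t))\<^sup>2 \<le> (exp (a * \<bar>t - s\<bar>) * norm (y s))\<^sup>2"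
    by (simp add: power2_norm_eq_inner power_mult_distrib exp_double)
  then show ?thesis
    by (rule power2_le_imp_le) simp
qed

lemma integrable_on_exp_atMost:
  fixes c :: real
  assumes "0 < c"
  shows "(\<lambda>r. exp (- c * (t - r))) integrable_on {..t}"
proof -
  have "(\<lambda>x. exp (- c * x)) absolutely_integrable_on {0..}"
    by (intro nonnegative_absolutely_integrable_1 integrable_on_exp_minus_to_infinity assms) auto
  then have "integrable lborel (\<lambda>x. indicator {0..} x *\<^sub>R exp (- c * x))"
    unfolding set_integrable_def by (subst (asm) integrable_completion) auto
  then have "integrable lborel (\<lambda>r. indicator {0..} (t + - 1 * r) *\<^sub>R exp (- c * (t + - 1 * r)))"
    by (rule lborel_integrable_real_affine) simp
  also have "(\<lambda>r. indicator {0..} (t + - 1 * r) *\<^sub>R exp (- c * (t + - 1 * r)))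
     = (\<lambda>r. indicator {..t} r *\<^sub>R exp (- c * (t - r)))"
    by (auto simp: indicator_def fun_eq_iff)
  finally show ?thesis
    by (intro set_borel_integral_eq_integral(1)) (simp add: set_integrable_def)
qed

lemma integrable_on_exp_decay:
  fixes h :: "real \<Rightarrow> 'a::euclidean_space"
  assumes h: "continuous_on UNIV h" and c: "0 < c"
    and le: "\<And>r. r \<le> t \<Longrightarrow> norm (h r) \<le> C * exp (- c * (t - r))"
  shows "h integrable_on {..t}"
proof (rule measurable_bounded_by_integrable_imp_integrable)
  show "h \<in> borel_measurable (lebesgue_on {..t})"
    by (intro continuous_imp_measurable_on_sets_lebesgue continuous_on_subset[OF h]) auto
  show "(\<lambda>r. C * exp (- c * (t - r))) integrable_on {..t}"
    by (rule integrable_on_mult_right[OF integrable_on_exp_atMost[OF c]])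
qed (use le in auto)

section \<open>Evolution families: cocycle, continuity and growth\<close>

context
  fixes A :: "real \<Rightarrow> real^'n::finite^'n" and U :: "real \<Rightarrow> real \<Rightarrow> real^'n^'n" and a :: real
  assumes ev: "evolution_family A U" and a: "0 < a" "\<And>t x. norm (A t *v x) \<le> a * norm x"
begin

lemma evolution_has_vector_derivative:
  "((\<lambda>\<tau>. U \<tau> s *v x) has_vector_derivative A t *v (U t s *v x)) (at t)"
proof -
  have "((\<lambda>\<tau>. U \<tau> s) has_vector_derivative A t ** U t s) (at t)"
    using ev by (simp add: evolution_family_def)
  from bounded_linear.has_vector_derivative[OF bounded_bilinear.bounded_linear_left[OF bounded_bilinear_matrix_vector] this]
  show ?thesis
    by (simp add: matrix_vector_mul_assoc)
qed

lemma evolution_norm_le: "norm (U t s *v x) \<le> exp (a * \<bar>t - s\<bar>) * norm x"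
  using ode_gronwall[where y = "\<lambda>\<tau>. U \<tau> s *v x", OF evolution_has_vector_derivative a(2), of t s] ev
  by (simp add: evolution_family_def)

lemma evolution_cocycle: "U t s ** U s r = U t r"
proof -
  have "U t s *v (U s r *v x) - U t r *v x = 0" for x
  proof -
    \<comment> \<open>Uniqueness for the linear equation: the difference solves it and vanishes at
      time s, so Gronwall makes it zero, also for t < s.\<close>
    let ?y = "\<lambda>\<tau>. U \<tau> s *v (U s r *v x) - U \<tau> r *v x"
    have "(?y has_vector_derivative A \<tau> *v ?y \<tau>) (at \<tau>)" for \<tau>
      using has_vector_derivative_diff[OF evolution_has_vector_derivative evolution_has_vector_derivative]
      by (simp add: matrix_vector_mult_diff_distrib)
    from ode_gronwall[OF this a(2), of t s] show ?thesis
      using ev by (simp add: evolution_family_def)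
  qed
  then show ?thesis
    by (simp add: matrix_eq flip: matrix_vector_mul_assoc)
qed

text \<open>U(s,t) inverts U(t,s), so its upper bound is a lower bound for U(t,s).\<close>

lemma evolution_norm_ge: "exp (- a * \<bar>t - s\<bar>) * norm x \<le> norm (U t s *v x)"
proof -
  have "U s t *v (U t s *v x) = x"
    using ev by (simp add: matrix_vector_mul_assoc evolution_cocycle) (simp add: evolution_family_def)
  then have "norm x \<le> exp (a * \<bar>t - s\<bar>) * norm (U t s *v x)"
    using evolution_norm_le[of s t "U t s *v x"] by (simp add: abs_minus_commute)
  then have "exp (- a * \<bar>t - s\<bar>) * norm x \<le> exp (- a * \<bar>t - s\<bar>) * (exp (a * \<bar>t - s\<bar>) * norm (U t s *v x))"
    by (intro mult_left_mono) auto
  then show ?thesis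
    by (simp flip: mult.assoc exp_add)
qed

text \<open>The equation gives regularity in the first argument only. Continuity in the second
  follows from U(t,r) - U(t,s) = U(t,r) (1 - U(r,s)).\<close>

lemma continuous_evolution: "continuous_on UNIV (U t)"
proof -
  have "((\<lambda>r. U t r *v x) \<longlongrightarrow> U t s *v x) (at s)" for s x
  proof (rule Lim_null[THEN iffD2], rule Lim_null_comparison)
    have "isCont (\<lambda>r. U r s *v x) s"
      using evolution_has_vector_derivative has_vector_derivative_continuous by blast
    then have "((\<lambda>r. U r s *v x) \<longlongrightarrow> x) (at s)"
      using ev by (simp add: isCont_def evolution_family_def)
    then have "((\<lambda>r. exp (a * \<bar>t - r\<bar>) * norm (x - U r s *v x)) \<longlongrightarrow> exp (a * \<bar>t - s\<bar>) * norm (x - x)) (at s)"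
      by (intro tendsto_intros)
    then show "((\<lambda>r. exp (a * \<bar>t - r\<bar>) * norm (x - U r s *v x)) \<longlongrightarrow> 0) (at s)"
      by simp
    have "norm (U t r *v x - U t s *v x) \<le> exp (a * \<bar>t - r\<bar>) * norm (x - U r s *v x)" for r
      using evolution_norm_le[of t r "x - U r s *v x"]
      by (simp add: matrix_vector_mult_diff_distrib matrix_vector_mul_assoc evolution_cocycle)
    then show "\<forall>\<^sub>F r in at s. norm (U t r *v x - U t s *v x) \<le> exp (a * \<bar>t - r\<bar>) * norm (x - U r s *v x)"
      by simp
  qed
  from this[of "axis j 1" for j] have "((\<lambda>r. U t r $ i $ j) \<longlongrightarrow> U t s $ i $ j) (at s)" for s i j
    using tendsto_vec_nth[of "\<lambda>r. U t r *v axis j 1" "U t s *v axis j 1" "at s" i]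
    by (simp add: matrix_vector_mult_basis column_def)
  then show ?thesis
    unfolding continuous_on_def by (auto intro!: vec_tendstoI)
qed

lemma growth_bound_less_imp:
  assumes "growth_bound U < \<omega>"
  obtains M where "1 \<le> M" "\<And>s t x. s \<le> t \<Longrightarrow> norm (U t s *v x) \<le> M * exp (\<omega> * (t - s)) * norm x"
proof -
  let ?S = "{\<omega>. \<exists>M. \<forall>s t. s \<le> t \<longrightarrow> onorm ((*v) (U t s)) \<le> M * exp (\<omega> * (t - s))}"
  have "onorm ((*v) (U t s)) \<le> 1 * exp (a * (t - s))" if "s \<le> t" for s t
    using evolution_norm_le[of t s] that by (intro onorm_le) simp
  \<comment> \<open>The set of admissible rates must be nonempty before its infimum yields an
    element below omega; Gronwall supplies a.\<close>
  then have "a \<in> ?S"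
    by blast
  then obtain \<omega>' where "\<omega>' \<in> ?S" "\<omega>' < \<omega>"
    using assms cInf_lessD[of ?S \<omega>] unfolding growth_bound_def by blast
  then obtain M where M: "\<And>s t. s \<le> t \<Longrightarrow> onorm ((*v) (U t s)) \<le> M * exp (\<omega>' * (t - s))"
    by blast
  have "norm (U t s *v x) \<le> max 1 M * exp (\<omega> * (t - s)) * norm x" if "s \<le> t" for s t x
  proof -
    have "\<omega>' * (t - s) \<le> \<omega> * (t - s)"
      using \<open>\<omega>' < \<omega>\<close> that by (intro mult_right_mono) auto
    then have "M * exp (\<omega>' * (t - s)) \<le> max 1 M * exp (\<omega> * (t - s))"
      by (intro mult_mono) auto
    then have "onorm ((*v) (U t s)) \<le> max 1 M * exp (\<omega> * (t - s))"
      using M[OF that] by linarith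
    then have "onorm ((*v) (U t s)) * norm x \<le> max 1 M * exp (\<omega> * (t - s)) * norm x"
      by (rule mult_right_mono) simp
    then show ?thesis
      using onorm[OF matrix_vector_mul_bounded_linear, of "U t s" x] by linarith
  qed
  then show thesis
    by (intro that[of "max 1 M"]) auto
qed

section \<open>Covariance and mean integrals; the decay hypothesis makes those over a half-line
  converge\<close>

context
  fixes B :: "real \<Rightarrow> real^'n^'n" and b \<mu> M \<omega> :: real
  assumes contB: "continuous_on UNIV B" and b: "\<And>t x. norm (B t *v x) \<le> b * norm x"
    and \<mu>: "0 < \<mu>" "\<And>t x. \<mu> * norm x \<le> norm (B t *v x)"
    and M: "1 \<le> M" and \<omega>: "\<omega> < 0"
    and decay: "\<And>s t x. s \<le> t \<Longrightarrow> norm (U t s *v x) \<le> M * exp (\<omega> * (t - s)) * norm x"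
begin

abbreviation "cov \<equiv> \<lambda>t r. U t r ** B r ** transpose (B r) ** transpose (U t r)"

lemma continuous_cov: "continuous_on UNIV (cov t)"
  by (intro bounded_bilinear.continuous_on[OF bounded_bilinear_matrix_matrix]
      bounded_linear.continuous_on[OF bounded_linear_transpose] continuous_evolution contB)

lemma cov_form: "x \<bullet> (cov t r *v x) = (norm (transpose (B r) *v (transpose (U t r) *v x)))\<^sup>2"
  by (simp only: inner_matrix_vector_mult[of x "U t r"] inner_matrix_vector_mult[of _ "B r"]
      power2_norm_eq_inner matrix_vector_mul_assoc[symmetric])

lemma integrable_cov: "cov t integrable_on {..t}"
proof (rule integrable_on_exp_decay[OF continuous_cov])
  fix r assume r: "r \<le> t"
  let ?u = "M * exp (\<omega> * (t - r))"
  have b0: "0 \<le> b"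
    using order_trans[OF norm_ge_zero b[of 0 "axis undefined 1"]] by (simp add: norm_axis_1)
  have u: "0 \<le> ?u"
    using M by simp
  have "norm (cov t r *v x) \<le> ?u * (b * (b * (?u * norm x)))" for x
  proof -
    have "norm (cov t r *v x) = norm (U t r *v (B r *v (transpose (B r) *v (transpose (U t r) *v x))))"
      by (simp only: matrix_vector_mul_assoc matrix_mul_assoc)
    also have "\<dots> \<le> ?u * norm (B r *v (transpose (B r) *v (transpose (U t r) *v x)))"
      by (rule decay[OF r])
    also have "\<dots> \<le> ?u * (b * norm (transpose (B r) *v (transpose (U t r) *v x)))"
      by (intro mult_left_mono b u)
    also have "\<dots> \<le> ?u * (b * (b * norm (transpose (U t r) *v x)))"
      by (intro mult_left_mono transpose_norm_le b u b0)
    also have "\<dots> \<le> ?u * (b * (b * (?u * norm x)))"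
      by (intro mult_left_mono transpose_norm_le decay[OF r] u b0)
    finally show ?thesis .
  qed
  then have "norm (cov t r) \<le> real CARD('n) * (real CARD('n) * (?u * b * b * ?u))"
    by (intro matrix_norm_le) (simp add: mult_ac)
  also have "\<dots> = (real CARD('n))\<^sup>2 * b\<^sup>2 * M\<^sup>2 * exp (- (- 2 * \<omega>) * (t - r))"
    by (simp add: power2_eq_square mult_ac flip: exp_add)
  finally show "norm (cov t r) \<le> (real CARD('n))\<^sup>2 * b\<^sup>2 * M\<^sup>2 * exp (- (- 2 * \<omega>) * (t - r))" .
qed (use \<omega> in simp)

lemma integrable_cov_Icc: "cov t integrable_on {s..t}"
  by (intro integrable_continuous_interval continuous_on_subset[OF continuous_cov]) simp

text \<open>Within the last unit of time U(t,r) shrinks vectors by at most e^(-a), and so does its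
  transpose; B^* contributes mu.\<close>

lemma cov_lower:
  assumes "t - 1 \<le> r" "r \<le> t"
  shows "(\<mu> * exp (- a))\<^sup>2 * (norm x)\<^sup>2 \<le> x \<bullet> (cov t r *v x)"
proof -
  have e: "exp (- a) \<le> exp (- a * \<bar>t - r\<bar>)"
    using assms a(1) by (simp add: mult_left_le)
  have "exp (- a) * norm y \<le> norm (U t r *v y)" for y
    using mult_right_mono[OF e norm_ge_zero[of y]] evolution_norm_ge[of t r y] by linarith
  then have "exp (- a) * norm x \<le> norm (transpose (U t r) *v x)"
    by (rule transpose_norm_ge[rotated]) simp
  then have "\<mu> * (exp (- a) * norm x) \<le> \<mu> * norm (transpose (U t r) *v x)"
    using \<mu>(1) by (intro mult_left_mono) auto
  also have "\<dots> \<le> norm (transpose (B r) *v (transpose (U t r) *v x))"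
    by (rule transpose_norm_ge[OF \<mu>])
  finally have "(\<mu> * (exp (- a) * norm x))\<^sup>2 \<le> (norm (transpose (B r) *v (transpose (U t r) *v x)))\<^sup>2"
    using \<mu>(1) by (intro power_mono) auto
  then show ?thesis
    by (simp add: cov_form power_mult_distrib)
qed

text \<open>The integrand is nonnegative, so its integral over I dominates the part from the last h
  units of time, where the integrand is bounded below.\<close>

lemma Q_int_form_lower:
  assumes I: "cov t integrable_on I" "{t - h..t} \<subseteq> I" and h: "0 \<le> h" "h \<le> 1"
  shows "(\<mu> * exp (- a))\<^sup>2 * h * (norm x)\<^sup>2 \<le> x \<bullet> (Q_int U B t I *v x)"
proof -
  have lin: "bounded_linear (\<lambda>Q :: real^'n^'n. x \<bullet> (Q *v x))"
    by (rule bounded_linear_compose[OF bounded_linear_inner_right])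
      (rule bounded_bilinear.bounded_linear_left[OF bounded_bilinear_matrix_vector])
  have int: "(\<lambda>r. x \<bullet> (cov t r *v x)) integrable_on J" if "cov t integrable_on J" for J
    using integrable_linear[OF that lin] by (simp add: o_def)
  have cov: "cov t integrable_on {t - h..t}"
    by (rule integrable_cov_Icc)
  have "(\<mu> * exp (- a))\<^sup>2 * h * (norm x)\<^sup>2 = integral {t - h..t} (\<lambda>_. (\<mu> * exp (- a))\<^sup>2 * (norm x)\<^sup>2)"
    using h by simp
  also have "\<dots> \<le> integral {t - h..t} (\<lambda>r. x \<bullet> (cov t r *v x))"
    using h by (intro integral_le int cov cov_lower) auto
  also have "\<dots> \<le> integral I (\<lambda>r. x \<bullet> (cov t r *v x))"
    by (intro integral_subset_le I int cov) (simp add: cov_form)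
  also have "\<dots> = x \<bullet> (Q_int U B t I *v x)"
    using integral_linear[OF I(1) lin] by (simp add: o_def Q_int_def)
  finally show ?thesis .
qed

lemma posdef_Q_int:
  assumes I: "cov t integrable_on I" "{t - h..t} \<subseteq> I" and h: "0 < h" "h \<le> 1"
  shows "posdef (Q_int U B t I)"
  unfolding posdef_def
proof (intro conjI allI impI)
  have "transpose (Q_int U B t I) = integral I (transpose \<circ> cov t)"
    unfolding Q_int_def by (rule integral_linear[OF I(1) bounded_linear_transpose, symmetric])
  also have "transpose \<circ> cov t = cov t"
    by (simp add: fun_eq_iff matrix_transpose_mul matrix_mul_assoc)
  finally show "transpose (Q_int U B t I) = Q_int U B t I"
    by (simp add: Q_int_def)
  fix x :: "real^'n" assume "x \<noteq> 0"
  then have "0 < (\<mu> * exp (- a))\<^sup>2 * h * (norm x)\<^sup>2"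
    using h \<mu>(1) by simp
  then show "0 < x \<bullet> (Q_int U B t I *v x)"
    using Q_int_form_lower[OF I, of x] h by linarith
qed

text \<open>By the cocycle law, U(t,s) factors out of the part of the integral up to time s. With
  \<open>g_int_split\<close> this is the relation between nu_s and nu_t that invariance
  requires.\<close>

lemma Q_int_split:
  assumes "s \<le> t"
  shows "Q_int U B t {..t} = Q_int U B t {s..t} + U t s ** Q_int U B s {..s} ** transpose (U t s)"
proof -
  have lin: "bounded_linear (\<lambda>Q. U t s ** Q ** transpose (U t s))"
    by (rule bounded_linear_compose[of "\<lambda>X. X ** transpose (U t s)" "(**) (U t s)"])
      (intro bounded_bilinear.bounded_linear_left[OF bounded_bilinear_matrix_matrix]
        bounded_bilinear.bounded_linear_right[OF bounded_bilinear_matrix_matrix])+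
  have eq: "cov t = (\<lambda>Q. U t s ** Q ** transpose (U t s)) \<circ> cov s"
  proof
    fix r
    have "U t r = U t s ** U s r"
      by (simp only: evolution_cocycle)
    then show "cov t r = ((\<lambda>Q. U t s ** Q ** transpose (U t s)) \<circ> cov s) r"
      by (simp only: o_def matrix_transpose_mul matrix_mul_assoc)
  qed
  have int: "cov t integrable_on {..s}"
    by (subst eq) (rule integrable_linear[OF integrable_cov lin])
  have "integral {..s} (cov t) = U t s ** Q_int U B s {..s} ** transpose (U t s)"
    unfolding Q_int_def by (subst eq) (rule integral_linear[OF integrable_cov lin])
  moreover have "{..t} = {..s} \<union> {s..t}" "{..s} \<inter> {s..t} = {s}"
    using assms by auto
  then have "integral {..t} (cov t) = integral {..s} (cov t) + integral {s..t} (cov t)"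
    using int integrable_cov_Icc[of t s] by simp
  ultimately show ?thesis
    by (simp add: Q_int_def)
qed

lemma g_int_split:
  fixes f :: "real \<Rightarrow> real^'n"
  assumes f: "continuous_on UNIV f" "bounded (range f)" and "s \<le> t"
  shows "g_int U f t {..t} = U t s *v g_int U f s {..s} + g_int U f t {s..t}"
proof -
  let ?h = "\<lambda>t r. U t r *v f r"
  obtain c where c: "\<And>r. norm (f r) \<le> c"
    using f(2) by (auto simp: bounded_iff)
  have cont: "continuous_on UNIV (?h t)" for t
    by (intro bounded_bilinear.continuous_on[OF bounded_bilinear_matrix_vector] continuous_evolution f)
  have intt: "?h t integrable_on {..t}" for t
  proof (rule integrable_on_exp_decay[OF cont])
    fix r assume "r \<le> t"
    then have "norm (U t r *v f r) \<le> M * exp (\<omega> * (t - r)) * norm (f r)"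
      by (rule decay)
    also have "\<dots> \<le> M * exp (\<omega> * (t - r)) * c"
      using M by (intro mult_left_mono c) auto
    finally show "norm (U t r *v f r) \<le> M * c * exp (- (- \<omega>) * (t - r))"
      by (simp add: mult_ac)
  qed (use \<omega> in simp)
  have lin: "bounded_linear ((*v) (U t s))"
    by (rule matrix_vector_mul_bounded_linear)
  have eq: "?h t = (*v) (U t s) \<circ> ?h s"
    by (simp add: fun_eq_iff matrix_vector_mul_assoc evolution_cocycle)
  have int: "?h t integrable_on {..s}"
    by (subst eq) (rule integrable_linear[OF intt lin])
  have "integral {..s} (?h t) = U t s *v g_int U f s {..s}"
    unfolding g_int_def by (subst eq) (rule integral_linear[OF intt lin])
  moreover have "{..t} = {..s} \<union> {s..t}" "{..s} \<inter> {s..t} = {s}"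
    using assms by auto
  moreover have "?h t integrable_on {s..t}"
    by (intro integrable_continuous_interval continuous_on_subset[OF cont]) simp
  then have "integral {..t} (?h t) = integral {..s} (?h t) + integral {s..t} (?h t)"
    using int calculation(2,3) by simp
  ultimately show ?thesis
    by (simp add: g_int_def)
qed

text \<open>Here kappa is the ratio of d, which bounds U(t,s), to the square root of the lower bound
  of Q(t,s). The length h is free up to t - s and 1, so smoothing and decay can be measured on
  different time intervals.\<close>

lemma L2_op_norm_deriv_evol_le_power:
  fixes f :: "real \<Rightarrow> real^'n"
  assumes f: "continuous_on UNIV f" "bounded (range f)"
    and h: "0 < h" "h \<le> 1" "h \<le> t - s" and d: "0 \<le> d" "\<And>x. norm (U t s *v x) \<le> d * norm x"
  shows "L2_op_norm (evol_measure U B f t) (evol_measure U B f s) (deriv_evol_L2 U B f \<alpha> s t)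
    \<le> ennreal (smoothing_const TYPE('n) (mindex_order \<alpha>) * (d / (\<mu> * exp (- a) * sqrt h)) ^ mindex_order \<alpha>)"
proof (rule L2_op_norm_deriv_evol_le)
  have st: "s \<le> t"
    using h by simp
  have sub: "{t - h..t} \<subseteq> {s..t}"
    using h by auto
  show "posdef (Q_int U B s {..s})"
    by (rule posdef_Q_int[OF integrable_cov, where h = 1]) auto
  show Q2: "posdef (Q_int U B t {s..t})"
    by (rule posdef_Q_int[OF integrable_cov_Icc sub h(1,2)])
  show "Q_int U B t {..t} = Q_int U B t {s..t} + U t s ** Q_int U B s {..s} ** transpose (U t s)"
    by (rule Q_int_split[OF st])
  show "g_int U f t {..t} = U t s *v g_int U f s {..s} + g_int U f t {s..t}"
    by (rule g_int_split[OF f st])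
  let ?l = "(\<mu> * exp (- a))\<^sup>2 * h"
  have l: "0 < ?l"
    using \<mu>(1) h(1) by simp
  show "0 \<le> d / (\<mu> * exp (- a) * sqrt h)"
    using d(1) \<mu>(1) h(1) by simp
  fix i
  let ?v = "U t s *v axis i 1"
  have "?v \<bullet> (matrix_inv (Q_int U B t {s..t}) *v ?v) \<le> (norm ?v)\<^sup>2 / ?l"
    using Q_int_form_lower[OF integrable_cov_Icc sub] h by (intro posdef_inverse_form_le Q2 l) auto
  also have "\<dots> \<le> d\<^sup>2 / ?l"
    using d(2)[of "axis i 1"] l by (intro divide_right_mono power_mono) (auto simp: norm_axis_1)
  also have "\<dots> = (d / (\<mu> * exp (- a) * sqrt h))\<^sup>2"
    using h(1) by (simp add: power_divide power_mult_distrib)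
  finally show "?v \<bullet> (matrix_inv (Q_int U B t {s..t}) *v ?v) \<le> (d / (\<mu> * exp (- a) * sqrt h))\<^sup>2" .
qed

end

end

theorem mainTheorem4:
  fixes A B :: "real \<Rightarrow> real^'n^'n::finite"
    and f :: "real \<Rightarrow> real^'n"
    and U :: "real \<Rightarrow> real \<Rightarrow> real^'n^'n"
    and \<mu>\<^sub>0 :: real
  assumes "continuous_on UNIV A" and "bounded (range A)"
    and "continuous_on UNIV B" and "bounded (range B)"
    and "continuous_on UNIV f" and "bounded (range f)"
    and "\<mu>\<^sub>0 > 0" and "\<And>t x. norm (B t *v x) \<ge> \<mu>\<^sub>0 * norm x"
    and "evolution_family A U"
    and "growth_bound U < 0"
  shows "(\<forall>\<alpha> :: 'n \<Rightarrow> nat. \<exists>C>0. \<forall>s t. 0 < t - s \<and> t - s < 1 \<longrightarrow>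
            L2_op_norm (evol_measure U B f t) (evol_measure U B f s) (deriv_evol_L2 U B f \<alpha> s t)
              \<le> ennreal (C * (t - s) powr (- real (mindex_order \<alpha>) / 2)))
       \<and> (\<forall>\<alpha> :: 'n \<Rightarrow> nat. \<forall>\<omega>. growth_bound U < \<omega> \<and> \<omega> < 0 \<longrightarrow> (\<exists>C>0. \<forall>s t. t - s > 1 \<longrightarrow>
            L2_op_norm (evol_measure U B f t) (evol_measure U B f s) (deriv_evol_L2 U B f \<alpha> s t)
              \<le> ennreal (C * exp (\<omega> * real (mindex_order \<alpha>) * (t - s)))))"
proof (intro conjI allI impI)
  obtain a where a: "0 < a" "\<And>t x. norm (A t *v x) \<le> a * norm x"
    using matrix_bounded_range[OF assms(2)] by metis
  obtain b where b: "\<And>t x. norm (B t *v x) \<le> b * norm x"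
    using matrix_bounded_range[OF assms(4)] by metis
  note ev = assms(9) a
  note bound = L2_op_norm_deriv_evol_le_power[OF ev assms(3) b assms(7,8) _ _ _ assms(5,6)]
  let ?c = "\<mu>\<^sub>0 * exp (- a)"
  have c: "0 < ?c"
    using assms(7) by simp
  {
    fix \<alpha> :: "'n \<Rightarrow> nat"
    let ?k = "mindex_order \<alpha>"
    \<comment> \<open>A negative rate above the growth bound makes the integrals defining nu_t and
      nu_s converge. As the growth bound is negative, half of it qualifies.\<close>
    obtain M where M: "1 \<le> M"
      "\<And>s t x. s \<le> t \<Longrightarrow> norm (U t s *v x) \<le> M * exp (growth_bound U / 2 * (t - s)) * norm x"
      by (rule growth_bound_less_imp[OF ev, of "growth_bound U / 2"]) (use assms(10) in auto)
    let ?C = "smoothing_const TYPE('n) ?k * (exp a / ?c) ^ ?k"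
    have "L2_op_norm (evol_measure U B f t) (evol_measure U B f s) (deriv_evol_L2 U B f \<alpha> s t)
        \<le> ennreal (?C * (t - s) powr (- real ?k / 2))" if st: "0 < t - s \<and> t - s < 1" for s t
    proof -
      have "norm (U t s *v x) \<le> exp a * norm x" for x
      proof -
        have "exp (a * \<bar>t - s\<bar>) \<le> exp a"
          using st a(1) by (simp add: mult_left_le)
        then have "exp (a * \<bar>t - s\<bar>) * norm x \<le> exp a * norm x"
          by (rule mult_right_mono) simp
        then show ?thesis
          using evolution_norm_le[OF ev, of t s x] by linarith
      qed
      \<comment> \<open>Taking h = t - s and d = e^a: the whole short interval smooths, and the
        power of sqrt h gives the singularity.\<close>
      then have "L2_op_norm (evol_measure U B f t) (evol_measure U B f s) (deriv_evol_L2 U B f \<alpha> s t)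
        \<le> ennreal (smoothing_const TYPE('n) ?k * (exp a / (?c * sqrt (t - s))) ^ ?k)"
        using assms(10) st by (intro bound[OF M(1) _ M(2)]) auto
      also have "(exp a / (?c * sqrt (t - s))) ^ ?k = (exp a / ?c) ^ ?k * (1 / sqrt (t - s)) ^ ?k"
        by (simp flip: power_mult_distrib)
      also have "(1 / sqrt (t - s)) ^ ?k = (t - s) powr (- real ?k / 2)"
      proof -
        have "1 / sqrt (t - s) = (t - s) powr (- 1 / 2)"
          using st by (simp add: powr_minus_divide flip: powr_half_sqrt)
        then show ?thesis
          using st by (simp add: powr_power)
      qed
      finally show ?thesis
        by (simp only: mult.assoc)
    qed
    moreover have "0 < ?C"
      using c smoothing_const_pos[where 'n = 'n, of ?k] by simp
    ultimately show "\<exists>C>0. \<forall>s t. 0 < t - s \<and> t - s < 1 \<longrightarrow>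
        L2_op_norm (evol_measure U B f t) (evol_measure U B f s) (deriv_evol_L2 U B f \<alpha> s t)
          \<le> ennreal (C * (t - s) powr (- real ?k / 2))"
      by blast
  }
  {
    fix \<alpha> :: "'n \<Rightarrow> nat" and \<omega> :: real
    assume \<omega>: "growth_bound U < \<omega> \<and> \<omega> < 0"
    let ?k = "mindex_order \<alpha>"
    obtain M where M: "1 \<le> M" "\<And>s t x. s \<le> t \<Longrightarrow> norm (U t s *v x) \<le> M * exp (\<omega> * (t - s)) * norm x"
      by (rule growth_bound_less_imp[OF ev, of \<omega>]) (use \<omega> in auto)
    let ?C = "smoothing_const TYPE('n) ?k * (M / ?c) ^ ?k"
    have "L2_op_norm (evol_measure U B f t) (evol_measure U B f s) (deriv_evol_L2 U B f \<alpha> s t)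
        \<le> ennreal (?C * exp (\<omega> * real ?k * (t - s)))" if st: "1 < t - s" for s t
    proof -
      \<comment> \<open>Taking h = 1 and d = M e^(omega (t - s)): the smoothing bound stays fixed,
        and each derivative contributes one factor d.\<close>
      have "L2_op_norm (evol_measure U B f t) (evol_measure U B f s) (deriv_evol_L2 U B f \<alpha> s t)
        \<le> ennreal (smoothing_const TYPE('n) ?k * (M * exp (\<omega> * (t - s)) / (?c * sqrt 1)) ^ ?k)"
        using \<omega> M(1) st by (intro bound[OF M(1) _ M(2)] M(2)) auto
      also have "(M * exp (\<omega> * (t - s)) / (?c * sqrt 1)) ^ ?k = (M / ?c) ^ ?k * exp (\<omega> * (t - s)) ^ ?k"
        by (simp flip: power_mult_distrib)
      also have "exp (\<omega> * (t - s)) ^ ?k = exp (\<omega> * real ?k * (t - s))"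
        by (simp add: mult_ac flip: exp_of_nat_mult)
      finally show ?thesis
        by (simp only: mult.assoc)
    qed
    moreover have "0 < ?C"
      using c M(1) smoothing_const_pos[where 'n = 'n, of ?k] by simp
    ultimately show "\<exists>C>0. \<forall>s t. 1 < t - s \<longrightarrow>
        L2_op_norm (evol_measure U B f t) (evol_measure U B f s) (deriv_evol_L2 U B f \<alpha> s t)
          \<le> ennreal (C * exp (\<omega> * real ?k * (t - s)))"
      by blast
  }
qed

end
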